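(* Let $U=N\times(\mathbb R^{k-m}\times T^m)\to N$ be a toroidal domain of a $k$-dimensional commutative dynamical algebra $\mathcal A$, and let $w$ be a Poisson structure on $U$ such that $(w,\mathcal A)$ is a partially integrable system on the Poisson manifold $(U,w)$. Then there exists a toroidal domain $U'\subset U$ equipped with partial action-angle coordinates $(I_a,I_i,z^A,x^a,\phi^i)$ such that, restricted to $U'$, the Poisson bivector field takes the canonical form $$w=\partial^a\wedge\partial_a+\partial^i\wedge\partial_i,$$ while the dynamical algebra $\mathcal A$ is generated by the Hamiltonian vector fields of the action coordinate functions $H_a=I_a$, $H_i=I_i$.
   Context: Setting. $\mathcal A$ is a commutative dynamical algebra on a smooth manifold $Z$: given $k$ mutually commuting vector fields $\vartheta_\lambda$ on $Z$, independent almost everywhere (the set where $\vartheta_1\wedge\dots\wedge\vartheta_k$ vanishes is nowhere dense), $\mathcal S$ is the ring of smooth functions annihilated by all $\vartheta_\lambda$ (integrals of motion) and $\mathcal A$ is the $k$-dimensional $\mathcal S$-Lie algebra generated by the $\vartheta_\lambda$. On an open subset, $\mathcal A$ and $\mathcal S$ are understood as restricted to it. Toroidal domain $U$: an open subset of $Z$, a neighbourhood of a regular invariant manifold of $\mathcal A$ (an orbit of the flows of the $\vartheta_\lambda$ on which $\vartheta_1\wedge\dots\wedge\vartheta_k\ne0$), presented as a trivial principal bundle $\pi:U=N\times(\mathbb R^{k-m}\times T^m)\to N$ over a domain $N\subset\mathbb R^{\dim Z-k}$ whose fibers are invariant manifolds. It carries coordinates $(r^A)$ on $N$ and standard coordinates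 $(y^\lambda)=(t^a,\varphi^i)$, $a=1,\dots,k-m$, $i=1,\dots,m$, on $\mathbb R^{k-m}\times T^m$, in which $$\vartheta_a=\partial_a,\qquad \vartheta_i=-(BC^{-1})_i^a(r)\partial_a+(C^{-1})_i^k(r)\partial_k$$ with $B,C$ smooth matrix functions on $N$ and $C$ nondegenerate; so on $U$ one has $\mathcal S=\pi^*C^\infty(N)$ and $\mathcal A$ is generated over $\mathcal S$ by $\partial/\partial y^\lambda$. A toroidal domain $U'\subset U$ is the part $\pi^{-1}(N')$ of $U$ over a domain $N'\subset N$, possibly with another trivialization $U'\cong N'\times(\mathbb R^{k-m}\times T^m)$ over $N'$. Partial action-angle coordinates on $U'$: $(I_\lambda,z^A)=(I_a,I_i,z^A)$, $A=1,\dots,\dim Z-2k$, are coordinates on the base $N'$, and $(x^a,\phi^i)$ are standard coordinates on the fiber $\mathbb R^{k-m}\times T^m$ ($\phi^i$ cyclic), $a=1,\dots,k-m$, $i=1,\dots,m$. Notation: $\partial^a=\partial/\partial I_a$, $\partial^i=\partial/\partial I_i$, $\partial_a=\partial/\partial x^a$, $\partial_i=\partial/\partial\phi^i$; summation over repeated indices. Partially integrable system (PIS): a $k$-dimensional commutative dynamical algebra $\mathcal A$ on a regular Poisson manifold is a PIS $(w,\mathcal A)$ if (a) $\mathcal A$ is generated (over $\mathcal S$) by the Hamiltonian vector fields of $k$ almost everywhere independent integrals of motion $H_\lambda$ in involution (the set where $dH_1\wedge\dots\wedge dH_k$ vanishes is nowhere dense), and (b) all elements of $\mathcal S$ are mutually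 in involution. The Hamiltonian vector field of $f$ is $-w\lfloor df$, i.e. the derivation $g\mapsto\{f,g\}$ of the Poisson bracket defined by $w$. *)

theory Defs
  imports "HOL-Analysis.Analysis"
begin

fun Ck_on :: "nat \<Rightarrow> 'a::euclidean_space set \<Rightarrow> ('a \<Rightarrow> 'b::real_normed_vector) \<Rightarrow> bool" where
  "Ck_on 0 S f \<longleftrightarrow> continuous_on S f"
| "Ck_on (Suc n) S f \<longleftrightarrow>
     (\<forall>x\<in>S. f differentiable (at x)) \<and> (\<forall>v. Ck_on n S (\<lambda>x. frechet_derivative f (at x) v))"

definition smooth_on :: "'a::euclidean_space set \<Rightarrow> ('a \<Rightarrow> 'b::real_normed_vector) \<Rightarrow> bool" where
  "smooth_on S f \<longleftrightarrow> (\<forall>n. Ck_on n S f)"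

definition smooth_diffeo ::
  "'a::euclidean_space set \<Rightarrow> 'a set \<Rightarrow> ('a \<Rightarrow> 'a) \<Rightarrow> ('a \<Rightarrow> 'a) \<Rightarrow> bool" where
  "smooth_diffeo S T f g \<longleftrightarrow>
     open S \<and> open T \<and> homeomorphism S T f g \<and> smooth_on S f \<and> smooth_on T g"

definition domain :: "'a::topological_space set \<Rightarrow> bool" where
  "domain N \<longleftrightarrow> open N \<and> connected N \<and> N \<noteq> {}"

text \<open>
  The fiber index type \<open>'k\<close> has \<open>k\<close> elements; \<open>J :: 'k set\<close>, with \<open>card J = m\<close>, is the set of
  cyclic indices, so that the indices \<open>a\<close> range over \<open>- J\<close> and the indices \<open>i\<close> over \<open>J\<close>
  (either may be empty).
  The manifold \<open>\<real>\<^bsup>k-m\<^esup> \<times> T\<^bsup>m\<^esup>\<close> is the embedded submanifold of \<open>complex^'k\<close> whose \<open>J\<close>-components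
  lie on the unit circle and whose other components are real.  The base index type \<open>'n\<close> has
  \<open>dim Z - k\<close> elements.
\<close>

type_synonym ('n, 'k) point = "(real^'n) \<times> (complex^'k)"

text \<open>
  Components \<open>(r\<^sup>A, y\<^sup>\<lambda>)\<close> of tangent vectors in the global frame \<open>\<partial>/\<partial>r\<^sup>A, \<partial>/\<partial>y\<^sup>\<lambda>\<close>, and also
  components of covectors in the dual coframe \<open>dr\<^sup>A, dy\<^sup>\<lambda>\<close>; the inner product is the duality
  pairing.
\<close>

type_synonym ('n, 'k) tvec = "(real^'n) \<times> (real^'k)"

definition cyl :: "'k::finite set \<Rightarrow> (complex^'k) set" where
  "cyl J = {u. \<forall>l. if l \<in> J then cmod (u $ l) = 1 else u $ l \<in> \<real>}"

text \<open>Standard coordinates \<open>y\<close> on the cylinder; the cyclic ones are defined modulo \<open>2\<pi>\<close>.\<close>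

definition cov :: "'k::finite set \<Rightarrow> real^'k \<Rightarrow> complex^'k" where
  "cov J y = (\<chi> l. if l \<in> J then cis (y $ l) else of_real (y $ l))"

text \<open>The translation action of \<open>\<real>\<^sup>k\<close>, with \<open>cov J (y + y') = act J y (cov J y')\<close>.\<close>

definition act :: "'k::finite set \<Rightarrow> real^'k \<Rightarrow> complex^'k \<Rightarrow> complex^'k" where
  "act J y u = (\<chi> l. if l \<in> J then cis (y $ l) * u $ l else of_real (y $ l) + u $ l)"

definition smooth_cyl ::
  "'k::finite set \<Rightarrow> (real^'n::finite) set \<Rightarrow> (('n, 'k) point \<Rightarrow> 'b::real_normed_vector) \<Rightarrow> bool" where
  "smooth_cyl J N f \<longleftrightarrow> smooth_on (N \<times> UNIV) (\<lambda>(r, y). f (r, cov J y))"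

text \<open>\<open>deriv_cyl J f p v\<close> is the derivative of \<open>f\<close> at \<open>p\<close> along \<open>v\<^sup>A \<partial>/\<partial>r\<^sup>A + v\<^sup>\<lambda> \<partial>/\<partial>y\<^sup>\<lambda>\<close>.\<close>

definition deriv_cyl ::
  "'k::finite set \<Rightarrow> (('n::finite, 'k) point \<Rightarrow> 'b::real_normed_vector) \<Rightarrow> ('n, 'k) point
     \<Rightarrow> ('n, 'k) tvec \<Rightarrow> 'b" where
  "deriv_cyl J f p v =
     frechet_derivative (\<lambda>(r, y). f (r, act J y (snd p))) (at (fst p, 0)) v"

definition dif ::
  "'k::finite set \<Rightarrow> (('n::finite, 'k) point \<Rightarrow> real) \<Rightarrow> ('n, 'k) point \<Rightarrow> ('n, 'k) tvec" where
  "dif J f p = (\<Sum>b\<in>Basis. deriv_cyl J f p b *\<^sub>R b)"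

text \<open>
  Tangent map of a map \<open>G\<close> between such products, in the frames above.  A cyclic component
  \<open>u = exp (\<i> \<phi>)\<close> has \<open>d\<phi> = Im (cnj u du)\<close>.
\<close>

definition tangent ::
  "'k::finite set \<Rightarrow> (('n::finite, 'k) point \<Rightarrow> ('n, 'k) point) \<Rightarrow> ('n, 'k) point
     \<Rightarrow> ('n, 'k) tvec \<Rightarrow> ('n, 'k) tvec" where
  "tangent J G p v =
     (fst (deriv_cyl J G p v),
      \<chi> l. if l \<in> J then Im (cnj (snd (G p) $ l) * (snd (deriv_cyl J G p v) $ l))
           else Re (snd (deriv_cyl J G p v) $ l))"

text \<open>
  Only the entries \<open>C r $ i $ j\<close> with \<open>i, j \<in> J\<close> and \<open>B r $ a $ j\<close> with \<open>a \<notin> J\<close>, \<open>j \<in> J\<close> are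
  meaningful.  The \<open>J \<times> J\<close> block of \<open>C\<close> is extended by the identity matrix, so that its
  nondegeneracy and inverse are those of a matrix on the whole index type.
  In \<open>M $ i $ j\<close> the row \<open>i\<close> is the upper index.
\<close>

definition block :: "'k::finite set \<Rightarrow> real^'k^'k \<Rightarrow> real^'k^'k" where
  "block J M = (\<chi> i j. if i \<in> J \<and> j \<in> J then M $ i $ j else if i = j then 1 else 0)"

definition toroidal_domain ::
  "'k::finite set \<Rightarrow> (real^'n::finite) set \<Rightarrow> (real^'n \<Rightarrow> real^'k^'k) \<Rightarrow> (real^'n \<Rightarrow> real^'k^'k)
     \<Rightarrow> bool" where
  "toroidal_domain J N B C \<longleftrightarrow>
     domain N \<and>
     (\<forall>a\<in>-J. \<forall>j\<in>J. smooth_on N (\<lambda>r. B r $ a $ j)) \<and>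
     (\<forall>i\<in>J. \<forall>j\<in>J. smooth_on N (\<lambda>r. C r $ i $ j)) \<and>
     (\<forall>r\<in>N. invertible (block J (C r)))"

text \<open>
  The vector fields \<open>\<vartheta>\<^sub>a = \<partial>\<^sub>a\<close> and
  \<open>\<vartheta>\<^sub>i = - (B C\<^sup>-\<^sup>1)\<^sub>i\<^sup>a \<partial>\<^sub>a + (C\<^sup>-\<^sup>1)\<^sub>i\<^sup>k \<partial>\<^sub>k\<close>.
\<close>

definition theta ::
  "'k::finite set \<Rightarrow> (real^'n::finite \<Rightarrow> real^'k^'k) \<Rightarrow> (real^'n \<Rightarrow> real^'k^'k)
     \<Rightarrow> 'k \<Rightarrow> ('n, 'k) point \<Rightarrow> ('n, 'k) tvec" where
  "theta J B C l p =
     (let D = matrix_inv (block J (C (fst p)))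
      in (0, if l \<in> J then (\<chi> \<mu>. if \<mu> \<in> J then D $ \<mu> $ l else - (B (fst p) ** D) $ \<mu> $ l)
             else axis l 1))"

definition integrals ::
  "'k::finite set \<Rightarrow> (real^'n::finite) set \<Rightarrow> ('k \<Rightarrow> ('n, 'k) point \<Rightarrow> ('n, 'k) tvec)
     \<Rightarrow> (('n, 'k) point \<Rightarrow> real) set" where
  "integrals J N th =
     {f. smooth_cyl J N f \<and> (\<forall>l. \<forall>p\<in>N \<times> cyl J. deriv_cyl J f p (th l p) = 0)}"

text \<open>
  Functions and vector fields matter only through their values on \<open>N \<times> cyl J\<close>; the set below is
  closed under changes elsewhere.
\<close>

definition generated_by ::
  "'k::finite set \<Rightarrow> (real^'n::finite) set \<Rightarrow> (('n, 'k) point \<Rightarrow> real) set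
     \<Rightarrow> ('k \<Rightarrow> ('n, 'k) point \<Rightarrow> ('n, 'k) tvec) \<Rightarrow> (('n, 'k) point \<Rightarrow> ('n, 'k) tvec) set" where
  "generated_by J N S X =
     {Y. \<exists>s. (\<forall>l. s l \<in> S) \<and> (\<forall>p\<in>N \<times> cyl J. Y p = (\<Sum>l\<in>UNIV. s l p *\<^sub>R X l p))}"

text \<open>
  As the generators commute and are derivations over the ring of integrals, the Lie algebra they
  generate over this ring is their linear span over it.
\<close>

definition dyn_algebra ::
  "'k::finite set \<Rightarrow> (real^'n::finite) set \<Rightarrow> ('k \<Rightarrow> ('n, 'k) point \<Rightarrow> ('n, 'k) tvec)
     \<Rightarrow> (('n, 'k) point \<Rightarrow> ('n, 'k) tvec) set" where
  "dyn_algebra J N th = generated_by J N (integrals J N th) th"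

type_synonym ('n, 'k) bivector = "('n, 'k) point \<Rightarrow> ('n, 'k) tvec \<Rightarrow> ('n, 'k) tvec \<Rightarrow> real"

definition wedge :: "'e::real_inner \<Rightarrow> 'e \<Rightarrow> 'e \<Rightarrow> 'e \<Rightarrow> real" where
  "wedge X Y \<alpha> \<beta> = (\<alpha> \<bullet> X) * (\<beta> \<bullet> Y) - (\<alpha> \<bullet> Y) * (\<beta> \<bullet> X)"

definition pbracket ::
  "'k::finite set \<Rightarrow> ('n::finite, 'k) bivector \<Rightarrow> (('n, 'k) point \<Rightarrow> real)
     \<Rightarrow> (('n, 'k) point \<Rightarrow> real) \<Rightarrow> ('n, 'k) point \<Rightarrow> real" where
  "pbracket J w f g p = w p (dif J f p) (dif J g p)"

definition poisson_structure ::
  "'k::finite set \<Rightarrow> (real^'n::finite) set \<Rightarrow> ('n, 'k) bivector \<Rightarrow> bool" where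
  "poisson_structure J N w \<longleftrightarrow>
     (\<forall>p\<in>N \<times> cyl J. bilinear (w p) \<and> (\<forall>\<alpha>. w p \<alpha> \<alpha> = 0)) \<and>
     (\<forall>\<alpha> \<beta>. smooth_cyl J N (\<lambda>p. w p \<alpha> \<beta>)) \<and>
     (\<forall>f g h. smooth_cyl J N f \<longrightarrow> smooth_cyl J N g \<longrightarrow> smooth_cyl J N h \<longrightarrow>
        (\<forall>p\<in>N \<times> cyl J.
           pbracket J w f (pbracket J w g h) p + pbracket J w g (pbracket J w h f) p
             + pbracket J w h (pbracket J w f g) p = 0))"

definition sharp ::
  "('n::finite, 'k::finite) bivector \<Rightarrow> ('n, 'k) point \<Rightarrow> ('n, 'k) tvec \<Rightarrow> ('n, 'k) tvec" where
  "sharp w p \<alpha> = (\<Sum>b\<in>Basis. w p \<alpha> b *\<^sub>R b)"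

text \<open>The Hamiltonian vector field of \<open>f\<close> is the derivation \<open>g \<mapsto> {f, g}\<close>.\<close>

definition ham ::
  "'k::finite set \<Rightarrow> ('n::finite, 'k) bivector \<Rightarrow> (('n, 'k) point \<Rightarrow> real)
     \<Rightarrow> ('n, 'k) point \<Rightarrow> ('n, 'k) tvec" where
  "ham J w f p = sharp w p (dif J f p)"

definition regular_poisson ::
  "'k::finite set \<Rightarrow> (real^'n::finite) set \<Rightarrow> ('n, 'k) bivector \<Rightarrow> bool" where
  "regular_poisson J N w \<longleftrightarrow>
     poisson_structure J N w \<and> (\<exists>d. \<forall>p\<in>N \<times> cyl J. dim (range (sharp w p)) = d)"

text \<open>\<open>dH\<^sub>1 \<and> \<dots> \<and> dH\<^sub>k\<close>, evaluated on \<open>k\<close> tangent vectors at \<open>p\<close>.\<close>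

definition dwedge ::
  "'k::finite set \<Rightarrow> ('k \<Rightarrow> ('n::finite, 'k) point \<Rightarrow> real) \<Rightarrow> ('n, 'k) point
     \<Rightarrow> ('k \<Rightarrow> ('n, 'k) tvec) \<Rightarrow> real" where
  "dwedge J H p v = det (\<chi> i j. deriv_cyl J (H i) p (v j))"

definition ae_independent ::
  "'k::finite set \<Rightarrow> (real^'n::finite) set \<Rightarrow> ('k \<Rightarrow> ('n, 'k) point \<Rightarrow> real) \<Rightarrow> bool" where
  "ae_independent J N H \<longleftrightarrow>
     (let U = top_of_set (N \<times> cyl J)
      in U interior_of (U closure_of {p \<in> N \<times> cyl J. \<forall>v. dwedge J H p v = 0}) = {})"

definition partially_integrable ::
  "'k::finite set \<Rightarrow> (real^'n::finite) set \<Rightarrow> ('k \<Rightarrow> ('n, 'k) point \<Rightarrow> ('n, 'k) tvec)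
     \<Rightarrow> ('n, 'k) bivector \<Rightarrow> bool" where
  "partially_integrable J N th w \<longleftrightarrow>
     regular_poisson J N w \<and>
     (\<exists>H. (\<forall>l. H l \<in> integrals J N th) \<and>
          (\<forall>l \<mu>. \<forall>p\<in>N \<times> cyl J. pbracket J w (H l) (H \<mu>) p = 0) \<and>
          ae_independent J N H \<and>
          dyn_algebra J N th = generated_by J N (integrals J N th) (\<lambda>l. ham J w (H l))) \<and>
     (\<forall>f\<in>integrals J N th. \<forall>g\<in>integrals J N th. \<forall>p\<in>N \<times> cyl J. pbracket J w f g p = 0)"

text \<open>A trivialization over \<open>N\<close>, relative to the given one, with inverse \<open>T'\<close>.\<close>

definition trivialization ::
  "'k::finite set \<Rightarrow> (real^'n::finite) set \<Rightarrow> (('n, 'k) point \<Rightarrow> ('n, 'k) point)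
     \<Rightarrow> (('n, 'k) point \<Rightarrow> ('n, 'k) point) \<Rightarrow> bool" where
  "trivialization J N T T' \<longleftrightarrow>
     homeomorphism (N \<times> cyl J) (N \<times> cyl J) T T' \<and>
     smooth_cyl J N T \<and> smooth_cyl J N T' \<and>
     (\<forall>p\<in>N \<times> cyl J. fst (T p) = fst p)"

text \<open>
  Base coordinates \<open>\<psi> : N \<rightarrow> V\<close> together with standard fiber coordinates of a trivialization \<open>T\<close>.
  The components \<open>\<psi> $ \<iota> \<lambda>\<close> are the action coordinates \<open>I\<^sub>\<lambda>\<close>, the other \<open>dim Z - 2 k\<close> components
  are the \<open>z\<^sup>A\<close>, and the fiber coordinates are \<open>x\<^sup>a\<close> (\<open>a \<notin> J\<close>) and \<open>\<phi>\<^sup>i\<close> (\<open>i \<in> J\<close>).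
\<close>

definition aa_coordinates ::
  "'k::finite set \<Rightarrow> (real^'n::finite) set \<Rightarrow> (real^'n) set \<Rightarrow> (real^'n \<Rightarrow> real^'n)
     \<Rightarrow> (real^'n \<Rightarrow> real^'n) \<Rightarrow> (('n, 'k) point \<Rightarrow> ('n, 'k) point)
     \<Rightarrow> (('n, 'k) point \<Rightarrow> ('n, 'k) point) \<Rightarrow> ('k \<Rightarrow> 'n) \<Rightarrow> bool" where
  "aa_coordinates J N V \<psi> \<psi>' T T' \<iota> \<longleftrightarrow>
     smooth_diffeo N V \<psi> \<psi>' \<and> trivialization J N T T' \<and> inj \<iota>"

text \<open>
  The vector field which the coordinate map \<open>(r, u) \<mapsto> (\<psi> r, snd (T (r, u)))\<close> carries to the
  constant vector field \<open>e\<close> on \<open>V \<times> cyl J\<close>.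
\<close>

definition coord_field ::
  "'k::finite set \<Rightarrow> (real^'n::finite \<Rightarrow> real^'n) \<Rightarrow> (real^'n \<Rightarrow> real^'n)
     \<Rightarrow> (('n, 'k) point \<Rightarrow> ('n, 'k) point) \<Rightarrow> (('n, 'k) point \<Rightarrow> ('n, 'k) point)
     \<Rightarrow> ('n, 'k) tvec \<Rightarrow> ('n, 'k) point \<Rightarrow> ('n, 'k) tvec" where
  "coord_field J \<psi> \<psi>' T T' e p =
     tangent J (\<lambda>(\<rho>, u). T' (\<psi>' \<rho>, u)) (\<psi> (fst p), snd (T p)) e"

end

theory Submission
  imports Defs
begin

text \<open>
  The universal cover of \<open>N \<times> (\<real>\<^bsup>k-m\<^esup> \<times> T\<^bsup>m\<^esup>)\<close> is \<open>N \<times> \<real>\<^bsup>k\<^esup>\<close>. There all fibre coordinates \<open>y\<close> are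
  global, and \<open>w\<close> becomes a Poisson bivector \<open>W\<close> which is \<open>2\<pi>\<close>-periodic in the cyclic \<open>y\<^sub>i\<close>. The
  argument takes place there and descends at the end.

  The integrals of motion are the functions of \<open>r \<in> N\<close> alone, and they are in involution, so
  \<open>{r\<^sup>A, r\<^sup>B} = 0\<close>. The Hamiltonian fields of the given integrals \<open>H\<^sub>\<lambda>\<close> are vertical, constant along
  the fibres, and form a frame of the vertical directions at every point. With the Jacobi identity
  this makes all brackets \<open>{r\<^sup>A, y\<^sub>\<mu>}\<close> functions of \<open>r\<close>.

  Take any \<open>k\<close> functions \<open>K\<^sub>\<lambda>\<close> on a part of \<open>N\<close> with Hamiltonian fields \<open>A\<^sub>\<lambda>\<^sub>\<mu>(r) \<partial>/\<partial>y\<^sub>\<mu>\<close>, \<open>A\<close> invertible,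
  and let \<open>R\<close> be the inverse of \<open>A\<close> and \<open>y'\<^sub>\<lambda> = y\<^sub>\<mu> R\<^sub>\<mu>\<^sub>\<lambda>\<close>. Then \<open>{K\<^sub>\<lambda>, y'\<^sub>\<mu>} = \<delta>\<^sub>\<lambda>\<^sub>\<mu>\<close>, and Jacobi identities
  for \<open>K\<close>, \<open>y'\<close> and functions of \<open>r\<close> show that \<open>P\<^sub>\<lambda>\<^sub>\<mu> = {y'\<^sub>\<lambda>, y'\<^sub>\<mu>}\<close> depends on \<open>r\<close> only, that the fields
  \<open>Y\<^sub>\<lambda> = {\<cdot>, y'\<^sub>\<lambda>}\<close> on the base commute (\<open>Y_commute\<close>), and that \<open>P\<close> is closed along their orbits
  (\<open>P_closed\<close>). Commuting fields are simultaneously straightened (\<open>rectify_commuting_fields\<close>), which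
  gives base coordinates \<open>(I, z)\<close> with \<open>Y\<^sub>\<lambda> = \<partial>/\<partial>I\<^sub>\<lambda>\<close>. A primitive \<open>\<tau>\<close> of \<open>P\<close> along the leaves
  \<open>z = const\<close> removes the remaining brackets: \<open>I\<close>, \<open>z\<close> and \<open>y' - \<tau>\<close> are canonical (\<open>canonical_chart\<close>).

  These coordinates descend to the cylinder when the row \<open>A\<^sub>i\<close> of each cyclic index is the unit vector,
  that is, when the Hamiltonian field of \<open>K\<^sub>i\<close> is \<open>\<partial>/\<partial>y\<^sub>i\<close>. Start with \<open>K = H\<close>. The function \<open>K\<^sub>i\<close> sought
  must satisfy \<open>Y\<^sub>\<lambda> K\<^sub>i = R\<^sub>i\<^sub>\<lambda>\<close>, so the 1-form \<open>R\<^sub>i\<^sub>\<lambda>\<close> along the leaves has to be closed. This is where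
  periodicity enters (\<open>cyclic_row_closed\<close>): translation by \<open>2\<pi>\<close> in \<open>y\<^sub>i\<close> preserves \<open>W\<close> and adds
  \<open>2\<pi>R\<^sub>i\<^sub>\<lambda>\<close> to \<open>y'\<^sub>\<lambda>\<close>, hence does not change \<open>{y'\<^sub>\<lambda>, y'\<^sub>\<mu>}\<close>. The Poincare lemma provides \<open>K\<^sub>i\<close>; the other
  \<open>K\<^sub>a\<close> are constant combinations of the \<open>H\<^sub>\<lambda>\<close> chosen such that \<open>A\<close> is the identity at a base point
  (\<open>adapted_momenta_exist\<close>). Then the construction above is carried out with these \<open>K\<close>.

  The analytic core is the straightening of commuting fields, with smooth dependence on all variables.
  Along the rays \<open>s \<mapsto> \<sigma> s \<rho>\<close>, which join a transversal to the point with coordinates \<open>\<rho>\<close>, the inverse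
  chart \<open>x\<close> solves \<open>x(\<rho>) = b(\<rho>) + \<integral> F(s, \<rho>, x(\<sigma> s \<rho>)) ds\<close>. Its partial derivatives solve linear equations
  of the same kind, and this yields smoothness by induction on the number of derivatives (\<open>solves_Ck\<close>).
\<close>

section \<open>Functions of class \<open>C\<^sup>k\<close>\<close>

text \<open>
  Both sides are choices from the same set of derivatives, so differentiability is not an issue.
\<close>

lemma frechet_derivative_cong_open:
  assumes "open S" "x \<in> S" "\<And>z. z \<in> S \<Longrightarrow> f z = g z"
  shows "frechet_derivative f (at x) = frechet_derivative g (at x)"
proof -
  have "(f has_derivative D) (at x) \<longleftrightarrow> (g has_derivative D) (at x)" for D
    using assms has_derivative_transform_within_open[of f D x UNIV S g]
      has_derivative_transform_within_open[of g D x UNIV S f] by auto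
  then show ?thesis
    unfolding frechet_derivative_def by simp
qed

lemma frechet_derivative_eqI:
  "(f has_derivative D) (at x) \<Longrightarrow> frechet_derivative f (at x) = D"
  using frechet_derivative_at by metis

lemma Ck_on_cong:
  assumes "open S" "\<And>x. x \<in> S \<Longrightarrow> f x = g x" "Ck_on n S f"
  shows "Ck_on n S g"
  using assms(2,3)
proof (induction n arbitrary: f g)
  case 0
  then show ?case by (auto cong: continuous_on_cong)
next
  case (Suc n)
  have eq: "frechet_derivative f (at x) = frechet_derivative g (at x)" if "x \<in> S" for x
    using frechet_derivative_cong_open[OF assms(1) that Suc.prems(1)] .
  have "g differentiable (at x)" if "x \<in> S" for x
    using Suc.prems that assms(1) unfolding differentiable_def
    by (metis (no_types, lifting) Ck_on.simps(2) differentiable_def has_derivative_transform_within_open)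
  moreover have "Ck_on n S (\<lambda>x. frechet_derivative g (at x) v)" for v
    by (rule Suc.IH[of "\<lambda>x. frechet_derivative f (at x) v"]) (use Suc.prems eq in auto)
  ultimately show ?case by simp
qed

lemma Ck_on_subset: "Ck_on n S f \<Longrightarrow> T \<subseteq> S \<Longrightarrow> Ck_on n T f"
  by (induction n arbitrary: f) (auto intro: continuous_on_subset)

lemma Ck_on_imp_continuous_on: "Ck_on n S f \<Longrightarrow> continuous_on S f"
  by (cases n) (auto intro!: continuous_at_imp_continuous_on differentiable_imp_continuous_within)

lemma Ck_on_SucD: "Ck_on (Suc n) S f \<Longrightarrow> Ck_on n S f"
proof (induction n arbitrary: f)
  case 0
  then show ?case using Ck_on_imp_continuous_on by fastforce
next
  case (Suc n)
  then show ?case by (metis Ck_on.simps(2))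
qed

lemma Ck_on_le: "Ck_on n S f \<Longrightarrow> m \<le> n \<Longrightarrow> Ck_on m S f"
proof (induction n)
  case (Suc n)
  then show ?case using Ck_on_SucD by (cases "m = Suc n") auto
qed simp

lemma Ck_on_SucI:
  assumes "open S" "\<And>x. x \<in> S \<Longrightarrow> (f has_derivative D x) (at x)"
    and "\<And>v. Ck_on n S (\<lambda>x. D x v)"
  shows "Ck_on (Suc n) S f"
proof -
  have "Ck_on n S (\<lambda>x. frechet_derivative f (at x) v)" for v
    by (rule Ck_on_cong[OF assms(1) _ assms(3)[of v]]) (use assms(2) frechet_derivative_eqI in metis)
  then show ?thesis using assms(2) by (auto simp: differentiable_def)
qed

lemma Ck_on_Suc_has_derivative:
  "Ck_on (Suc n) S f \<Longrightarrow> x \<in> S \<Longrightarrow> (f has_derivative frechet_derivative f (at x)) (at x)"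
  using frechet_derivative_works by auto

lemma Ck_on_frechet_derivative:
  "Ck_on (Suc n) S f \<Longrightarrow> Ck_on n S (\<lambda>x. frechet_derivative f (at x) v)"
  by simp

lemma Ck_on_const: "open S \<Longrightarrow> Ck_on n S (\<lambda>x. c)"
proof (induction n arbitrary: c)
  case 0
  then show ?case by simp
next
  case (Suc n)
  show ?case by (rule Ck_on_SucI[where D="\<lambda>x v. 0"]) (use Suc in auto)
qed

lemma Ck_on_bounded_linear:
  assumes "open S" "bounded_linear L" "Ck_on n S f"
  shows "Ck_on n S (\<lambda>x. L (f x))"
  using assms(3)
proof (induction n arbitrary: f)
  case 0
  then show ?case using assms(2) by (auto intro: bounded_linear.continuous_on)
next
  case (Suc n)
  show ?case
  proof (rule Ck_on_SucI[where D="\<lambda>x v. L (frechet_derivative f (at x) v)"])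
    show "((\<lambda>x. L (f x)) has_derivative (\<lambda>v. L (frechet_derivative f (at x) v))) (at x)"
      if "x \<in> S" for x
      using bounded_linear.has_derivative[OF assms(2) Ck_on_Suc_has_derivative[OF Suc.prems that]] .
  qed (use Suc assms in auto)
qed

lemma Ck_on_linear_map:
  fixes L :: "'a::euclidean_space \<Rightarrow> 'b::real_normed_vector"
  assumes "open S" "bounded_linear L"
  shows "Ck_on n S L"
proof (cases n)
  case 0
  then show ?thesis using assms linear_continuous_on by auto
next
  case (Suc m)
  show ?thesis unfolding Suc
    by (rule Ck_on_SucI[where D="\<lambda>x. L"])
       (use assms in \<open>auto intro!: Ck_on_const bounded_linear_imp_has_derivative\<close>)
qed

lemma Ck_on_add:
  assumes "open S" "Ck_on n S f" "Ck_on n S g"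
  shows "Ck_on n S (\<lambda>x. f x + g x)"
  using assms(2,3)
proof (induction n arbitrary: f g)
  case 0
  then show ?case by (auto intro: continuous_intros)
next
  case (Suc n)
  show ?case
    by (rule Ck_on_SucI[where
          D="\<lambda>x v. frechet_derivative f (at x) v + frechet_derivative g (at x) v"])
      (use Suc assms in \<open>auto intro!: has_derivative_add Ck_on_Suc_has_derivative[of n S]\<close>)
qed

lemma Ck_on_sum:
  assumes "open S" "\<And>i. i \<in> A \<Longrightarrow> Ck_on n S (f i)"
  shows "Ck_on n S (\<lambda>x. \<Sum>i\<in>A. f i x)"
  using assms(2)
  by (induction A rule: infinite_finite_induct) (auto intro!: Ck_on_add Ck_on_const assms(1))

lemma Ck_on_bilinear:
  assumes "open S" "bounded_bilinear B" "Ck_on n S f" "Ck_on n S g"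
  shows "Ck_on n S (\<lambda>x. B (f x) (g x))"
  using assms(3,4)
proof (induction n arbitrary: f g)
  case 0
  then show ?case using assms(2) by (auto intro: bounded_bilinear.continuous_on)
next
  case (Suc n)
  show ?case
  proof (rule Ck_on_SucI[where
      D="\<lambda>x v. B (f x) (frechet_derivative g (at x) v) + B (frechet_derivative f (at x) v) (g x)"])
    fix x assume x: "x \<in> S"
    show "((\<lambda>x. B (f x) (g x)) has_derivative
        (\<lambda>v. B (f x) (frechet_derivative g (at x) v) + B (frechet_derivative f (at x) v) (g x))) (at x)"
      using bounded_bilinear.FDERIV[OF assms(2) Ck_on_Suc_has_derivative[OF Suc.prems(1) x]
          Ck_on_Suc_has_derivative[OF Suc.prems(2) x]] .
  next
    fix v
    show "Ck_on n S (\<lambda>x. B (f x) (frechet_derivative g (at x) v) + B (frechet_derivative f (at x) v) (g x))"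
      by (intro Ck_on_add assms Suc.IH Ck_on_SucD[OF Suc.prems(1)] Ck_on_SucD[OF Suc.prems(2)]
          Ck_on_frechet_derivative[OF Suc.prems(1)] Ck_on_frechet_derivative[OF Suc.prems(2)])
  qed (fact assms)
qed

lemma linear_eq_sum_Basis:
  fixes L :: "'a::euclidean_space \<Rightarrow> 'b::real_vector"
  assumes "linear L"
  shows "L v = (\<Sum>b\<in>Basis. (v \<bullet> b) *\<^sub>R L b)"
proof -
  have "L v = L (\<Sum>b\<in>Basis. (v \<bullet> b) *\<^sub>R b)" by (simp add: euclidean_representation)
  also have "\<dots> = (\<Sum>b\<in>Basis. (v \<bullet> b) *\<^sub>R L b)"
    using assms by (simp add: linear_sum linear_cmul)
  finally show ?thesis .
qed

lemma Ck_on_compose: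
  fixes g :: "'a::euclidean_space \<Rightarrow> 'b::euclidean_space" and f :: "'b \<Rightarrow> 'c::real_normed_vector"
  assumes "open S" "open T" "Ck_on n S g" "Ck_on n T f" "g ` S \<subseteq> T"
  shows "Ck_on n S (\<lambda>x. f (g x))"
  using assms(3,4)
proof (induction n arbitrary: f)
  case 0
  then show ?case using assms(5) continuous_on_compose2[of T f S g] by simp
next
  case (Suc n)
  let ?D = "\<lambda>x v. \<Sum>b\<in>Basis. (frechet_derivative g (at x) v \<bullet> b) *\<^sub>R frechet_derivative f (at (g x)) b"
  show ?case
  proof (rule Ck_on_SucI[where D="?D"])
    fix x assume x: "x \<in> S"
    have df: "(f has_derivative frechet_derivative f (at (g x))) (at (g x))"
      using Ck_on_Suc_has_derivative[OF Suc.prems(2), of "g x"] assms(5) x by blast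
    have "?D x = (\<lambda>v. frechet_derivative f (at (g x)) (frechet_derivative g (at x) v))"
      by (intro ext linear_eq_sum_Basis[OF has_derivative_linear[OF df], symmetric])
    moreover have "((\<lambda>x. f (g x)) has_derivative
        (\<lambda>v. frechet_derivative f (at (g x)) (frechet_derivative g (at x) v))) (at x)"
      using diff_chain_at[OF Ck_on_Suc_has_derivative[OF Suc.prems(1) x] df] by (simp add: o_def)
    ultimately show "((\<lambda>x. f (g x)) has_derivative ?D x) (at x)" by simp
  next
    fix v
    show "Ck_on n S (\<lambda>x. ?D x v)"
    proof (intro Ck_on_sum Ck_on_bilinear[OF assms(1) bounded_bilinear_scaleR] assms)
      fix b :: 'b
      show "Ck_on n S (\<lambda>x. frechet_derivative g (at x) v \<bullet> b)"
        by (rule Ck_on_bounded_linear[OF assms(1) bounded_linear_inner_left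
              Ck_on_frechet_derivative[OF Suc.prems(1)]])
      show "Ck_on n S (\<lambda>x. frechet_derivative f (at (g x)) b)"
        by (rule Suc.IH[OF Ck_on_SucD[OF Suc.prems(1)] Ck_on_frechet_derivative[OF Suc.prems(2)]])
    qed
  qed (fact assms)
qed

lemma Ck_on_inverse:
  fixes f :: "'a::euclidean_space \<Rightarrow> real"
  assumes "open S" "Ck_on n S f" "\<And>x. x \<in> S \<Longrightarrow> f x \<noteq> 0"
  shows "Ck_on n S (\<lambda>x. inverse (f x))"
  using assms(2)
proof (induction n)
  case 0
  then show ?case using assms(3) by (auto intro!: continuous_intros)
next
  case (Suc n)
  let ?D = "\<lambda>x v. - (inverse (f x) * frechet_derivative f (at x) v * inverse (f x))"
  show ?case
  proof (rule Ck_on_SucI[where D="?D"])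
    fix x assume x: "x \<in> S"
    show "((\<lambda>x. inverse (f x)) has_derivative ?D x) (at x)"
      using Ck_on_Suc_has_derivative[OF Suc.prems x] assms(3)[OF x]
      by (intro Deriv.has_derivative_inverse) auto
  next
    fix v
    have *: "Ck_on n S (\<lambda>x. inverse (f x))" "Ck_on n S (\<lambda>x. frechet_derivative f (at x) v)"
      using Suc.IH[OF Ck_on_SucD[OF Suc.prems]] Ck_on_frechet_derivative[OF Suc.prems] by auto
    show "Ck_on n S (\<lambda>x. ?D x v)"
      by (intro Ck_on_bounded_linear[OF assms(1) bounded_linear_minus[OF bounded_linear_ident]]
            Ck_on_bilinear[OF assms(1) bounded_bilinear_mult] *)
  qed (fact assms)
qed

lemma smooth_onD: "smooth_on S f \<Longrightarrow> Ck_on n S f"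
  by (simp add: smooth_on_def)

lemma smooth_on_cong: "open S \<Longrightarrow> (\<And>x. x \<in> S \<Longrightarrow> f x = g x) \<Longrightarrow> smooth_on S f \<Longrightarrow> smooth_on S g"
  using Ck_on_cong[of S f g] by (simp add: smooth_on_def)

lemma smooth_on_subset: "smooth_on S f \<Longrightarrow> T \<subseteq> S \<Longrightarrow> smooth_on T f"
  using Ck_on_subset[of _ S f T] by (simp add: smooth_on_def)

lemma smooth_on_continuous: "smooth_on S f \<Longrightarrow> continuous_on S f"
  using Ck_on_imp_continuous_on[of 0 S f] by (simp add: smooth_on_def)

lemma smooth_on_has_derivative:
  "smooth_on S f \<Longrightarrow> x \<in> S \<Longrightarrow> (f has_derivative frechet_derivative f (at x)) (at x)"
  using Ck_on_Suc_has_derivative[of 0 S f x] by (simp add: smooth_on_def del: Ck_on.simps)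

lemma smooth_on_frechet_derivative:
  "smooth_on S f \<Longrightarrow> smooth_on S (\<lambda>x. frechet_derivative f (at x) v)"
  using Ck_on.simps(2)[of _ S f] by (auto simp: smooth_on_def simp del: Ck_on.simps)

lemma smooth_on_const: "open S \<Longrightarrow> smooth_on S (\<lambda>x. c)"
  by (simp add: smooth_on_def Ck_on_const)

lemma smooth_on_linear_map:
  fixes L :: "'a::euclidean_space \<Rightarrow> 'b::real_normed_vector"
  shows "open S \<Longrightarrow> bounded_linear L \<Longrightarrow> smooth_on S L"
  by (simp add: smooth_on_def Ck_on_linear_map)

lemma smooth_on_bounded_linear:
  "open S \<Longrightarrow> bounded_linear L \<Longrightarrow> smooth_on S f \<Longrightarrow> smooth_on S (\<lambda>x. L (f x))"
  by (simp add: smooth_on_def Ck_on_bounded_linear)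

lemma smooth_on_add: "open S \<Longrightarrow> smooth_on S f \<Longrightarrow> smooth_on S g \<Longrightarrow> smooth_on S (\<lambda>x. f x + g x)"
  by (simp add: smooth_on_def Ck_on_add)

lemma smooth_on_minus: "open S \<Longrightarrow> smooth_on S f \<Longrightarrow> smooth_on S (\<lambda>x. - f x)"
  by (rule smooth_on_bounded_linear[OF _ bounded_linear_minus[OF bounded_linear_ident]])

lemma smooth_on_sum:
  "open S \<Longrightarrow> (\<And>i. i \<in> A \<Longrightarrow> smooth_on S (f i)) \<Longrightarrow> smooth_on S (\<lambda>x. \<Sum>i\<in>A. f i x)"
  by (simp add: smooth_on_def Ck_on_sum)

lemma smooth_on_bilinear:
  "open S \<Longrightarrow> bounded_bilinear B \<Longrightarrow> smooth_on S f \<Longrightarrow> smooth_on S g \<Longrightarrow> smooth_on S (\<lambda>x. B (f x) (g x))"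
  by (simp add: smooth_on_def Ck_on_bilinear)

lemmas smooth_on_scaleR = smooth_on_bilinear[OF _ bounded_bilinear_scaleR]
lemmas smooth_on_mult = smooth_on_bilinear[OF _ bounded_bilinear_mult]
lemmas smooth_on_inner = smooth_on_bilinear[OF _ bounded_bilinear_inner]

lemma smooth_on_compose:
  fixes g :: "'a::euclidean_space \<Rightarrow> 'b::euclidean_space" and f :: "'b \<Rightarrow> 'c::real_normed_vector"
  shows "open S \<Longrightarrow> open T \<Longrightarrow> smooth_on S g \<Longrightarrow> smooth_on T f \<Longrightarrow> g ` S \<subseteq> T
    \<Longrightarrow> smooth_on S (\<lambda>x. f (g x))"
  by (simp add: smooth_on_def Ck_on_compose[of S T])

lemma Ck_on_prod:
  fixes f :: "'i \<Rightarrow> 'a::euclidean_space \<Rightarrow> real"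
  assumes "open S" "\<And>i. i \<in> A \<Longrightarrow> Ck_on n S (f i)"
  shows "Ck_on n S (\<lambda>x. \<Prod>i\<in>A. f i x)"
  using assms(2)
  by (induction A rule: infinite_finite_induct)
     (auto intro!: Ck_on_bilinear[OF _ bounded_bilinear_mult] Ck_on_const assms(1))

lemma bounded_linear_vec_axis:
  "bounded_linear (\<lambda>c::'a::real_normed_vector. axis i c :: 'a^'n::finite)"
proof (rule bounded_linear_intro[where K=1])
  show "norm (axis i x :: 'a^'n) \<le> norm x * 1" for x :: 'a
  proof -
    have "norm (axis i x :: 'a^'n) \<le> (\<Sum>j\<in>UNIV. norm ((axis i x :: 'a^'n) $ j))"
      unfolding norm_vec_def by (rule L2_set_le_sum) auto
    also have "\<dots> = (\<Sum>j\<in>UNIV. if j = i then norm x else 0)"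
      by (intro sum.cong) (auto simp: axis_def)
    finally show ?thesis by simp
  qed
qed (auto simp: axis_def vec_eq_iff)

lemma vec_lambda_eq_sum_axis: "(\<chi> i. f i) = (\<Sum>i\<in>UNIV. axis i (f i :: 'a::real_normed_vector) :: 'a^'n::finite)"
  by (simp add: vec_eq_iff axis_def sum.delta if_distrib cong: if_cong)

lemma Ck_on_vec_lambda:
  fixes f :: "'n::finite \<Rightarrow> 'a::euclidean_space \<Rightarrow> 'b::real_normed_vector"
  assumes "open S" "\<And>i. Ck_on n S (f i)"
  shows "Ck_on n S (\<lambda>x. \<chi> i. f i x)"
  unfolding vec_lambda_eq_sum_axis
  by (intro Ck_on_sum Ck_on_bounded_linear[OF assms(1) bounded_linear_vec_axis] assms)

lemma smooth_on_vec_lambda: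
  fixes f :: "'n::finite \<Rightarrow> 'a::euclidean_space \<Rightarrow> 'b::real_normed_vector"
  shows "open S \<Longrightarrow> (\<And>i. smooth_on S (f i)) \<Longrightarrow> smooth_on S (\<lambda>x. \<chi> i. f i x)"
  by (simp add: smooth_on_def Ck_on_vec_lambda)

lemma smooth_on_vec_nth:
  "open S \<Longrightarrow> smooth_on S f \<Longrightarrow> smooth_on S (\<lambda>x. f x $ i)"
  by (rule smooth_on_bounded_linear[OF _ bounded_linear_vec_nth])

lemma Ck_on_Pair:
  assumes "open S" "Ck_on n S f" "Ck_on n S g"
  shows "Ck_on n S (\<lambda>x. (f x, g x))"
proof -
  have b: "bounded_linear (\<lambda>y. (y, 0::'c))" "bounded_linear (\<lambda>z. (0::'b, z))"
    for dummy :: "'b::real_normed_vector \<times> 'c::real_normed_vector"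
    by (intro bounded_linear_Pair bounded_linear_ident bounded_linear_zero)+
  have "Ck_on n S (\<lambda>x. (f x, 0) + (0, g x))"
    by (intro Ck_on_add Ck_on_bounded_linear[OF assms(1) b(1)] Ck_on_bounded_linear[OF assms(1) b(2)] assms)
  then show ?thesis by simp
qed

lemma smooth_on_Pair:
  "open S \<Longrightarrow> smooth_on S f \<Longrightarrow> smooth_on S g \<Longrightarrow> smooth_on S (\<lambda>x. (f x, g x))"
  by (simp add: smooth_on_def Ck_on_Pair)

lemma Ck_on_det:
  fixes M :: "'a::euclidean_space \<Rightarrow> real^'m^'m"
  assumes "open S" "\<And>i j. Ck_on n S (\<lambda>x. M x $ i $ j)"
  shows "Ck_on n S (\<lambda>x. det (M x))"
  unfolding det_def
  by (intro Ck_on_sum Ck_on_bilinear[OF assms(1) bounded_bilinear_mult] Ck_on_const Ck_on_prod assms)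

lemma matrix_inv_left_right:
  fixes A :: "real^'m^'m"
  assumes "invertible A"
  shows "matrix_inv A ** A = mat 1" "A ** matrix_inv A = mat 1"
  using someI_ex[of "\<lambda>A'. A ** A' = mat 1 \<and> A' ** A = mat 1"] assms
  unfolding invertible_def matrix_inv_def by blast+

text \<open>
  By Cramer's rule the entries of the inverse are quotients of determinants.
\<close>

lemma Ck_on_matrix_inv:
  fixes M :: "'a::euclidean_space \<Rightarrow> real^'m^'m"
  assumes "open S" "\<And>i j. Ck_on n S (\<lambda>x. M x $ i $ j)" "\<And>x. x \<in> S \<Longrightarrow> invertible (M x)"
  shows "Ck_on n S (\<lambda>x. matrix_inv (M x) $ i $ j)"
proof (rule Ck_on_cong[OF assms(1)])
  let ?R = "\<lambda>x. (\<chi> k l. if l = i then axis j 1 $ k else M x $ k $ l) :: real^'m^'m"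
  show "det (?R x) * inverse (det (M x)) = matrix_inv (M x) $ i $ j" if "x \<in> S" for x
  proof -
    have inv: "det (M x) \<noteq> 0" using assms(3)[OF that] invertible_det_nz by blast
    have "M x *v column j (matrix_inv (M x)) = axis j 1"
      using matrix_inv_left_right(2)[OF assms(3)[OF that]]
      by (metis matrix_mult_dot matrix_vector_mul_assoc matrix_vector_mul_lid matrix_vector_mult_basis)
    then have "column j (matrix_inv (M x)) =
        (\<chi> k. det (\<chi> k' l. if l = k then axis j 1 $ k' else M x $ k' $ l) / det (M x))"
      using cramer[OF inv] by blast
    then have "column j (matrix_inv (M x)) $ i = det (?R x) / det (M x)" by simp
    then show ?thesis by (simp add: column_def divide_inverse)
  qed
  show "Ck_on n S (\<lambda>x. det (?R x) * inverse (det (M x)))"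
  proof (intro Ck_on_bilinear[OF assms(1) bounded_bilinear_mult] Ck_on_det Ck_on_inverse assms)
    show "Ck_on n S (\<lambda>x. ?R x $ k $ l)" for k l
      using assms by (cases "l = i") (auto intro: Ck_on_const)
    show "det (M x) \<noteq> 0" if "x \<in> S" for x
      using assms(3)[OF that] invertible_det_nz by blast
  qed
qed

lemma smooth_on_matrix_inv:
  fixes M :: "'a::euclidean_space \<Rightarrow> real^'m^'m"
  shows "open S \<Longrightarrow> (\<And>i j. smooth_on S (\<lambda>x. M x $ i $ j)) \<Longrightarrow> (\<And>x. x \<in> S \<Longrightarrow> invertible (M x))
    \<Longrightarrow> smooth_on S (\<lambda>x. matrix_inv (M x) $ i $ j)"
  by (simp add: smooth_on_def Ck_on_matrix_inv)

lemma smooth_on_det: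
  fixes M :: "'a::euclidean_space \<Rightarrow> real^'m^'m"
  shows "open S \<Longrightarrow> (\<And>i j. smooth_on S (\<lambda>x. M x $ i $ j)) \<Longrightarrow> smooth_on S (\<lambda>x. det (M x))"
  by (simp add: smooth_on_def Ck_on_det)

lemma smooth_on_cis: "smooth_on UNIV cis"
proof -
  have "Ck_on n UNIV cis" for n
  proof (induction n)
    case 0
    then show ?case by (auto intro!: continuous_intros)
  next
    case (Suc n)
    show ?case
    proof (rule Ck_on_SucI[where D="\<lambda>x v. v *\<^sub>R (\<i> * cis x)"])
      show "(cis has_derivative (\<lambda>v. v *\<^sub>R (\<i> * cis x))) (at x)" for x
        using has_derivative_cis[of "\<lambda>x. x" "\<lambda>x. x" x UNIV] by simp
      show "Ck_on n UNIV (\<lambda>x. v *\<^sub>R (\<i> * cis x))" for v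
        using Ck_on_bounded_linear[OF open_UNIV bounded_linear_scaleR_right[THEN bounded_linear_compose, OF bounded_linear_mult_right] Suc]
        by (simp add: o_def)
    qed auto
  qed
  then show ?thesis by (simp add: smooth_on_def)
qed

text \<open>
  Two applications of the mean value theorem, first along \<open>u\<close> and then along \<open>v\<close>. The left-hand
  side is symmetric in \<open>u\<close> and \<open>v\<close>, which is the source of the symmetry of second derivatives.
\<close>

lemma second_difference_eq_mixed_derivative:
  fixes f :: "'a::euclidean_space \<Rightarrow> real"
  assumes f: "Ck_on 2 S f" and h: "0 < h"
    and S: "\<And>s t. s \<in> {0..h} \<Longrightarrow> t \<in> {0..h} \<Longrightarrow> x + s *\<^sub>R u + t *\<^sub>R v \<in> S"
  shows "\<exists>s\<in>{0..h}. \<exists>t\<in>{0..h}.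
    f (x + h *\<^sub>R u + h *\<^sub>R v) - f (x + h *\<^sub>R u) - f (x + h *\<^sub>R v) + f x =
    h * h * frechet_derivative (\<lambda>z. frechet_derivative f (at z) u) (at (x + s *\<^sub>R u + t *\<^sub>R v)) v"
proof -
  let ?Du = "\<lambda>z. frechet_derivative f (at z) u"
  let ?\<phi> = "\<lambda>s. f (x + s *\<^sub>R u + h *\<^sub>R v) - f (x + s *\<^sub>R u)"
  have f2: "Ck_on (Suc (Suc 0)) S f" using f by (simp add: numeral_2_eq_2)
  have df: "(f has_derivative frechet_derivative f (at z)) (at z)" if "z \<in> S" for z
    using Ck_on_Suc_has_derivative[OF f2 that] .
  have ddf: "(?Du has_derivative frechet_derivative ?Du (at z)) (at z)" if "z \<in> S" for z
    using Ck_on_Suc_has_derivative[OF Ck_on_frechet_derivative[OF f2] that] .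
  have sc: "frechet_derivative f (at z) (r *\<^sub>R u) = r * ?Du z" if "z \<in> S" for z r
    using linear_cmul[OF has_derivative_linear[OF df[OF that]]] by simp
  have "(?\<phi> has_derivative (\<lambda>r. r * (?Du (x + s *\<^sub>R u + h *\<^sub>R v) - ?Du (x + s *\<^sub>R u)))) (at s within {0..h})"
    if "0 \<le> s" "s \<le> h" for s
  proof -
    have S1: "x + s *\<^sub>R u + h *\<^sub>R v \<in> S" and S2: "x + s *\<^sub>R u \<in> S"
      using S[of s h] S[of s 0] that h by auto
    have i: "((\<lambda>s. x + s *\<^sub>R u + h *\<^sub>R v) has_derivative (\<lambda>r. r *\<^sub>R u)) (at s within {0..h})"
      "((\<lambda>s. x + s *\<^sub>R u) has_derivative (\<lambda>r. r *\<^sub>R u)) (at s within {0..h})"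
      by (auto intro!: derivative_eq_intros)
    show ?thesis
      using has_derivative_diff[OF has_derivative_compose[OF i(1) df[OF S1]]
          has_derivative_compose[OF i(2) df[OF S2]]]
      by (simp add: sc[OF S1] sc[OF S2] right_diff_distrib)
  qed
  from mvt_simple[OF h this] obtain s where s: "s \<in> {0<..<h}"
    and \<phi>: "?\<phi> h - ?\<phi> 0 = h * (?Du (x + s *\<^sub>R u + h *\<^sub>R v) - ?Du (x + s *\<^sub>R u))"
    by auto
  let ?\<gamma> = "\<lambda>t. ?Du (x + s *\<^sub>R u + t *\<^sub>R v)"
  have "(?\<gamma> has_derivative (\<lambda>r. r * frechet_derivative ?Du (at (x + s *\<^sub>R u + t *\<^sub>R v)) v)) (at t within {0..h})"
    if "0 \<le> t" "t \<le> h" for t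
  proof -
    have S1: "x + s *\<^sub>R u + t *\<^sub>R v \<in> S" using S[of s t] s that by auto
    have i: "((\<lambda>t. x + s *\<^sub>R u + t *\<^sub>R v) has_derivative (\<lambda>r. r *\<^sub>R v)) (at t within {0..h})"
      by (auto intro!: derivative_eq_intros)
    show ?thesis
      using has_derivative_compose[OF i ddf[OF S1]] linear_cmul[OF has_derivative_linear[OF ddf[OF S1]]]
      by simp
  qed
  from mvt_simple[OF h this] obtain t where t: "t \<in> {0<..<h}"
    and "?\<gamma> h - ?\<gamma> 0 = h * frechet_derivative ?Du (at (x + s *\<^sub>R u + t *\<^sub>R v)) v"
    by auto
  then have "?\<phi> h - ?\<phi> 0 = h * (h * frechet_derivative ?Du (at (x + s *\<^sub>R u + t *\<^sub>R v)) v)"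
    using \<phi> by simp
  with s t show ?thesis
    by (intro bexI[of _ s] bexI[of _ t]) (auto simp: algebra_simps)
qed

lemma frechet_derivative_symmetric:
  fixes f :: "'a::euclidean_space \<Rightarrow> real"
  assumes "open S" "Ck_on 2 S f" "x \<in> S"
  shows "frechet_derivative (\<lambda>z. frechet_derivative f (at z) u) (at x) v =
         frechet_derivative (\<lambda>z. frechet_derivative f (at z) v) (at x) u"
proof -
  define M where "M u v z = frechet_derivative (\<lambda>z. frechet_derivative f (at z) u) (at z) v" for u v z
  have cont: "continuous_on S (M u v)" for u v
    using assms(2) unfolding M_def numeral_2_eq_2 by simp
  have "\<bar>M u v x - M v u x\<bar> \<le> e" if e: "e > 0" for e
  proof -
    have "\<exists>d>0. \<forall>z. dist z x < d \<longrightarrow> z \<in> S \<and> \<bar>M u v z - M u v x\<bar> < e / 2 \<and> \<bar>M v u z - M v u x\<bar> < e / 2"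
    proof -
      have "\<forall>\<^sub>F z in nhds x. z \<in> S \<and> dist (M u v z) (M u v x) < e / 2 \<and> dist (M v u z) (M v u x) < e / 2"
      proof (intro eventually_conj)
        show "\<forall>\<^sub>F z in nhds x. z \<in> S" using assms eventually_nhds by blast
        have "(M p q \<longlongrightarrow> M p q x) (nhds x)" for p q
          using cont[of p q] assms(1,3) continuous_on_eq_continuous_at
          by (metis continuous_at_imp_continuous_at_within isCont_def tendsto_at_iff_tendsto_nhds)
        then show "\<forall>\<^sub>F z in nhds x. dist (M u v z) (M u v x) < e / 2"
          "\<forall>\<^sub>F z in nhds x. dist (M v u z) (M v u x) < e / 2"
          using e half_gt_zero tendstoD by blast+
      qed
      then show ?thesis by (auto simp: eventually_nhds_metric dist_real_def)
    qed
    then obtain d where d: "d > 0" "\<And>z. dist z x < d \<Longrightarrow>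
        z \<in> S \<and> \<bar>M u v z - M u v x\<bar> < e / 2 \<and> \<bar>M v u z - M v u x\<bar> < e / 2" by blast
    define h where "h = d / (2 * (norm u + norm v + 1))"
    have h: "h > 0" using d by (auto simp: h_def intro!: divide_pos_pos add_nonneg_pos)
    have near: "dist (x + s *\<^sub>R u + t *\<^sub>R v) x < d" if "s \<in> {0..h}" "t \<in> {0..h}" for s t
    proof -
      have "norm (s *\<^sub>R u + t *\<^sub>R v) \<le> h * norm u + h * norm v"
        using that by (intro norm_triangle_mono) (auto intro: mult_right_mono)
      also have "\<dots> \<le> h * (norm u + norm v + 1)"
        using h by (simp add: algebra_simps)
      also have "\<dots> = d / 2"
        unfolding h_def by (simp add: add_nonneg_eq_0_iff add_pos_nonneg field_simps add_nonneg_pos less_imp_neq[symmetric])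
      also have "\<dots> < d" using d by simp
      finally show ?thesis by (simp add: dist_norm add.assoc)
    qed
    have near': "dist (x + s *\<^sub>R v + t *\<^sub>R u) x < d" if "s \<in> {0..h}" "t \<in> {0..h}" for s t
      using near[OF that(2,1)] by (simp add: algebra_simps)
    obtain s t where st: "s \<in> {0..h}" "t \<in> {0..h}" and 1:
      "f (x + h *\<^sub>R u + h *\<^sub>R v) - f (x + h *\<^sub>R u) - f (x + h *\<^sub>R v) + f x = h * h * M u v (x + s *\<^sub>R u + t *\<^sub>R v)"
      using second_difference_eq_mixed_derivative[OF assms(2) h, of x u v] near d(2) unfolding M_def by blast
    obtain s' t' where st': "s' \<in> {0..h}" "t' \<in> {0..h}" and 2:
      "f (x + h *\<^sub>R v + h *\<^sub>R u) - f (x + h *\<^sub>R v) - f (x + h *\<^sub>R u) + f x = h * h * M v u (x + s' *\<^sub>R v + t' *\<^sub>R u)"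
      using second_difference_eq_mixed_derivative[OF assms(2) h, of x v u] near' d(2) unfolding M_def by blast
    have "x + h *\<^sub>R v + h *\<^sub>R u = x + h *\<^sub>R u + h *\<^sub>R v" by simp
    then have "h * h * M u v (x + s *\<^sub>R u + t *\<^sub>R v) = h * h * M v u (x + s' *\<^sub>R v + t' *\<^sub>R u)"
      using 1 2 by (smt (verit))
    then have "M u v (x + s *\<^sub>R u + t *\<^sub>R v) = M v u (x + s' *\<^sub>R v + t' *\<^sub>R u)" using h by simp
    moreover note d(2)[OF near[OF st]] d(2)[OF near'[OF st']]
    ultimately show ?thesis by linarith
  qed
  then have "\<bar>M u v x - M v u x\<bar> \<le> 0" by (rule field_le_epsilon[of _ 0, simplified])
  then show ?thesis by (simp add: M_def)
qed

section \<open>Integral equations along rays\<close>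

text \<open>
  A substitute for Gronwall's inequality: if every bound \<open>M\<close> of a bounded function can be improved to
  \<open>a + M/2\<close>, then the least bound is at most \<open>2a\<close>. All kernels below are scaled so that they contribute
  the factor \<open>1/2\<close>.
\<close>

lemma halving_bound:
  fixes g :: "'z \<Rightarrow> real"
  assumes bdd: "\<And>z. z \<in> D \<Longrightarrow> g z \<le> bnd"
    and step: "\<And>M z. (\<And>z. z \<in> D \<Longrightarrow> g z \<le> M) \<Longrightarrow> z \<in> D \<Longrightarrow> g z \<le> a + M / 2"
    and z: "z \<in> D"
  shows "g z \<le> 2 * a"
proof -
  define M where "M = Sup (g ` D)"
  have bd: "bdd_above (g ` D)" using bdd by (auto intro!: bdd_aboveI)
  have up: "g z \<le> M" if "z \<in> D" for z
    unfolding M_def using bd that by (intro cSup_upper) auto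
  have "M \<le> a + M / 2"
    unfolding M_def using z step[OF up] by (intro cSup_least) (auto simp: M_def)
  then show ?thesis using up[OF z] by linarith
qed

text \<open>
  Uniformity in the base point is what counts: below, the remainder is integrated over \<open>s\<close> with
  base points that depend on \<open>s\<close>.
\<close>

lemma C1_compact_remainder:
  fixes F :: "'q::euclidean_space \<Rightarrow> 'b::real_normed_vector" and F' :: "'q \<Rightarrow> 'q \<Rightarrow>\<^sub>L 'b"
  assumes der: "\<And>q. q \<in> Q \<Longrightarrow> (F has_derivative F' q) (at q within Q)"
    and cont: "continuous_on Q F'" and "compact Q" "convex Q" and e: "e > 0"
  shows "\<exists>d>0. \<forall>q\<in>Q. \<forall>q'\<in>Q. dist q' q < d \<longrightarrow>
    norm (F q' - F q - F' q (q' - q)) \<le> e * norm (q' - q)"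
proof -
  have "uniformly_continuous_on Q F'"
    using compact_uniformly_continuous[OF cont \<open>compact Q\<close>] .
  then obtain d where d: "d > 0"
    and du: "\<And>q q'. q \<in> Q \<Longrightarrow> q' \<in> Q \<Longrightarrow> dist q' q < d \<Longrightarrow> dist (F' q') (F' q) < e"
    using e unfolding uniformly_continuous_on_def by blast
  have "norm (F q' - F q - F' q (q' - q)) \<le> e * norm (q' - q)"
    if q: "q \<in> Q" "q' \<in> Q" "dist q' q < d" for q q'
  proof -
    let ?S = "Q \<inter> ball q d"
    have cs: "convex ?S" using \<open>convex Q\<close> by (intro convex_Int convex_ball)
    have mem: "q \<in> ?S" "q' \<in> ?S" using q d by (auto simp: dist_commute)
    have "norm (F q' - F q - F' q (q' - q)) \<le> norm (q' - q) * e"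
    proof (rule differentiable_bound_linearization[where S="?S"])
      show "q + t *\<^sub>R (q' - q) \<in> ?S" if "t \<in> {0..1}" for t
        using convexD_alt[OF cs mem, of t] that by (simp add: algebra_simps)
      show "(F has_derivative F' z) (at z within ?S)" if "z \<in> ?S" for z
        using der that by (auto intro: has_derivative_subset)
      show "onorm (blinfun_apply (F' z) - blinfun_apply (F' q)) \<le> e" if "z \<in> ?S" for z
      proof -
        have "norm (F' z - F' q) \<le> e"
          using du[of q z] that q by (auto simp: dist_norm norm_minus_commute dist_commute intro: less_imp_le)
        then show ?thesis
          by (simp add: norm_blinfun.rep_eq minus_blinfun.rep_eq fun_diff_def)
      qed
    qed (fact mem)
    then show ?thesis by (simp add: mult.commute)
  qed
  with d show ?thesis by blast
qed

lemma C1_compact_Lipschitz: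
  fixes F :: "'q::euclidean_space \<Rightarrow> 'b::real_normed_vector" and F' :: "'q \<Rightarrow> 'q \<Rightarrow>\<^sub>L 'b"
  assumes der: "\<And>q. q \<in> Q \<Longrightarrow> (F has_derivative F' q) (at q within Q)"
    and cont: "continuous_on Q F'" and "compact Q" "convex Q"
  shows "\<exists>C\<ge>0. \<forall>q\<in>Q. \<forall>q'\<in>Q. norm (F q' - F q) \<le> C * norm (q' - q)"
proof -
  have "bounded (F' ` Q)" using compact_continuous_image[OF cont] \<open>compact Q\<close> compact_imp_bounded by blast
  then obtain C where C: "\<And>q. q \<in> Q \<Longrightarrow> norm (F' q) \<le> C" by (auto simp: bounded_iff)
  have "norm (F q' - F q) \<le> \<bar>C\<bar> * norm (q' - q)" if "q \<in> Q" "q' \<in> Q" for q q'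
    by (rule differentiable_bound[OF \<open>convex Q\<close> der])
       (use C that in \<open>auto simp: norm_blinfun.rep_eq[symmetric] intro: order_trans[OF _ abs_ge_self]\<close>)
  then show ?thesis by (intro exI[of _ "\<bar>C\<bar>"]) auto
qed

lemma norm_integral_unit_interval_le:
  fixes f :: "real \<Rightarrow> 'c::banach"
  assumes "f integrable_on {0..1}" "\<And>s. s \<in> {0..1} \<Longrightarrow> norm (f s) \<le> M"
  shows "norm (integral {0..1} f) \<le> M"
proof -
  have "0 \<le> M" using assms(2)[of 0] order_trans[OF norm_ge_zero[of "f 0"]] by simp
  then show ?thesis using integrable_bound[of M f 0 1] assms by (simp add: cbox_interval)
qed

text \<open>
  Picard iteration. The values lie in a Banach space because the lemma serves twice: for the solution
  itself, and for its derivative, which is operator-valued.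
\<close>

lemma integral_eq_solution_exists:
  fixes D :: "'a::euclidean_space set" and \<sigma> :: "real \<Rightarrow> 'a \<Rightarrow> 'a"
    and K :: "real \<Rightarrow> 'a \<Rightarrow> 'c::banach \<Rightarrow> 'c"
  assumes D: "compact D" and \<sigma>D: "\<And>s \<rho>. s \<in> {0..1} \<Longrightarrow> \<rho> \<in> D \<Longrightarrow> \<sigma> s \<rho> \<in> D"
    and \<sigma>: "continuous_on ({0..1} \<times> D) (\<lambda>(s, \<rho>). \<sigma> s \<rho>)"
    and K: "continuous_on ({0..1} \<times> D \<times> C) (\<lambda>(s, \<rho>, z). K s \<rho> z)"
    and lip: "\<And>s \<rho> z z'. s \<in> {0..1} \<Longrightarrow> \<rho> \<in> D \<Longrightarrow> z \<in> C \<Longrightarrow> z' \<in> C \<Longrightarrow>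
        norm (K s \<rho> z - K s \<rho> z') \<le> norm (z - z') / 2"
    and C: "closed C" "c0 \<in> C" and b: "continuous_on D b"
    and maps: "\<And>x \<rho>. continuous_on D x \<Longrightarrow> x ` D \<subseteq> C \<Longrightarrow> \<rho> \<in> D \<Longrightarrow>
        b \<rho> + integral {0..1} (\<lambda>s. K s \<rho> (x (\<sigma> s \<rho>))) \<in> C"
  shows "\<exists>x. continuous_on D x \<and> x ` D \<subseteq> C \<and>
    (\<forall>\<rho>\<in>D. x \<rho> = b \<rho> + integral {0..1} (\<lambda>s. K s \<rho> (x (\<sigma> s \<rho>))))"
proof -
  define T where "T x \<rho> = b \<rho> + integral {0..1} (\<lambda>s. K s \<rho> (x (\<sigma> s \<rho>)))" for x \<rho>
  have Kx: "continuous_on (D \<times> {0..1}) (\<lambda>(\<rho>, s). K s \<rho> (x (\<sigma> s \<rho>)))"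
    if x: "continuous_on D x" "x ` D \<subseteq> C" for x
  proof -
    have "continuous_on (D \<times> {0..1}) (\<lambda>q. (\<lambda>(s, \<rho>, z). K s \<rho> z) (snd q, fst q, x ((\<lambda>(s,\<rho>). \<sigma> s \<rho>) (snd q, fst q))))"
      by (intro continuous_on_compose2[OF K] continuous_on_Pair continuous_on_fst continuous_on_snd
          continuous_on_id continuous_on_compose2[OF x(1)] continuous_on_compose2[OF \<sigma>])
        (use \<sigma>D x in auto)
    then show ?thesis by (simp add: split_beta)
  qed
  have int: "(\<lambda>s. K s \<rho> (x (\<sigma> s \<rho>))) integrable_on {0..1}"
    if x: "continuous_on D x" "x ` D \<subseteq> C" and \<rho>: "\<rho> \<in> D" for x \<rho>
  proof -
    have "continuous_on {0..1} (\<lambda>s. (\<lambda>(\<rho>, s). K s \<rho> (x (\<sigma> s \<rho>))) (\<rho>, s))"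
      by (rule continuous_on_compose2[OF Kx[OF x]]) (use \<rho> in \<open>auto intro!: continuous_intros\<close>)
    then show ?thesis by (auto intro: integrable_continuous_interval)
  qed
  have Tcont: "continuous_on D (T x)" if x: "continuous_on D x" "x ` D \<subseteq> C" for x
  proof -
    have "continuous_on D (\<lambda>\<rho>. integral (cbox 0 1) (\<lambda>s. K s \<rho> (x (\<sigma> s \<rho>))))"
      by (rule integral_continuous_on_param) (use Kx[OF x] in simp)
    then show ?thesis unfolding T_def using b by (auto intro!: continuous_on_add simp: cbox_interval)
  qed
  have Tlip: "norm (T x \<rho> - T y \<rho>) \<le> M / 2"
    if x: "continuous_on D x" "x ` D \<subseteq> C" and y: "continuous_on D y" "y ` D \<subseteq> C"
      and M: "\<And>\<rho>. \<rho> \<in> D \<Longrightarrow> norm (x \<rho> - y \<rho>) \<le> M" and \<rho>: "\<rho> \<in> D" for x y M \<rho>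
  proof -
    have "T x \<rho> - T y \<rho> = integral {0..1} (\<lambda>s. K s \<rho> (x (\<sigma> s \<rho>)) - K s \<rho> (y (\<sigma> s \<rho>)))"
      unfolding T_def using int[OF x \<rho>] int[OF y \<rho>] by (simp add: integral_diff)
    also have "norm \<dots> \<le> M / 2"
    proof (rule norm_integral_unit_interval_le)
      show "(\<lambda>s. K s \<rho> (x (\<sigma> s \<rho>)) - K s \<rho> (y (\<sigma> s \<rho>))) integrable_on {0..1}"
        using int[OF x \<rho>] int[OF y \<rho>] by (intro integrable_diff)
      fix s :: real assume s: "s \<in> {0..1}"
      have "norm (K s \<rho> (x (\<sigma> s \<rho>)) - K s \<rho> (y (\<sigma> s \<rho>))) \<le> norm (x (\<sigma> s \<rho>) - y (\<sigma> s \<rho>)) / 2"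
        using \<sigma>D[of s \<rho>] s x y \<rho> by (intro lip) auto
      also have "\<dots> \<le> M / 2" using M[OF \<sigma>D[of s \<rho>]] s \<rho> by auto
      finally show "norm (K s \<rho> (x (\<sigma> s \<rho>)) - K s \<rho> (y (\<sigma> s \<rho>))) \<le> M / 2" .
    qed
    finally show ?thesis .
  qed
  define X where "X n = (T ^^ n) (\<lambda>_. c0)" for n
  have X: "continuous_on D (X n) \<and> X n ` D \<subseteq> C" for n
  proof (induction n)
    case 0
    then show ?case using C by (auto simp: X_def)
  next
    case (Suc n)
    moreover have "X (Suc n) = T (X n)" by (simp add: X_def)
    ultimately show ?case using Tcont[of "X n"] maps[of "X n"] by (auto simp: T_def)
  qed
  have XS: "X (Suc n) = T (X n)" for n by (simp add: X_def)
  have "bounded ((\<lambda>\<rho>. X 1 \<rho> - X 0 \<rho>) ` D)"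
    using X[of 0] X[of 1] D by (intro compact_imp_bounded compact_continuous_image continuous_intros) auto
  then obtain M where M: "\<And>\<rho>. \<rho> \<in> D \<Longrightarrow> norm (X 1 \<rho> - X 0 \<rho>) \<le> M" by (auto simp: bounded_iff)
  have diff: "norm (X (Suc n) \<rho> - X n \<rho>) \<le> M * (1/2) ^ n" if "\<rho> \<in> D" for n \<rho>
    using that
  proof (induction n arbitrary: \<rho>)
    case 0
    then show ?case using M by simp
  next
    case (Suc n)
    have "norm (T (X (Suc n)) \<rho> - T (X n) \<rho>) \<le> M * (1/2)^n / 2"
      by (rule Tlip) (use X Suc in auto)
    then show ?case by (simp add: XS)
  qed
  have "uniform_limit D (\<lambda>n \<rho>. \<Sum>i<n. X (Suc i) \<rho> - X i \<rho>) (\<lambda>\<rho>. \<Sum>i. X (Suc i) \<rho> - X i \<rho>) sequentially"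
    by (rule Weierstrass_m_test[where M="\<lambda>n. M * (1/2)^n"])
       (use diff in \<open>auto intro!: summable_mult summable_geometric\<close>)
  then have "uniform_limit D (\<lambda>n \<rho>. X 0 \<rho> + (\<Sum>i<n. X (Suc i) \<rho> - X i \<rho>))
      (\<lambda>\<rho>. X 0 \<rho> + (\<Sum>i. X (Suc i) \<rho> - X i \<rho>)) sequentially"
    by (intro uniform_limit_intros)
  moreover define x where "x = (\<lambda>\<rho>. X 0 \<rho> + (\<Sum>i. X (Suc i) \<rho> - X i \<rho>))"
  moreover have "(\<lambda>n \<rho>. X 0 \<rho> + (\<Sum>i<n. X (Suc i) \<rho> - X i \<rho>)) = X"
    using sum_lessThan_telescope[of "\<lambda>i. X i _"] by (intro ext) simp
  ultimately have ul: "uniform_limit D X x sequentially" by simp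
  have xc: "continuous_on D x"
    by (rule uniform_limit_theorem[OF _ ul]) (use X in auto)
  have lim: "(\<lambda>n. X n \<rho>) \<longlonglongrightarrow> x \<rho>" if "\<rho> \<in> D" for \<rho>
    using tendsto_uniform_limitI[OF ul that] .
  have xC: "x ` D \<subseteq> C"
    using closed_sequentially[OF C(1) _ lim] X by blast
  have "x \<rho> = T x \<rho>" if \<rho>: "\<rho> \<in> D" for \<rho>
  proof -
    have "(\<lambda>n. T (X n) \<rho>) \<longlonglongrightarrow> T x \<rho>"
    proof (rule tendstoI)
      fix e :: real assume e: "e > 0"
      have "\<forall>\<^sub>F n in sequentially. \<forall>\<rho>\<in>D. dist (X n \<rho>) (x \<rho>) < e"
        using ul e by (simp add: uniform_limit_iff)
      then show "\<forall>\<^sub>F n in sequentially. dist (T (X n) \<rho>) (T x \<rho>) < e"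
      proof eventually_elim
        case (elim n)
        have "norm (T (X n) \<rho> - T x \<rho>) \<le> e / 2"
          by (rule Tlip) (use X xc xC elim \<rho> in \<open>auto simp: dist_norm intro: less_imp_le\<close>)
        then show ?case using e by (simp add: dist_norm)
      qed
    qed
    moreover have "(\<lambda>n. X (Suc n) \<rho>) \<longlonglongrightarrow> x \<rho>" using LIMSEQ_Suc[OF lim[OF \<rho>]] .
    ultimately show ?thesis using LIMSEQ_unique by (simp add: XS)
  qed
  then show ?thesis using xc xC unfolding T_def by blast
qed

text \<open>
  Here \<open>p\<close> is a linear projection whose scalings do not increase the norm, in the applications the
  orthogonal projection onto the directions of the leaves. The ray \<open>s \<mapsto> \<sigma> s v\<close> scales the image of \<open>p\<close> and fixes its
  kernel, so it joins the transversal \<open>p v = 0\<close> to \<open>v = \<sigma> 1 v\<close>. An ordinary differential equation along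
  all rays at once becomes an integral equation in which \<open>v\<close> occurs only through \<open>\<sigma> s v\<close>, and
  parameters need no separate treatment.
\<close>

locale radial_scaling =
  fixes p :: "'a::euclidean_space \<Rightarrow> 'a"
  assumes linear_p: "linear p" and p_idem: "p (p v) = p v"
    and contract: "0 \<le> s \<Longrightarrow> s \<le> 1 \<Longrightarrow> norm (v + (s - 1) *\<^sub>R p v) \<le> norm v"
begin

definition \<sigma> :: "real \<Rightarrow> 'a \<Rightarrow> 'a" where "\<sigma> s v = v + (s - 1) *\<^sub>R p v"

lemma bounded_linear_p: "bounded_linear p"
  using linear_p linear_conv_bounded_linear by blast

lemma \<sigma>_one [simp]: "\<sigma> 1 v = v" by (simp add: \<sigma>_def)

lemma norm_\<sigma>: "s \<in> {0..1} \<Longrightarrow> norm (\<sigma> s v) \<le> norm v"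
  using contract by (simp add: \<sigma>_def)

lemma bounded_linear_\<sigma>: "bounded_linear (\<sigma> s)"
  unfolding \<sigma>_def
  by (intro bounded_linear_add bounded_linear_ident bounded_linear_scaleR_right[THEN bounded_linear_compose] bounded_linear_p)

lemma \<sigma>_diff: "\<sigma> s (u - v) = \<sigma> s u - \<sigma> s v"
  using bounded_linear_\<sigma> by (simp add: linear_simps)

lemma \<sigma>_\<sigma>: "\<sigma> s (\<sigma> t v) = \<sigma> (s * t) v"
proof -
  have "p (\<sigma> t v) = t *\<^sub>R p v"
    unfolding \<sigma>_def using bounded_linear_p by (simp add: linear_simps p_idem algebra_simps)
  then show ?thesis
    unfolding \<sigma>_def[of s] by (simp add: \<sigma>_def algebra_simps)
qed

lemma \<sigma>_p: "p v = v \<Longrightarrow> \<sigma> s v = s *\<^sub>R v" by (simp add: \<sigma>_def algebra_simps)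

lemma \<sigma>_perp: "p v = 0 \<Longrightarrow> \<sigma> s v = v" by (simp add: \<sigma>_def)

lemma continuous_on_\<sigma>: "continuous_on X (\<lambda>q. \<sigma> (fst q) (snd q))"
  unfolding \<sigma>_def by (intro continuous_intros bounded_linear.continuous_on[OF bounded_linear_p])

lemma continuous_on_\<sigma>' [continuous_intros]:
  "continuous_on X f \<Longrightarrow> continuous_on X g \<Longrightarrow> continuous_on X (\<lambda>q. \<sigma> (f q) (g q))"
  unfolding \<sigma>_def by (intro continuous_intros bounded_linear.continuous_on[OF bounded_linear_p])

lemma \<sigma>_ball: "s \<in> {0..1} \<Longrightarrow> v \<in> ball 0 d \<Longrightarrow> \<sigma> s v \<in> ball 0 d"
  using norm_\<sigma>[of s v] by auto

lemma \<sigma>_cball: "s \<in> {0..1} \<Longrightarrow> v \<in> cball 0 d \<Longrightarrow> \<sigma> s v \<in> cball 0 d"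
  using norm_\<sigma>[of s v] by auto

end

lemma Ck_on_1_blinfun:
  fixes F :: "'q::euclidean_space \<Rightarrow> 'b::real_normed_vector"
  assumes "Ck_on (Suc 0) O' F"
  obtains F' :: "'q \<Rightarrow> 'q \<Rightarrow>\<^sub>L 'b"
  where "\<And>q. q \<in> O' \<Longrightarrow> (F has_derivative F' q) (at q)" "continuous_on O' F'"
proof
  let ?F' = "\<lambda>q. Blinfun (frechet_derivative F (at q))"
  have ap: "blinfun_apply (?F' q) = frechet_derivative F (at q)" if "q \<in> O'" for q
    using Ck_on_Suc_has_derivative[OF assms that] by (intro bounded_linear_Blinfun_apply has_derivative_bounded_linear)
  show "(F has_derivative ?F' q) (at q)" if "q \<in> O'" for q
    using Ck_on_Suc_has_derivative[OF assms that] ap[OF that] by simp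
  show "continuous_on O' ?F'"
  proof (rule continuous_on_blinfun_componentwise)
    fix i :: 'q assume "i \<in> Basis"
    show "continuous_on O' (\<lambda>q. blinfun_apply (?F' q) i)"
      using assms ap by (simp cong: continuous_on_cong)
  qed
qed

text \<open>
  Lets a Lipschitz hypothesis on the kernel be used for its derivative, so that the linearised equation
  is again a contraction.
\<close>

lemma norm_derivative_le_Lipschitz:
  assumes der: "(f has_derivative f') (at z)" and "open Z" "z \<in> Z"
    and lip: "\<And>z'. z' \<in> Z \<Longrightarrow> norm (f z' - f z) \<le> C * norm (z' - z)"
  shows "norm (f' v) \<le> C * norm v"
proof -
  have lin: "linear f'" using der has_derivative_linear by blast
  obtain r where r: "r > 0" "ball z r \<subseteq> Z" using assms(2,3) open_contains_ball by blast
  have "norm (f' v) \<le> C * norm v + e * norm v" if e: "e > 0" for e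
  proof (cases "v = 0")
    case True
    then show ?thesis using lin by (simp add: linear_0)
  next
    case False
    obtain d where d: "d > 0"
      "\<And>y. norm (y - z) < d \<Longrightarrow> norm (f y - f z - f' (y - z)) \<le> e * norm (y - z)"
      using der e unfolding has_derivative_at_alt by blast
    define t where "t = min d r / (2 * norm v)"
    have t: "t > 0" "t * norm v < d" "t * norm v < r"
      using False d r by (auto simp: t_def min_def)
    have "norm (f (z + t *\<^sub>R v) - f z - t *\<^sub>R f' v) \<le> e * (t * norm v)"
      using d(2)[of "z + t *\<^sub>R v"] t lin by (simp add: linear_cmul)
    moreover have "norm (f (z + t *\<^sub>R v) - f z) \<le> C * (t * norm v)"
      using lip[of "z + t *\<^sub>R v"] t r(2) by (auto simp: dist_norm subset_iff)
    moreover have "t *\<^sub>R f' v = (f (z + t *\<^sub>R v) - f z) - (f (z + t *\<^sub>R v) - f z - t *\<^sub>R f' v)" by simp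
    ultimately have "norm (t *\<^sub>R f' v) \<le> C * (t * norm v) + e * (t * norm v)"
      by (metis norm_triangle_le_diff add_mono)
    then have "t * norm (f' v) \<le> t * (C * norm v + e * norm v)"
      using t by (simp add: algebra_simps)
    then show ?thesis using t by simp
  qed
  then have *: "norm (f' v) \<le> (C + e) * norm v" if "e > 0" for e
    using that by (simp add: distrib_right)
  show ?thesis
  proof (cases "v = 0")
    case True
    then show ?thesis using lin by (simp add: linear_0)
  next
    case False
    have "norm (f' v) \<le> C * norm v + e" if "e > 0" for e
      using *[of "e / norm v"] False that by (simp add: distrib_right)
    then show ?thesis by (rule field_le_epsilon)
  qed
qed

context radial_scaling
begin

text \<open>
  Formal differentiation of the equation gives a linear equation for the derivative, which has a
  solution \<open>W\<close> on the closed ball. That \<open>W\<close> really is the derivative follows from two applications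
  of \<open>halving_bound\<close> to suprema over pairs of points at distance at most \<open>h\<close>: the solution is
  Lipschitz, and the error of the linear approximation by \<open>W\<close> is \<open>o(h)\<close>. Rays do not increase
  distances, so these suprema reproduce themselves under the integral. The smaller closed ball supplies
  the compactness that makes all estimates uniform.
\<close>

lemma solution_C1_on_cball:
  fixes F :: "real \<times> 'a \<times> 'b \<Rightarrow> 'b::euclidean_space" and b x :: "'a \<Rightarrow> 'b"
  assumes "d' < d"
    and oO: "open O'" and F: "Ck_on (Suc 0) O' F" and \<Omega>: "open \<Omega>" "convex \<Omega>"
    and sub: "{0..1} \<times> ball 0 d \<times> \<Omega> \<subseteq> O'"
    and lip: "\<And>s \<rho> z z'. s \<in> {0..1} \<Longrightarrow> \<rho> \<in> ball 0 d \<Longrightarrow> z \<in> \<Omega> \<Longrightarrow> z' \<in> \<Omega> \<Longrightarrow>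
        norm (F (s, \<rho>, z) - F (s, \<rho>, z')) \<le> norm (z - z') / 2"
    and b: "Ck_on (Suc 0) (ball 0 d) b"
    and x: "continuous_on (ball 0 d) x" "x ` ball 0 d \<subseteq> \<Omega>"
    and eq: "\<And>\<rho>. \<rho> \<in> ball 0 d \<Longrightarrow> x \<rho> = b \<rho> + integral {0..1} (\<lambda>s. F (s, \<rho>, x (\<sigma> s \<rho>)))"
  obtains W :: "'a \<Rightarrow> 'a \<Rightarrow>\<^sub>L 'b" where
    "continuous_on (cball 0 d') W"
    "\<And>\<rho>. \<rho> \<in> ball 0 d' \<Longrightarrow> (x has_derivative W \<rho>) (at \<rho>)"
    "\<And>\<rho> v. \<rho> \<in> cball 0 d' \<Longrightarrow> W \<rho> v = frechet_derivative b (at \<rho>) v +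
        integral {0..1} (\<lambda>s. frechet_derivative F (at (s, \<rho>, x (\<sigma> s \<rho>))) (0, v, W (\<sigma> s \<rho>) (\<sigma> s v)))"
proof -
  let ?D = "cball (0::'a) d'"
  have DV: "?D \<subseteq> ball 0 d" using \<open>d' < d\<close> by auto
  obtain F' where F': "\<And>q. q \<in> O' \<Longrightarrow> (F has_derivative blinfun_apply (F' q)) (at q)"
    and F'c: "continuous_on O' F'" using Ck_on_1_blinfun[OF F] by blast
  obtain b' where b': "\<And>\<rho>. \<rho> \<in> ball 0 d \<Longrightarrow> (b has_derivative blinfun_apply (b' \<rho>)) (at \<rho>)"
    and b'c: "continuous_on (ball 0 d) b'" using Ck_on_1_blinfun[OF b] by blast
  define Kc where "Kc = convex hull (x ` ?D)"
  have xD: "continuous_on ?D x" using x(1) DV continuous_on_subset by blast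
  have Kc: "compact Kc" "convex Kc" "Kc \<subseteq> \<Omega>"
    unfolding Kc_def using compact_convex_hull[OF compact_continuous_image[OF xD compact_cball]]
      hull_minimal[of "x ` ?D" \<Omega> convex] \<Omega> x(2) DV by auto
  have xKc: "x \<rho> \<in> Kc" if "\<rho> \<in> ?D" for \<rho> unfolding Kc_def by (intro hull_inc imageI that)
  define Q where "Q = {0..1::real} \<times> ?D \<times> Kc"
  have Q: "compact Q" "convex Q" "Q \<subseteq> O'"
    unfolding Q_def using Kc DV sub by (auto intro!: compact_Times convex_Times)
  have QF: "(F has_derivative F' q) (at q within Q)" if "q \<in> Q" for q
    using F' Q(3) that has_derivative_at_withinI by blast
  have QF': "continuous_on Q F'" using F'c Q(3) continuous_on_subset by blast
  have Db: "(b has_derivative b' \<rho>) (at \<rho> within ?D)" if "\<rho> \<in> ?D" for \<rho>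
    using b' DV that has_derivative_at_withinI by blast
  have Db': "continuous_on ?D b'" using b'c DV continuous_on_subset by blast
  have qQ: "(s, \<rho>, x (\<sigma> s \<rho>)) \<in> Q" if "s \<in> {0..1}" "\<rho> \<in> ?D" for s \<rho>
    using that xKc[OF \<sigma>_cball[OF that]] by (auto simp: Q_def)
  have q'Q: "(s, \<rho>, x (\<sigma> s \<rho>')) \<in> Q" if "s \<in> {0..1}" "\<rho> \<in> ?D" "\<rho>' \<in> ?D" for s \<rho> \<rho>'
    using that xKc[OF \<sigma>_cball[OF that(1,3)]] by (auto simp: Q_def)
  \<comment> \<open>the linearised equation, solved by Picard iteration among operator-valued functions\<close>
  define inA :: "'a \<Rightarrow>\<^sub>L (real \<times> 'a \<times> 'b)" where "inA = Blinfun (\<lambda>v. (0, v, 0))"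
  define inB :: "'b \<Rightarrow>\<^sub>L (real \<times> 'a \<times> 'b)" where "inB = Blinfun (\<lambda>z. (0, 0, z))"
  have inA: "blinfun_apply inA v = (0, v, 0)" for v
    unfolding inA_def by (subst bounded_linear_Blinfun_apply)
      (auto intro!: bounded_linear_Pair bounded_linear_ident bounded_linear_zero)
  have inB: "blinfun_apply inB z = (0, 0, z)" for z
    unfolding inB_def by (subst bounded_linear_Blinfun_apply)
      (auto intro!: bounded_linear_Pair bounded_linear_ident bounded_linear_zero)
  define Sg where "Sg s = Blinfun (\<sigma> s)" for s
  have Sg: "blinfun_apply (Sg s) v = \<sigma> s v" for s v
    unfolding Sg_def by (simp add: bounded_linear_Blinfun_apply bounded_linear_\<sigma>)
  have Sgn: "norm (Sg s) \<le> 1" if "s \<in> {0..1}" for s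
    by (rule norm_blinfun_bound) (use norm_\<sigma> that in \<open>auto simp: Sg\<close>)
  have Sgc: "continuous_on X (\<lambda>q. Sg (f q))" if "continuous_on X f" for X and f :: "'z::metric_space \<Rightarrow> real"
    by (rule continuous_on_blinfun_componentwise) (use that in \<open>auto simp: Sg intro!: continuous_intros\<close>)
  define G where "G s \<rho> = F' (s, \<rho>, x (\<sigma> s \<rho>))" for s \<rho>
  have Gc: "continuous_on ({0..1} \<times> ?D) (\<lambda>q. G (fst q) (snd q))"
    unfolding G_def
    by (rule continuous_on_compose2[OF QF'])
       (use qQ \<sigma>_cball in \<open>auto intro!: continuous_intros continuous_on_compose2[OF xD]\<close>)
  have GB: "norm (G s \<rho> o\<^sub>L inB) \<le> 1 / 2" if "s \<in> {0..1}" "\<rho> \<in> ?D" for s \<rho>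
  proof (rule norm_blinfun_bound)
    fix y
    let ?z = "x (\<sigma> s \<rho>)"
    have z: "?z \<in> \<Omega>" using xKc[OF \<sigma>_cball[OF that]] Kc(3) by blast
    have d1: "((\<lambda>z. (s, \<rho>, z)) has_derivative (\<lambda>z. (0, 0, z))) (at ?z)"
      by (auto intro!: derivative_eq_intros)
    have "(F has_derivative F' (s, \<rho>, ?z)) (at (s, \<rho>, ?z))" using F' qQ[OF that] Q(3) by blast
    from has_derivative_compose[OF d1 this]
    have der: "((\<lambda>z. F (s, \<rho>, z)) has_derivative (\<lambda>z. F' (s, \<rho>, ?z) (0, 0, z))) (at ?z)" .
    have "norm (F' (s, \<rho>, ?z) (0, 0, y)) \<le> 1 / 2 * norm y"
      by (rule norm_derivative_le_Lipschitz[OF der \<Omega>(1) z]) (use lip[OF that(1)] that(2) DV z in auto)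
    then show "norm (blinfun_apply (G s \<rho> o\<^sub>L inB) y) \<le> 1 / 2 * norm y"
      by (simp add: G_def inB)
  qed auto
  define L where "L s \<rho> W = (G s \<rho> o\<^sub>L inA) + ((G s \<rho> o\<^sub>L inB) o\<^sub>L (W o\<^sub>L Sg s))" for s \<rho> and W :: "'a \<Rightarrow>\<^sub>L 'b"
  have Lap: "blinfun_apply (L s \<rho> W) v = F' (s, \<rho>, x (\<sigma> s \<rho>)) (0, v, W (\<sigma> s v))" for s \<rho> W v
  proof -
    have "(0, v, W (\<sigma> s v)) = inA v + inB (W (\<sigma> s v))" by (simp add: inA inB)
    then show ?thesis
      unfolding L_def G_def by (simp add: blinfun.add_left Sg blinfun.add_right)
  qed
  have "\<exists>W. continuous_on ?D W \<and> W ` ?D \<subseteq> UNIV \<and>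
      (\<forall>\<rho>\<in>?D. W \<rho> = b' \<rho> + integral {0..1} (\<lambda>s. L s \<rho> (W (\<sigma> s \<rho>))))"
  proof (rule integral_eq_solution_exists)
    show "continuous_on ({0..1} \<times> ?D) (\<lambda>(s, \<rho>). \<sigma> s \<rho>)"
      using continuous_on_\<sigma> by (simp add: split_beta)
    have "continuous_on ({0..1} \<times> ?D \<times> UNIV) (\<lambda>q. G (fst q) (fst (snd q)))"
      by (rule continuous_on_compose2[OF Gc, of _ "\<lambda>q. (fst q, fst (snd q))", simplified])
         (auto intro!: continuous_intros)
    then show "continuous_on ({0..1} \<times> ?D \<times> UNIV) (\<lambda>(s, \<rho>, W). L s \<rho> W)"
      unfolding L_def split_beta
      by (intro continuous_intros bounded_bilinear.continuous_on[OF bounded_bilinear_blinfun_compose] Sgc)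
    show "norm (L s \<rho> W - L s \<rho> W') \<le> norm (W - W') / 2" if "s \<in> {0..1}" "\<rho> \<in> ?D" for s \<rho> W W'
    proof -
      have "L s \<rho> W - L s \<rho> W' = (G s \<rho> o\<^sub>L inB) o\<^sub>L ((W - W') o\<^sub>L Sg s)"
        by (rule blinfun_eqI) (simp add: L_def blinfun.add_left blinfun.diff_left blinfun.diff_right)
      also have "norm \<dots> \<le> norm (G s \<rho> o\<^sub>L inB) * (norm (W - W') * norm (Sg s))"
        by (meson mult_left_mono norm_blinfun_compose norm_ge_zero order_trans)
      also have "\<dots> \<le> 1 / 2 * (norm (W - W') * 1)"
        using GB[OF that] Sgn[OF that(1)] by (intro mult_mono mult_left_mono mult_nonneg_nonneg) auto
      finally show ?thesis by simp
    qed
  qed (use Db' \<sigma>_cball in auto)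
  then obtain W where Wc: "continuous_on ?D W"
    and Weq: "\<And>\<rho>. \<rho> \<in> ?D \<Longrightarrow> W \<rho> = b' \<rho> + integral {0..1} (\<lambda>s. L s \<rho> (W (\<sigma> s \<rho>)))" by blast
  have Lc: "continuous_on {0..1} (\<lambda>s. L s \<rho> (W (\<sigma> s \<rho>)))" if "\<rho> \<in> ?D" for \<rho>
  proof -
    have "continuous_on {0..1} (\<lambda>s. G s \<rho>)"
      by (rule continuous_on_compose2[OF Gc, of _ "\<lambda>s. (s, \<rho>)", simplified])
         (use that in \<open>auto intro!: continuous_intros\<close>)
    then show ?thesis unfolding L_def
      by (intro continuous_intros bounded_bilinear.continuous_on[OF bounded_bilinear_blinfun_compose] Sgc
          continuous_on_compose2[OF Wc]) (use \<sigma>_cball that in auto)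
  qed
  have Weq': "W \<rho> v = b' \<rho> v + integral {0..1} (\<lambda>s. F' (s, \<rho>, x (\<sigma> s \<rho>)) (0, v, W (\<sigma> s \<rho>) (\<sigma> s v)))"
    if "\<rho> \<in> ?D" for \<rho> v
  proof -
    have "integral {0..1} ((\<lambda>A. blinfun_apply A v) \<circ> (\<lambda>s. L s \<rho> (W (\<sigma> s \<rho>)))) =
        blinfun_apply (integral {0..1} (\<lambda>s. L s \<rho> (W (\<sigma> s \<rho>)))) v"
      by (rule integral_linear[OF integrable_continuous_interval[OF Lc[OF that]] blinfun.bounded_linear_left])
    then show ?thesis by (subst Weq[OF that]) (simp add: blinfun.add_left o_def Lap)
  qed
  have intLW: "(\<lambda>s. F' (s, \<rho>, x (\<sigma> s \<rho>)) (0, v, W (\<sigma> s \<rho>) (\<sigma> s v))) integrable_on {0..1}"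
    if "\<rho> \<in> ?D" for \<rho> v
    using integrable_linear[OF integrable_continuous_interval[OF Lc[OF that]] blinfun.bounded_linear_left, of v]
    by (simp add: o_def Lap)
  have intF: "(\<lambda>s. F (s, \<rho>, x (\<sigma> s \<rho>))) integrable_on {0..1}" if "\<rho> \<in> ?D" for \<rho>
  proof -
    have "continuous_on Q F" by (rule has_derivative_continuous_on[OF QF])
    from continuous_on_compose2[OF this, of "{0..1}" "\<lambda>s. (s, \<rho>, x (\<sigma> s \<rho>))"]
    have "continuous_on {0..1} (\<lambda>s. F (s, \<rho>, x (\<sigma> s \<rho>)))"
      using qQ \<sigma>_cball that by (force intro!: continuous_intros continuous_on_compose2[OF xD])
    then show ?thesis by (rule integrable_continuous_interval)
  qed
  \<comment> \<open>first use of the halving estimate: the solution is Lipschitz\<close>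
  obtain C1 where C1: "C1 \<ge> 0" "\<And>q q'. q \<in> Q \<Longrightarrow> q' \<in> Q \<Longrightarrow> norm (F q' - F q) \<le> C1 * norm (q' - q)"
    using C1_compact_Lipschitz[OF QF QF' Q(1,2)] by blast
  obtain C2 where C2: "C2 \<ge> 0" "\<And>q q'. q \<in> ?D \<Longrightarrow> q' \<in> ?D \<Longrightarrow> norm (b q' - b q) \<le> C2 * norm (q' - q)"
    using C1_compact_Lipschitz[OF Db Db' compact_cball convex_cball] by blast
  define Lx where "Lx = 2 * (C1 + C2)"
  have Lx0: "Lx \<ge> 0" using C1 C2 by (simp add: Lx_def)
  have bxD: "bounded (x ` ?D)" using compact_continuous_image[OF xD compact_cball] compact_imp_bounded by blast
  then obtain Mx where Mx: "\<And>\<rho>. \<rho> \<in> ?D \<Longrightarrow> norm (x \<rho>) \<le> Mx"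
    unfolding bounded_iff by blast
  let ?P = "\<lambda>h. {(\<rho>, \<rho>'). \<rho> \<in> ?D \<and> \<rho>' \<in> ?D \<and> norm (\<rho>' - \<rho>) \<le> h}"
  have \<sigma>P: "(\<sigma> s \<rho>, \<sigma> s \<rho>') \<in> ?P h" if "(\<rho>, \<rho>') \<in> ?P h" "s \<in> {0..1}" for s \<rho> \<rho>' h
    using that norm_\<sigma>[of s "\<rho>' - \<rho>"] \<sigma>_cball[of s _ d'] by (fastforce simp: \<sigma>_diff)
  have Lipx: "norm (x \<rho>' - x \<rho>) \<le> Lx * norm (\<rho>' - \<rho>)" if "\<rho> \<in> ?D" "\<rho>' \<in> ?D" for \<rho> \<rho>'
  proof -
    let ?h = "norm (\<rho>' - \<rho>)"
    have "norm (x (snd (\<rho>, \<rho>')) - x (fst (\<rho>, \<rho>'))) \<le> 2 * ((C1 + C2) * ?h)"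
    proof (rule halving_bound[where D="?P ?h" and bnd="2 * Mx" and g="\<lambda>r. norm (x (snd r) - x (fst r))"])
      show "norm (x (snd r) - x (fst r)) \<le> 2 * Mx" if "r \<in> ?P ?h" for r
        using that Mx[of "fst r"] Mx[of "snd r"] norm_triangle_ineq4[of "x (snd r)" "x (fst r)"] by auto
      show "(\<rho>, \<rho>') \<in> ?P ?h" using that by auto
      fix M r
      assume M: "\<And>r. r \<in> ?P ?h \<Longrightarrow> norm (x (snd r) - x (fst r)) \<le> M" and r: "r \<in> ?P ?h"
      obtain u u' where u: "r = (u, u')" "u \<in> ?D" "u' \<in> ?D" "norm (u' - u) \<le> ?h" using r by auto
      have "x u' - x u = (b u' - b u) +
          integral {0..1} (\<lambda>s. F (s, u', x (\<sigma> s u')) - F (s, u, x (\<sigma> s u)))"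
        using eq[of u] eq[of u'] u DV intF[of u] intF[of u'] by (simp add: integral_diff subset_iff)
      also have "norm \<dots> \<le> C2 * ?h + (C1 * ?h + M / 2)"
      proof (rule norm_triangle_mono)
        show "norm (b u' - b u) \<le> C2 * ?h"
          using C2(2)[of u u'] u mult_left_mono[OF u(4) C2(1)] by linarith
        show "norm (integral {0..1} (\<lambda>s. F (s, u', x (\<sigma> s u')) - F (s, u, x (\<sigma> s u)))) \<le> C1 * ?h + M / 2"
        proof (rule norm_integral_unit_interval_le)
          show "(\<lambda>s. F (s, u', x (\<sigma> s u')) - F (s, u, x (\<sigma> s u))) integrable_on {0..1}"
            using intF u by (intro integrable_diff) auto
          fix s :: real assume s: "s \<in> {0..1}"
          have "norm (F (s, u', x (\<sigma> s u')) - F (s, u, x (\<sigma> s u'))) \<le> C1 * norm (u' - u)"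
            using C1(2)[OF q'Q[OF s u(2) u(3)] q'Q[OF s u(3) u(3)]] by (simp add: norm_Pair)
          also have "\<dots> \<le> C1 * ?h" using mult_left_mono[OF u(4) C1(1)] .
          finally have 1: "norm (F (s, u', x (\<sigma> s u')) - F (s, u, x (\<sigma> s u'))) \<le> C1 * ?h" .
          have mem: "x (\<sigma> s u') \<in> \<Omega>" "x (\<sigma> s u) \<in> \<Omega>" "u \<in> ball 0 d"
            using xKc[OF \<sigma>_cball[OF s]] u Kc(3) DV by blast+
          have "norm (F (s, u, x (\<sigma> s u')) - F (s, u, x (\<sigma> s u))) \<le> norm (x (\<sigma> s u') - x (\<sigma> s u)) / 2"
            using lip[OF s mem(3) mem(1,2)] .
          also have "\<dots> \<le> M / 2"
            using M[OF \<sigma>P[of u u' ?h s]] r s u by simp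
          finally show "norm (F (s, u', x (\<sigma> s u')) - F (s, u, x (\<sigma> s u))) \<le> C1 * ?h + M / 2"
            using 1 norm_triangle_mono[OF 1, of "F (s, u, x (\<sigma> s u')) - F (s, u, x (\<sigma> s u))" "M/2"] by simp
        qed
      qed
      finally show "norm (x (snd r) - x (fst r)) \<le> (C1 + C2) * ?h + M / 2"
        using u by (simp add: algebra_simps)
    qed
    then show ?thesis by (simp add: Lx_def algebra_simps)
  qed
  \<comment> \<open>second use: the error of linear approximation by \<open>W\<close> is of smaller order\<close>
  obtain MW where MW: "\<And>\<rho>. \<rho> \<in> ?D \<Longrightarrow> norm (W \<rho>) \<le> MW"
    using compact_imp_bounded[OF compact_continuous_image[OF Wc compact_cball]]
    unfolding bounded_iff by blast
  define E where "E r = norm (x (snd r) - x (fst r) - W (fst r) (snd r - fst r))" for r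
  have rem: "\<exists>h0>0. \<forall>\<rho>\<in>?D. \<forall>\<rho>'\<in>?D. norm (\<rho>' - \<rho>) < h0 \<longrightarrow> E (\<rho>, \<rho>') \<le> e * norm (\<rho>' - \<rho>)"
    if e: "e > 0" for e
  proof -
    define e1 where "e1 = e / (2 * (Lx + 2))"
    have e1: "e1 > 0" using e Lx0 by (simp add: e1_def)
    obtain d1 where d1: "d1 > 0" "\<And>q q'. q \<in> Q \<Longrightarrow> q' \<in> Q \<Longrightarrow> dist q' q < d1 \<Longrightarrow>
        norm (F q' - F q - F' q (q' - q)) \<le> e1 * norm (q' - q)"
      using C1_compact_remainder[OF QF QF' Q(1,2) e1] by blast
    obtain d2 where d2: "d2 > 0" "\<And>q q'. q \<in> ?D \<Longrightarrow> q' \<in> ?D \<Longrightarrow> dist q' q < d2 \<Longrightarrow>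
        norm (b q' - b q - b' q (q' - q)) \<le> e1 * norm (q' - q)"
      using C1_compact_remainder[OF Db Db' compact_cball convex_cball e1] by blast
    define h0 where "h0 = min d2 (d1 / (Lx + 1))"
    have h0: "h0 > 0" using d1 d2 Lx0 by (simp add: h0_def)
    have "E (\<rho>, \<rho>') \<le> e * norm (\<rho>' - \<rho>)"
      if \<rho>: "\<rho> \<in> ?D" "\<rho>' \<in> ?D" "norm (\<rho>' - \<rho>) < h0" for \<rho> \<rho>'
    proof -
      let ?h = "norm (\<rho>' - \<rho>)"
      have hd: "?h < d2" "(Lx + 1) * ?h < d1"
        using \<rho>(3) Lx0 by (auto simp: h0_def field_simps)
      have "E (\<rho>, \<rho>') \<le> 2 * (e1 * (Lx + 2) * ?h)"
      proof (rule halving_bound[where D="?P ?h" and bnd="2 * Mx + MW * ?h"])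
        show "E r \<le> 2 * Mx + MW * ?h" if r: "r \<in> ?P ?h" for r
        proof -
          obtain u u' where u: "r = (u, u')" "u \<in> ?D" "u' \<in> ?D" "norm (u' - u) \<le> ?h" using r by auto
          have "norm (W u (u' - u)) \<le> MW * ?h"
            using norm_blinfun[of "W u" "u' - u"] mult_mono[OF MW[OF u(2)] u(4)] MW[OF u(2)]
              order_trans[OF norm_ge_zero MW[OF u(2)]] by (meson norm_ge_zero order_trans)
          then show ?thesis
            unfolding E_def u using Mx[OF u(2)] Mx[OF u(3)] norm_triangle_ineq4[of "x u'" "x u"]
              norm_triangle_ineq4[of "x u' - x u" "W u (u' - u)"] by simp
        qed
        show "(\<rho>, \<rho>') \<in> ?P ?h" using \<rho> by auto
        fix M r
        assume M: "\<And>r. r \<in> ?P ?h \<Longrightarrow> E r \<le> M" and r: "r \<in> ?P ?h"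
        obtain u u' where u: "r = (u, u')" "u \<in> ?D" "u' \<in> ?D" "norm (u' - u) \<le> ?h" using r by auto
        let ?I = "\<lambda>s. F (s, u', x (\<sigma> s u')) - F (s, u, x (\<sigma> s u)) -
            F' (s, u, x (\<sigma> s u)) (0, u' - u, W (\<sigma> s u) (\<sigma> s (u' - u)))"
        have "x u' - x u - W u (u' - u) = (b u' - b u - b' u (u' - u)) + integral {0..1} ?I"
          using eq[of u] eq[of u'] u DV intF[of u] intF[of u'] intLW[OF u(2)] Weq'[OF u(2), of "u' - u"]
          by (simp add: integral_diff integrable_diff subset_iff)
        also have "norm \<dots> \<le> e1 * ?h + (e1 * (Lx + 1) * ?h + M / 2)"
        proof (rule norm_triangle_mono)
          have "norm (b u' - b u - b' u (u' - u)) \<le> e1 * norm (u' - u)"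
            using d2(2)[of u u'] u hd(1) by (simp add: dist_norm)
          also have "\<dots> \<le> e1 * ?h" using u(4) e1 by (intro mult_left_mono) auto
          finally show "norm (b u' - b u - b' u (u' - u)) \<le> e1 * ?h" .
          show "norm (integral {0..1} ?I) \<le> e1 * (Lx + 1) * ?h + M / 2"
          proof (rule norm_integral_unit_interval_le)
            show "?I integrable_on {0..1}"
              using intF u intLW by (intro integrable_diff) auto
            fix s :: real assume s: "s \<in> {0..1}"
            let ?q = "(s, u, x (\<sigma> s u))" and ?q' = "(s, u', x (\<sigma> s u'))"
            have Dq: "norm (?q' - ?q) \<le> (Lx + 1) * ?h"
            proof -
              have "norm (?q' - ?q) \<le> norm (u' - u) + norm (x (\<sigma> s u') - x (\<sigma> s u))"
                using norm_Pair_le[of "u' - u" "x (\<sigma> s u') - x (\<sigma> s u)"] by (simp add: norm_Pair)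
              also have "norm (x (\<sigma> s u') - x (\<sigma> s u)) \<le> Lx * norm (\<sigma> s u' - \<sigma> s u)"
                using Lipx \<sigma>_cball[OF s] u by blast
              also have "\<dots> \<le> Lx * norm (u' - u)"
                using norm_\<sigma>[OF s, of "u' - u"] Lx0 by (intro mult_left_mono) (auto simp: \<sigma>_diff)
              finally have "norm (?q' - ?q) \<le> (Lx + 1) * norm (u' - u)" by (simp add: algebra_simps)
              also have "\<dots> \<le> (Lx + 1) * ?h" using u(4) Lx0 by (intro mult_left_mono) auto
              finally show ?thesis .
            qed
            have "dist ?q' ?q < d1" using Dq hd(2) unfolding dist_norm by linarith
            from d1(2)[OF qQ[OF s u(2)] qQ[OF s u(3)] this]
            have R: "norm (F ?q' - F ?q - F' ?q (?q' - ?q)) \<le> e1 * ((Lx + 1) * ?h)"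
              by (rule order_trans) (use Dq e1 in \<open>intro mult_left_mono, auto\<close>)
            have lin: "F' ?q (?q' - ?q) - F' ?q (0, u' - u, W (\<sigma> s u) (\<sigma> s (u' - u))) =
                (G s u o\<^sub>L inB) (x (\<sigma> s u') - x (\<sigma> s u) - W (\<sigma> s u) (\<sigma> s u' - \<sigma> s u))"
              by (simp add: G_def inB blinfun.diff_right[symmetric] \<sigma>_diff)
            have "norm ((G s u o\<^sub>L inB) (x (\<sigma> s u') - x (\<sigma> s u) - W (\<sigma> s u) (\<sigma> s u' - \<sigma> s u)))
                \<le> 1 / 2 * E (\<sigma> s u, \<sigma> s u')"
              using order_trans[OF norm_blinfun mult_right_mono[OF GB[OF s u(2)] norm_ge_zero]]
              by (simp add: E_def)
            also have "\<dots> \<le> M / 2" using M[OF \<sigma>P[of u u' ?h s]] r s u by simp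
            finally have B: "norm (F' ?q (?q' - ?q) - F' ?q (0, u' - u, W (\<sigma> s u) (\<sigma> s (u' - u)))) \<le> M / 2"
              unfolding lin .
            have "?I s = (F ?q' - F ?q - F' ?q (?q' - ?q)) +
                (F' ?q (?q' - ?q) - F' ?q (0, u' - u, W (\<sigma> s u) (\<sigma> s (u' - u))))" by simp
            then show "norm (?I s) \<le> e1 * (Lx + 1) * ?h + M / 2"
              using norm_triangle_mono[OF R B] by (simp add: mult.assoc)
          qed
        qed
        finally show "E r \<le> e1 * (Lx + 2) * ?h + M / 2"
          using u by (simp add: E_def algebra_simps)
      qed
      also have "\<dots> = e * ?h" using Lx0 by (simp add: e1_def field_simps)
      finally show ?thesis .
    qed
    then show ?thesis using h0 by blast
  qed
  show thesis
  proof
    show "continuous_on ?D W" by fact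
    show "(x has_derivative W \<rho>) (at \<rho>)" if \<rho>: "\<rho> \<in> ball 0 d'" for \<rho>
      unfolding has_derivative_at_alt
    proof (intro conjI allI impI blinfun.bounded_linear_right)
      fix e :: real assume "e > 0"
      from rem[OF this] obtain h0 where h0: "h0 > 0"
        "\<And>\<rho> \<rho>'. \<rho> \<in> ?D \<Longrightarrow> \<rho>' \<in> ?D \<Longrightarrow> norm (\<rho>' - \<rho>) < h0 \<Longrightarrow> E (\<rho>, \<rho>') \<le> e * norm (\<rho>' - \<rho>)" by blast
      show "\<exists>h>0. \<forall>y. norm (y - \<rho>) < h \<longrightarrow> norm (x y - x \<rho> - blinfun_apply (W \<rho>) (y - \<rho>)) \<le> e * norm (y - \<rho>)"
      proof (intro exI[of _ "min h0 (d' - norm \<rho>)"] conjI allI impI)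
        show "0 < min h0 (d' - norm \<rho>)" using h0 \<rho> by simp
        fix y assume y: "norm (y - \<rho>) < min h0 (d' - norm \<rho>)"
        have "y \<in> ?D" using y norm_triangle_sub[of y \<rho>] by simp
        then show "norm (x y - x \<rho> - blinfun_apply (W \<rho>) (y - \<rho>)) \<le> e * norm (y - \<rho>)"
          using h0(2)[of \<rho> y] y \<rho> by (simp add: E_def)
      qed
    qed
    show "W \<rho> v = frechet_derivative b (at \<rho>) v +
        integral {0..1} (\<lambda>s. frechet_derivative F (at (s, \<rho>, x (\<sigma> s \<rho>))) (0, v, W (\<sigma> s \<rho>) (\<sigma> s v)))"
      if \<rho>: "\<rho> \<in> cball 0 d'" for \<rho> v
    proof -
      have "frechet_derivative F (at (s, \<rho>, x (\<sigma> s \<rho>))) = F' (s, \<rho>, x (\<sigma> s \<rho>))" if "s \<in> {0..1}" for s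
        using F' qQ[OF that \<rho>] Q(3) frechet_derivative_eqI by blast
      moreover have "frechet_derivative b (at \<rho>) = b' \<rho>" using b' \<rho> DV frechet_derivative_eqI by blast
      moreover have "integral {0..1} (\<lambda>s. frechet_derivative F (at (s, \<rho>, x (\<sigma> s \<rho>))) (0, v, W (\<sigma> s \<rho>) (\<sigma> s v)))
          = integral {0..1} (\<lambda>s. F' (s, \<rho>, x (\<sigma> s \<rho>)) (0, v, W (\<sigma> s \<rho>) (\<sigma> s v)))"
        by (rule integral_cong) (simp only: calculation)
      ultimately show ?thesis using Weq'[OF \<rho>, of v] by simp
    qed
  qed
qed

end

context radial_scaling
begin

text \<open>
  The open domain \<open>O'\<close> of the right-hand side is kept separate from \<open>[0,1] \<times> ball 0 d \<times> \<Omega>\<close>: after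
  differentiation the new right-hand side contains \<open>x (\<sigma> s \<rho>)\<close> and is defined only where \<open>\<sigma> s \<rho>\<close> stays
  in the ball, which for \<open>s\<close> outside \<open>[0,1]\<close> is a condition on \<open>\<rho>\<close>.
\<close>

definition solves :: "real \<Rightarrow> (real \<times> 'a \<times> 'b) set \<Rightarrow> 'b set \<Rightarrow> (real \<times> 'a \<times> 'b \<Rightarrow> 'b) \<Rightarrow> ('a \<Rightarrow> 'b)
    \<Rightarrow> ('a \<Rightarrow> 'b::euclidean_space) \<Rightarrow> bool" where
  "solves d O' \<Omega> F b x \<longleftrightarrow>
    open O' \<and> open \<Omega> \<and> convex \<Omega> \<and> {0..1} \<times> ball 0 d \<times> \<Omega> \<subseteq> O' \<and>
    (\<forall>s\<in>{0..1}. \<forall>\<rho>\<in>ball 0 d. \<forall>z\<in>\<Omega>. \<forall>z'\<in>\<Omega>.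
       norm (F (s, \<rho>, z) - F (s, \<rho>, z')) \<le> norm (z - z') / 2) \<and>
    continuous_on (ball 0 d) x \<and> x ` ball 0 d \<subseteq> \<Omega> \<and>
    (\<forall>\<rho>\<in>ball 0 d. x \<rho> = b \<rho> + integral {0..1} (\<lambda>s. F (s, \<rho>, x (\<sigma> s \<rho>))))"

text \<open>
  On each smaller ball the derivative agrees with the local solution of the linearised equation, so
  that equation holds on the whole open ball.
\<close>

lemma solves_derivative:
  fixes b x :: "'a \<Rightarrow> 'b::euclidean_space"
  assumes sol: "solves d O' \<Omega> F b x" and F: "Ck_on (Suc 0) O' F" and b: "Ck_on (Suc 0) (ball 0 d) b"
  shows "\<And>\<rho>. \<rho> \<in> ball 0 d \<Longrightarrow> (x has_derivative frechet_derivative x (at \<rho>)) (at \<rho>)"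
    and "continuous_on (ball 0 d) (\<lambda>\<rho>. frechet_derivative x (at \<rho>) v)"
    and "\<And>\<rho>. \<rho> \<in> ball 0 d \<Longrightarrow> frechet_derivative x (at \<rho>) v = frechet_derivative b (at \<rho>) v +
        integral {0..1} (\<lambda>s. frechet_derivative F (at (s, \<rho>, x (\<sigma> s \<rho>)))
          (0, v, frechet_derivative x (at (\<sigma> s \<rho>)) (\<sigma> s v)))"
proof -
  have loc: "\<exists>d' W. \<rho> \<in> ball 0 d' \<and> d' < d \<and> continuous_on (cball 0 d') W \<and>
    (\<forall>\<rho>\<in>ball 0 d'. (x has_derivative blinfun_apply (W \<rho>)) (at \<rho>)) \<and>
    (\<forall>\<rho>\<in>cball 0 d'. \<forall>v. blinfun_apply (W \<rho>) v = frechet_derivative b (at \<rho>) v +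
        integral {0..1} (\<lambda>s. frechet_derivative F (at (s, \<rho>, x (\<sigma> s \<rho>))) (0, v, blinfun_apply (W (\<sigma> s \<rho>)) (\<sigma> s v))))"
    if \<rho>: "\<rho> \<in> ball 0 d" for \<rho> :: 'a
  proof -
    obtain d' where d': "norm \<rho> < d'" "d' < d" using \<rho> dense[of "norm \<rho>" d] by auto
    have s: "open O'" "open \<Omega>" "convex \<Omega>" "{0..1} \<times> ball 0 d \<times> \<Omega> \<subseteq> O'"
      "continuous_on (ball 0 d) x" "x ` ball 0 d \<subseteq> \<Omega>"
      using sol unfolding solves_def by auto
    have l: "norm (F (s, \<rho>, z) - F (s, \<rho>, z')) \<le> norm (z - z') / 2"
      if "s \<in> {0..1}" "\<rho> \<in> ball 0 d" "z \<in> \<Omega>" "z' \<in> \<Omega>" for s \<rho> z z'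
      using sol that unfolding solves_def by blast
    have e: "x \<rho> = b \<rho> + integral {0..1} (\<lambda>s. F (s, \<rho>, x (\<sigma> s \<rho>)))" if "\<rho> \<in> ball 0 d" for \<rho>
      using sol that unfolding solves_def by blast
    obtain W :: "'a \<Rightarrow> 'a \<Rightarrow>\<^sub>L 'b" where "continuous_on (cball 0 d') W"
      "\<And>\<rho>. \<rho> \<in> ball 0 d' \<Longrightarrow> (x has_derivative blinfun_apply (W \<rho>)) (at \<rho>)"
      "\<And>\<rho> v. \<rho> \<in> cball 0 d' \<Longrightarrow> blinfun_apply (W \<rho>) v = frechet_derivative b (at \<rho>) v +
        integral {0..1} (\<lambda>s. frechet_derivative F (at (s, \<rho>, x (\<sigma> s \<rho>))) (0, v, blinfun_apply (W (\<sigma> s \<rho>)) (\<sigma> s v)))"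
      using solution_C1_on_cball[OF d'(2) s(1) F s(2,3,4) l b s(5,6) e] by blast
    then show ?thesis using d' by (intro exI[of _ d'] exI[of _ W]) auto
  qed
  show der: "(x has_derivative frechet_derivative x (at \<rho>)) (at \<rho>)" if "\<rho> \<in> ball 0 d" for \<rho>
    using loc[OF that] frechet_derivative_eqI by metis
  show "frechet_derivative x (at \<rho>) v = frechet_derivative b (at \<rho>) v +
        integral {0..1} (\<lambda>s. frechet_derivative F (at (s, \<rho>, x (\<sigma> s \<rho>)))
          (0, v, frechet_derivative x (at (\<sigma> s \<rho>)) (\<sigma> s v)))" if \<rho>: "\<rho> \<in> ball 0 d" for \<rho>
  proof -
    obtain d' W where W: "\<rho> \<in> ball 0 d'"
      "\<And>\<rho>. \<rho> \<in> ball 0 d' \<Longrightarrow> (x has_derivative blinfun_apply (W \<rho>)) (at \<rho>)"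
      "\<And>\<rho> v. \<rho> \<in> cball 0 d' \<Longrightarrow> blinfun_apply (W \<rho>) v = frechet_derivative b (at \<rho>) v +
        integral {0..1} (\<lambda>s. frechet_derivative F (at (s, \<rho>, x (\<sigma> s \<rho>))) (0, v, blinfun_apply (W (\<sigma> s \<rho>)) (\<sigma> s v)))"
      using loc[OF \<rho>] by (elim exE conjE) blast
    have eq: "frechet_derivative x (at \<rho>) = W \<rho>" if "\<rho> \<in> ball 0 d'" for \<rho>
      using W(2)[OF that] frechet_derivative_eqI by blast
    have "integral {0..1} (\<lambda>s. frechet_derivative F (at (s, \<rho>, x (\<sigma> s \<rho>))) (0, v, frechet_derivative x (at (\<sigma> s \<rho>)) (\<sigma> s v)))
        = integral {0..1} (\<lambda>s. frechet_derivative F (at (s, \<rho>, x (\<sigma> s \<rho>))) (0, v, blinfun_apply (W (\<sigma> s \<rho>)) (\<sigma> s v)))"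
      by (rule integral_cong) (simp only: eq[OF \<sigma>_ball[OF _ W(1)]])
    then show ?thesis using W(3)[of \<rho> v] W(1) eq[OF W(1)] by simp
  qed
  show "continuous_on (ball 0 d) (\<lambda>\<rho>. frechet_derivative x (at \<rho>) v)"
  proof (rule continuous_at_imp_continuous_on, rule ballI)
    fix \<rho> :: 'a assume \<rho>: "\<rho> \<in> ball 0 d"
    obtain d' W where W: "\<rho> \<in> ball 0 d'" "continuous_on (cball 0 d') W"
      "\<And>\<rho>. \<rho> \<in> ball 0 d' \<Longrightarrow> (x has_derivative blinfun_apply (W \<rho>)) (at \<rho>)"
      using loc[OF \<rho>] by auto
    have "continuous_on (ball 0 d') (\<lambda>\<rho>. blinfun_apply (W \<rho>) v)"
      by (rule continuous_on_subset[OF bounded_linear.continuous_on[OF blinfun.bounded_linear_left W(2)] ball_subset_cball])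
    then have "continuous_on (ball 0 d') (\<lambda>\<rho>. frechet_derivative x (at \<rho>) v)"
      by (rule continuous_on_eq) (use W(3) frechet_derivative_eqI in metis)
    then show "isCont (\<lambda>\<rho>. frechet_derivative x (at \<rho>) v) \<rho>"
      using W(1) continuous_on_eq_continuous_at open_ball by blast
  qed
qed

lemma Ck_on_\<sigma>:
  fixes f :: "'c::euclidean_space \<Rightarrow> real"
  assumes "open X" "Ck_on k X f" "Ck_on k X g"
  shows "Ck_on k X (\<lambda>q. \<sigma> (f q) (g q))"
proof -
  have *: "Ck_on k X (\<lambda>q. f q + (- 1))" by (intro Ck_on_add Ck_on_const assms)
  have "Ck_on k X (\<lambda>q. g q + (f q + (- 1)) *\<^sub>R p (g q))"
    by (intro Ck_on_add Ck_on_bilinear[OF _ bounded_bilinear_scaleR]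
        Ck_on_bounded_linear[OF _ bounded_linear_p] * assms)
  then show ?thesis by (simp add: \<sigma>_def)
qed

text \<open>
  Induction on \<open>k\<close> for all equations simultaneously. The derivative of a solution in a direction \<open>v\<close>
  with \<open>p v = v\<close> or \<open>p v = 0\<close> solves an equation of the same form, because \<open>\<sigma> s v\<close> is then a multiple
  of \<open>v\<close>; its right-hand side is affine in the unknown and involves \<open>x\<close>, which is \<open>C\<^sup>k\<close> by the induction
  hypothesis. Every direction is a sum of two such directions.
\<close>

lemma solves_Ck:
  fixes b x :: "'a \<Rightarrow> 'b::euclidean_space"
  assumes "solves d O' \<Omega> F b x" "Ck_on k O' F" "Ck_on k (ball 0 d) b"
  shows "Ck_on k (ball 0 d) x"
  using assms
proof (induction k arbitrary: O' \<Omega> F b x)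
  case 0
  then show ?case by (simp add: solves_def)
next
  case (Suc k)
  let ?V = "ball (0::'a) d"
  have F1: "Ck_on (Suc 0) O' F" and b1: "Ck_on (Suc 0) ?V b"
    by (rule Ck_on_le[OF Suc.prems(2)], simp, rule Ck_on_le[OF Suc.prems(3)], simp)
  have sol: "open O'" "open \<Omega>" "convex \<Omega>" "{0..1} \<times> ?V \<times> \<Omega> \<subseteq> O'" "continuous_on ?V x" "x ` ?V \<subseteq> \<Omega>"
    using Suc.prems(1) unfolding solves_def by auto
  note der = solves_derivative[OF Suc.prems(1) F1 b1]
  \<comment> \<open>one derivative of \<open>F\<close> and \<open>b\<close> is given away\<close>
  have xk: "Ck_on k ?V x"
    using Suc.IH[OF Suc.prems(1) Ck_on_SucD[OF Suc.prems(2)] Ck_on_SucD[OF Suc.prems(3)]] .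
  have main: "Ck_on k ?V (\<lambda>\<rho>. frechet_derivative x (at \<rho>) v)"
    if c: "\<And>s. \<sigma> s v = c s *\<^sub>R v" "Ck_on k UNIV c" "\<And>s. s \<in> {0..1} \<Longrightarrow> \<bar>c s\<bar> \<le> 1" for v and c :: "real \<Rightarrow> real"
  proof -
    define O1 :: "(real \<times> 'a \<times> 'b) set" where "O1 = {q. fst (snd q) \<in> ?V \<and> \<sigma> (fst q) (fst (snd q)) \<in> ?V}"
    define \<Gamma> :: "real \<times> 'a \<times> 'b \<Rightarrow> real \<times> 'a \<times> 'b"
      where "\<Gamma> q = (fst q, fst (snd q), x (\<sigma> (fst q) (fst (snd q))))" for q
    define Ov where "Ov = O1 \<inter> \<Gamma> -` O'"
    define Fv where "Fv q = frechet_derivative F (at (\<Gamma> q)) (0, v, c (fst q) *\<^sub>R snd (snd q))" for q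
    have "open O1" unfolding O1_def
      by (intro open_Collect_conj) (auto intro!: open_Collect_less continuous_intros simp: dist_norm)
    have ck1: "Ck_on k X (\<lambda>q::real \<times> 'a \<times> 'b. fst q)" "Ck_on k X (\<lambda>q::real \<times> 'a \<times> 'b. fst (snd q))"
      "Ck_on k X (\<lambda>q::real \<times> 'a \<times> 'b. snd (snd q))" if "open X" for X
      using that by (auto intro!: Ck_on_linear_map bounded_linear_fst bounded_linear_snd
          bounded_linear_compose[OF bounded_linear_fst] bounded_linear_compose[OF bounded_linear_snd])
    have \<Gamma>k: "Ck_on k O1 \<Gamma>"
    proof -
      have "Ck_on k O1 (\<lambda>q. x (\<sigma> (fst q) (fst (snd q))))"
      proof (rule Ck_on_compose[OF \<open>open O1\<close> open_ball _ xk])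
        show "Ck_on k O1 (\<lambda>q. \<sigma> (fst q) (fst (snd q)))"
          by (intro Ck_on_\<sigma> ck1 \<open>open O1\<close>)
      qed (auto simp: O1_def)
      then show ?thesis unfolding \<Gamma>_def by (intro Ck_on_Pair ck1 \<open>open O1\<close>)
    qed
    have "open Ov" unfolding Ov_def
      by (rule continuous_open_preimage[OF Ck_on_imp_continuous_on[OF \<Gamma>k] \<open>open O1\<close> sol(1)])
    have \<Gamma>k': "Ck_on k Ov \<Gamma>" using Ck_on_subset[OF \<Gamma>k] by (auto simp: Ov_def)
    have dF: "Ck_on k Ov (\<lambda>q. frechet_derivative F (at (\<Gamma> q)) w)" for w
      by (rule Ck_on_compose[OF \<open>open Ov\<close> sol(1) \<Gamma>k' Ck_on_frechet_derivative[OF Suc.prems(2)]])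
         (auto simp: Ov_def)
    have Fv_eq: "frechet_derivative F (at (\<Gamma> q)) (0, v, 0) + c (fst q) *\<^sub>R
        (\<Sum>i\<in>Basis. (snd (snd q) \<bullet> i) *\<^sub>R frechet_derivative F (at (\<Gamma> q)) (0, 0, i)) = Fv q"
      if "q \<in> Ov" for q
    proof -
      have lin: "linear (frechet_derivative F (at (\<Gamma> q)))"
        using Ck_on_Suc_has_derivative[OF F1, of "\<Gamma> q"] that has_derivative_linear by (auto simp: Ov_def)
      have lin2: "linear (\<lambda>z. frechet_derivative F (at (\<Gamma> q)) (0, 0, z))"
        using linear_compose[OF _ lin, of "\<lambda>z. (0, 0, z)"]
        by (auto simp: o_def linear_iff)
      have "Fv q = frechet_derivative F (at (\<Gamma> q)) ((0, v, 0) + c (fst q) *\<^sub>R (0, 0, snd (snd q)))"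
        unfolding Fv_def by simp
      also have "\<dots> = frechet_derivative F (at (\<Gamma> q)) (0, v, 0) +
          c (fst q) *\<^sub>R frechet_derivative F (at (\<Gamma> q)) (0, 0, snd (snd q))"
        by (simp only: linear_add[OF lin] linear_cmul[OF lin])
      finally show ?thesis using linear_eq_sum_Basis[OF lin2, of "snd (snd q)"] by simp
    qed
    have Fvk: "Ck_on k Ov Fv"
    proof (rule Ck_on_cong[OF \<open>open Ov\<close> Fv_eq])
      have cq: "Ck_on k Ov (\<lambda>q. c (fst q))"
        by (rule Ck_on_compose[OF \<open>open Ov\<close> open_UNIV ck1(1)[OF \<open>open Ov\<close>] c(2)]) simp
      have iq: "Ck_on k Ov (\<lambda>q. snd (snd q) \<bullet> i)" for i
        by (rule Ck_on_bounded_linear[OF \<open>open Ov\<close> bounded_linear_inner_left ck1(3)[OF \<open>open Ov\<close>]])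
      show "Ck_on k Ov (\<lambda>q. frechet_derivative F (at (\<Gamma> q)) (0, v, 0) + c (fst q) *\<^sub>R
          (\<Sum>i\<in>Basis. (snd (snd q) \<bullet> i) *\<^sub>R frechet_derivative F (at (\<Gamma> q)) (0, 0, i)))"
        by (intro Ck_on_add Ck_on_sum Ck_on_bilinear[OF \<open>open Ov\<close> bounded_bilinear_scaleR] dF cq iq \<open>open Ov\<close>)
    qed
    have mem: "(s, \<rho>, z) \<in> Ov" if "s \<in> {0..1}" "\<rho> \<in> ?V" for s \<rho> z
    proof -
      have "x (\<sigma> s \<rho>) \<in> \<Omega>" using \<sigma>_ball[OF that] sol(6) by blast
      then have "(s, \<rho>, x (\<sigma> s \<rho>)) \<in> O'" using sol(4) that by blast
      then show ?thesis using that \<sigma>_ball[OF that] unfolding Ov_def O1_def \<Gamma>_def by simp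
    qed
    have "solves d Ov UNIV Fv (\<lambda>\<rho>. frechet_derivative b (at \<rho>) v) (\<lambda>\<rho>. frechet_derivative x (at \<rho>) v)"
      unfolding solves_def
    proof (intro conjI ballI)
      show "{0..1} \<times> ?V \<times> UNIV \<subseteq> Ov" using mem by auto
      show "continuous_on ?V (\<lambda>\<rho>. frechet_derivative x (at \<rho>) v)" by (rule der(2))
      show "norm (Fv (s, \<rho>, z) - Fv (s, \<rho>, z')) \<le> norm (z - z') / 2"
        if s: "s \<in> {0..1}" and \<rho>: "\<rho> \<in> ?V" for s \<rho> z z'
      proof -
        let ?y = "x (\<sigma> s \<rho>)"
        have y: "?y \<in> \<Omega>" using \<sigma>_ball[OF s \<rho>] sol(6) by auto
        have Fd: "(F has_derivative frechet_derivative F (at (s, \<rho>, ?y))) (at (s, \<rho>, ?y))"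
          by (rule Ck_on_Suc_has_derivative[OF F1]) (use s \<rho> y sol(4) in auto)
        have d1: "((\<lambda>z. (s, \<rho>, z)) has_derivative (\<lambda>z. (0, 0, z))) (at ?y)"
          by (auto intro!: derivative_eq_intros)
        have "norm (frechet_derivative F (at (s, \<rho>, ?y)) (0, 0, c s *\<^sub>R (z - z'))) \<le> 1 / 2 * norm (c s *\<^sub>R (z - z'))"
        proof (rule norm_derivative_le_Lipschitz[OF has_derivative_compose[OF d1 Fd] sol(2) y])
          show "norm (F (s, \<rho>, y') - F (s, \<rho>, ?y)) \<le> 1 / 2 * norm (y' - ?y)" if "y' \<in> \<Omega>" for y'
            using Suc.prems(1) s \<rho> y that unfolding solves_def by simp
        qed
        also have "\<dots> \<le> norm (z - z') / 2"
          using mult_right_mono[OF c(3)[OF s] norm_ge_zero[of "z - z'"]] by simp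
        also have "frechet_derivative F (at (s, \<rho>, ?y)) (0, 0, c s *\<^sub>R (z - z')) = Fv (s, \<rho>, z) - Fv (s, \<rho>, z')"
          unfolding Fv_def \<Gamma>_def using linear_diff[OF has_derivative_linear[OF Fd], of "(0, v, c s *\<^sub>R z)" "(0, v, c s *\<^sub>R z')"]
          by (simp add: scaleR_diff_right)
        finally show ?thesis .
      qed
      show "frechet_derivative x (at \<rho>) v = frechet_derivative b (at \<rho>) v +
          integral {0..1} (\<lambda>s. Fv (s, \<rho>, frechet_derivative x (at (\<sigma> s \<rho>)) v))" if \<rho>: "\<rho> \<in> ?V" for \<rho>
      proof -
        have "integral {0..1} (\<lambda>s. Fv (s, \<rho>, frechet_derivative x (at (\<sigma> s \<rho>)) v)) =
          integral {0..1} (\<lambda>s. frechet_derivative F (at (s, \<rho>, x (\<sigma> s \<rho>)))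
            (0, v, frechet_derivative x (at (\<sigma> s \<rho>)) (\<sigma> s v)))"
        proof (rule integral_cong)
          fix s :: real assume s: "s \<in> {0..1}"
          show "Fv (s, \<rho>, frechet_derivative x (at (\<sigma> s \<rho>)) v) =
            frechet_derivative F (at (s, \<rho>, x (\<sigma> s \<rho>))) (0, v, frechet_derivative x (at (\<sigma> s \<rho>)) (\<sigma> s v))"
            using linear_cmul[OF has_derivative_linear[OF der(1)[OF \<sigma>_ball[OF s \<rho>]]]]
            by (simp add: Fv_def \<Gamma>_def c(1))
        qed
        then show ?thesis using der(3)[OF \<rho>, of v] by simp
      qed
    qed (use \<open>open Ov\<close> in auto)
    then show ?thesis
      by (rule Suc.IH[OF _ Fvk Ck_on_frechet_derivative[OF Suc.prems(3)]])
  qed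
  show ?case
  proof (rule Ck_on_SucI[OF open_ball der(1)])
    fix v
    have pv: "p (p v) = p v" "p (v - p v) = 0"
      using linear_p by (simp_all add: p_idem linear_diff)
    have "Ck_on k ?V (\<lambda>\<rho>. frechet_derivative x (at \<rho>) (p v) + frechet_derivative x (at \<rho>) (v - p v))"
    proof (intro Ck_on_add open_ball)
      show "Ck_on k ?V (\<lambda>\<rho>. frechet_derivative x (at \<rho>) (p v))"
        by (rule main[of "p v" "\<lambda>s. s"]) (auto simp: \<sigma>_p[OF pv(1)] intro!: Ck_on_linear_map bounded_linear_ident)
      show "Ck_on k ?V (\<lambda>\<rho>. frechet_derivative x (at \<rho>) (v - p v))"
        by (rule main[of "v - p v" "\<lambda>s. 1"]) (auto simp: \<sigma>_perp[OF pv(2)] intro!: Ck_on_const)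
    qed
    moreover have "frechet_derivative x (at \<rho>) (p v) + frechet_derivative x (at \<rho>) (v - p v) = frechet_derivative x (at \<rho>) v"
      if "\<rho> \<in> ?V" for \<rho>
      using linear_add[OF has_derivative_linear[OF der(1)[OF that]], of "p v" "v - p v"] by simp
    ultimately show "Ck_on k ?V (\<lambda>\<rho>. frechet_derivative x (at \<rho>) v)"
      using Ck_on_cong[OF open_ball] by (metis (no_types, lifting))
  qed
qed

lemma solves_smooth:
  fixes b x :: "'a \<Rightarrow> 'b::euclidean_space"
  assumes "solves d O' \<Omega> F b x" "smooth_on O' F" "smooth_on (ball 0 d) b"
  shows "smooth_on (ball 0 d) x"
  using solves_Ck[OF assms(1)] assms(2,3) by (simp add: smooth_on_def)

end

section \<open>Smooth inverses and integrals with parameters\<close>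

text \<open>
  The classical theorem gives a differentiable inverse \<open>g\<close>. Smoothness follows by induction: the
  derivative of \<open>g\<close> is the inverse matrix of the derivative of \<open>f\<close> at \<open>g y\<close>, hence as often
  differentiable as \<open>g\<close>.
\<close>

lemma smooth_inverse_function:
  fixes f :: "real^'n::finite \<Rightarrow> real^'n"
  assumes U: "open U" "smooth_on U f" "x0 \<in> U" and inj: "inj (frechet_derivative f (at x0))"
  obtains e N' g where "e > 0" "ball x0 e \<subseteq> U" "smooth_diffeo (ball x0 e) N' f g"
proof -
  obtain f' where f': "\<And>x. x \<in> U \<Longrightarrow> (f has_derivative blinfun_apply (f' x)) (at x)"
    and f'c: "continuous_on U f'"
    using Ck_on_1_blinfun[of U f] U(2) unfolding smooth_on_def by blast
  have fd: "frechet_derivative f (at x) = blinfun_apply (f' x)" if "x \<in> U" for x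
    using f'[OF that] frechet_derivative_eqI by blast
  have lin0: "linear (blinfun_apply (f' x))" for x by (rule bounded_linear.linear[OF blinfun.bounded_linear_right])
  obtain h where h: "linear h" "h \<circ> blinfun_apply (f' x0) = id"
    using linear_injective_left_inverse[OF lin0] inj fd[OF U(3)] by metis
  \<comment> \<open>a left inverse suffices in finite dimension\<close>
  have "Blinfun h o\<^sub>L f' x0 = id_blinfun"
    by (rule blinfun_eqI)
       (use h in \<open>simp add: bounded_linear_Blinfun_apply linear_conv_bounded_linear[symmetric] o_def fun_eq_iff\<close>)
  from inverse_function_theorem[OF U(1) f' f'c U(3) this]
  obtain U' V g g' where *: "open U'" "U' \<subseteq> U" "x0 \<in> U'" "open V" "f x0 \<in> V" "homeomorphism U' V f g"
    "\<And>y. y \<in> V \<Longrightarrow> (g has_derivative g' y) (at y)"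
    "\<And>y. y \<in> V \<Longrightarrow> g' y = inv (blinfun_apply (f' (g y)))"
    "\<And>y. y \<in> V \<Longrightarrow> bij (blinfun_apply (f' (g y)))" by metis
  have gU: "g y \<in> U'" if "y \<in> V" for y using *(6) that by (auto simp: homeomorphism_def)
  let ?M = "\<lambda>y. matrix (frechet_derivative f (at (g y)))"
  have inv: "invertible (?M y)" and g'M: "g' y v = matrix_inv (?M y) *v v" if "y \<in> V" for y v
  proof -
    have fdy: "frechet_derivative f (at (g y)) = blinfun_apply (f' (g y))" using fd gU[OF that] *(2) by blast
    show i: "invertible (?M y)"
      unfolding fdy invertible_eq_bij using *(9)[OF that] matrix_vector_mul(2)[OF lin0] by simp
    have "blinfun_apply (f' (g y)) (matrix_inv (?M y) *v v) = v"
      using matrix_inv_left_right(2)[OF i] fun_cong[OF matrix_vector_mul(2)[OF lin0], of "g y"] unfolding fdy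
      by (metis matrix_vector_mul_assoc matrix_vector_mul_lid)
    then show "g' y v = matrix_inv (?M y) *v v"
      using *(8,9)[OF that] by (metis bij_inv_eq_iff)
  qed
  have gk: "Ck_on n V g" for n
  proof (induction n)
    case 0
    then show ?case using *(6) by (simp add: homeomorphism_def)
  next
    case (Suc n)
    show ?case
    proof (rule Ck_on_SucI[OF *(4) *(7)])
      fix v
      have "Ck_on n V (\<lambda>y. \<chi> i. \<Sum>j\<in>UNIV. matrix_inv (?M y) $ i $ j * v $ j)"
      proof (intro Ck_on_vec_lambda Ck_on_sum Ck_on_bilinear[OF *(4) bounded_bilinear_mult] Ck_on_const
          Ck_on_matrix_inv[OF *(4) _ inv] *(4))
        fix i j
        have "Ck_on n U (\<lambda>x. frechet_derivative f (at x) (axis j 1))"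
          using smooth_on_frechet_derivative[OF U(2)] by (rule smooth_onD)
        from Ck_on_compose[OF *(4) U(1) Suc this] gU *(2)
        have "Ck_on n V (\<lambda>y. frechet_derivative f (at (g y)) (axis j 1))" by blast
        from Ck_on_bounded_linear[OF *(4) bounded_linear_vec_nth this, of i]
        show "Ck_on n V (\<lambda>y. ?M y $ i $ j)" by (simp add: matrix_def)
      qed
      then show "Ck_on n V (\<lambda>y. g' y v)"
        by (rule Ck_on_cong[OF *(4), rotated]) (simp add: g'M matrix_vector_mult_def)
    qed
  qed
  obtain e where e: "e > 0" "ball x0 e \<subseteq> U'" using *(1,3) open_contains_ball by blast
  have hb: "homeomorphism (ball x0 e) (f ` ball x0 e) f g"
    by (rule homeomorphism_of_subsets[OF *(6)]) (use e in auto)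
  have "f ` ball x0 e = V \<inter> g -` ball x0 e"
    using *(6) e by (force simp: homeomorphism_def)
  moreover have "open (V \<inter> g -` ball x0 e)"
    using *(4,6) by (intro continuous_open_preimage) (auto simp: homeomorphism_def)
  moreover have "smooth_on V g" using gk by (simp add: smooth_on_def)
  ultimately have "smooth_diffeo (ball x0 e) (f ` ball x0 e) f g"
    unfolding smooth_diffeo_def using hb smooth_on_subset[OF U(2), of "ball x0 e"] smooth_on_subset[of V g] e *(2) by auto
  then show thesis using that[of e] e *(2) by blast
qed

text \<open>
  Differentiation under the integral sign is the degenerate case of an equation along rays where the
  rays are constant (\<open>p = 0\<close>) and the right-hand side does not contain the unknown.
\<close>

lemma smooth_on_integral:
  fixes G :: "real \<times> 'a::euclidean_space \<Rightarrow> 'b::euclidean_space"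
  assumes O2: "open O2" "smooth_on O2 G" "{0..1} \<times> ball 0 d \<subseteq> O2"
  shows "smooth_on (ball 0 d) (\<lambda>\<rho>. integral {0..1} (\<lambda>s. G (s, \<rho>)))"
    and "\<And>\<rho>. \<rho> \<in> ball 0 d \<Longrightarrow>
       frechet_derivative (\<lambda>\<rho>. integral {0..1} (\<lambda>s. G (s, \<rho>))) (at \<rho>) v =
       integral {0..1} (\<lambda>s. frechet_derivative G (at (s, \<rho>)) (0, v))"
proof -
  interpret radial_scaling "\<lambda>v::'a. 0"
    by standard (auto simp: linear_zero)
  have \<sigma>[simp]: "\<sigma> s v = v" for s v by (simp add: \<sigma>_def)
  let ?x = "\<lambda>\<rho>. integral {0..1} (\<lambda>s. G (s, \<rho>))"
  let ?F = "\<lambda>q::real \<times> 'a \<times> 'b. G (fst q, fst (snd q))"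
  let ?O = "{q::real \<times> 'a \<times> 'b. (fst q, fst (snd q)) \<in> O2}"
  have oO: "open ?O"
  proof -
    have "?O = (\<lambda>q. (fst q, fst (snd q))) -` O2" by auto
    then show ?thesis using O2(1) by (simp add: open_vimage continuous_intros)
  qed
  have bl: "bounded_linear (\<lambda>q::real \<times> 'a \<times> 'b. (fst q, fst (snd q)))"
    by (intro bounded_linear_Pair bounded_linear_fst bounded_linear_compose[OF bounded_linear_fst] bounded_linear_snd)
  have Fs: "smooth_on ?O ?F"
    by (rule smooth_on_compose[OF oO O2(1) smooth_on_linear_map[OF oO bl] O2(2)]) auto
  have xc: "continuous_on (ball 0 d) ?x"
  proof -
    have "continuous_on (ball 0 d \<times> cbox 0 1) (\<lambda>(\<rho>, s). G (s, \<rho>))"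
      unfolding split_beta
      by (rule continuous_on_compose2[OF smooth_on_continuous[OF O2(2)]])
         (use O2(3) in \<open>auto intro!: continuous_intros simp: cbox_interval\<close>)
    from integral_continuous_on_param[OF this] show ?thesis by (simp add: cbox_interval)
  qed
  have sol: "solves d ?O UNIV ?F (\<lambda>_. 0) ?x"
    unfolding solves_def using O2(3) oO xc by auto
  show "smooth_on (ball 0 d) ?x"
    by (rule solves_smooth[OF sol Fs smooth_on_const[OF open_ball]])
  fix \<rho> :: 'a assume \<rho>: "\<rho> \<in> ball 0 d"
  have "frechet_derivative ?x (at \<rho>) v = frechet_derivative (\<lambda>_. 0) (at \<rho>) v +
        integral {0..1} (\<lambda>s. frechet_derivative ?F (at (s, \<rho>, ?x (\<sigma> s \<rho>)))
          (0, v, frechet_derivative ?x (at (\<sigma> s \<rho>)) (\<sigma> s v)))"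
    by (rule solves_derivative(3)[OF sol smooth_onD[OF Fs] smooth_onD[OF smooth_on_const[OF open_ball]] \<rho>])
  then have dx: "frechet_derivative ?x (at \<rho>) v =
        integral {0..1} (\<lambda>s. frechet_derivative ?F (at (s, \<rho>, ?x (\<sigma> s \<rho>)))
          (0, v, frechet_derivative ?x (at (\<sigma> s \<rho>)) (\<sigma> s v)))"
    using frechet_derivative_eqI[OF has_derivative_const, of "0::'b" \<rho>] by simp
  have "frechet_derivative ?F (at (s, \<rho>, z)) (0, v, y) = frechet_derivative G (at (s, \<rho>)) (0, v)"
    if "s \<in> {0..1}" for s z y
  proof -
    have 1: "((\<lambda>q::real \<times> 'a \<times> 'b. (fst q, fst (snd q))) has_derivative (\<lambda>q. (fst q, fst (snd q)))) (at (s, \<rho>, z))"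
      using bl bounded_linear_imp_has_derivative by blast
    have 2: "(G has_derivative frechet_derivative G (at (s, \<rho>))) (at (fst (s, \<rho>, z), fst (snd (s, \<rho>, z))))"
    proof -
      have "(s, \<rho>) \<in> O2" using O2(3) that \<rho> by blast
      from smooth_on_has_derivative[OF O2(2) this] show ?thesis by simp
    qed
    show ?thesis
      using frechet_derivative_eqI[OF has_derivative_compose[OF 1 2]] by simp
  qed
  then have Fint: "integral {0..1} (\<lambda>s. frechet_derivative ?F (at (s, \<rho>, ?x (\<sigma> s \<rho>)))
          (0, v, frechet_derivative ?x (at (\<sigma> s \<rho>)) (\<sigma> s v))) =
      integral {0..1} (\<lambda>s. frechet_derivative G (at (s, \<rho>)) (0, v))"
    by (simp only: \<sigma> cong: integral_cong)
  show "frechet_derivative ?x (at \<rho>) v = integral {0..1} (\<lambda>s. frechet_derivative G (at (s, \<rho>)) (0, v))"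
    by (rule trans[OF dx Fint])
qed

definition coord_part :: "('k \<Rightarrow> 'n) \<Rightarrow> real^'n \<Rightarrow> real^'n::finite" where
  "coord_part \<iota> v = (\<chi> j. if j \<in> range \<iota> then v $ j else 0)"

lemma coord_part_scaling: "radial_scaling (coord_part \<iota>)"
proof (unfold radial_scaling_def, intro conjI allI impI)
  show "linear (coord_part \<iota>)"
    by (rule linearI) (auto simp: coord_part_def vec_eq_iff)
  show "coord_part \<iota> (coord_part \<iota> v) = coord_part \<iota> v" for v
    by (auto simp: coord_part_def vec_eq_iff)
  show "norm (v + (s - 1) *\<^sub>R coord_part \<iota> v) \<le> norm v" if "0 \<le> s" "s \<le> 1" for s v
  proof (rule norm_le_componentwise_cart)
    show "norm ((v + (s - 1) *\<^sub>R coord_part \<iota> v) $ i) \<le> norm (v $ i)" for i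
    proof (cases "i \<in> range \<iota>")
      case True
      then have "(v + (s - 1) *\<^sub>R coord_part \<iota> v) $ i = s * v $ i"
        by (simp add: coord_part_def algebra_simps)
      then show ?thesis using that by (simp add: abs_mult mult_left_le_one_le)
    qed (simp add: coord_part_def)
  qed
qed

lemma coord_part_eq_sum:
  fixes \<iota> :: "'k::finite \<Rightarrow> 'n::finite"
  assumes "inj \<iota>"
  shows "coord_part \<iota> v = (\<Sum>l\<in>UNIV. v $ \<iota> l *\<^sub>R axis (\<iota> l) 1)"
proof -
  have "(\<Sum>l\<in>UNIV. (v $ \<iota> l *\<^sub>R axis (\<iota> l) 1 :: real^'n) $ j) = (if j \<in> range \<iota> then v $ j else 0)" for j
  proof (cases "j \<in> range \<iota>")
    case True
    then obtain l where l: "j = \<iota> l" by blast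
    have "(\<Sum>l'\<in>UNIV. (v $ \<iota> l' *\<^sub>R axis (\<iota> l') 1 :: real^'n) $ j) = (\<Sum>l'\<in>UNIV. if l' = l then v $ j else 0)"
      using assms by (intro sum.cong) (auto simp: l axis_def inj_eq)
    then show ?thesis using True by simp
  next
    case False
    then show ?thesis by (auto intro!: sum.neutral simp: axis_def)
  qed
  then show ?thesis by (simp add: vec_eq_iff coord_part_def)
qed

lemma coord_part_axis: "coord_part \<iota> (axis (\<iota> l) 1) = axis (\<iota> l) 1"
  by (auto simp: coord_part_def vec_eq_iff axis_def)

section \<open>Poincare lemmas along the leaves\<close>

text \<open>
  The coordinates with indices \<open>\<iota> l\<close> are coordinates along the leaves, all others label the leaves.
\<close>

locale leaf_coords =
  fixes \<iota> :: "'k::finite \<Rightarrow> 'n::finite"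
  assumes inj_\<iota>: "inj \<iota>"
begin

sublocale radial_scaling "coord_part \<iota>"
  by (rule coord_part_scaling)

abbreviation e :: "'k \<Rightarrow> real^'n" where "e l \<equiv> axis (\<iota> l) 1"

abbreviation pd :: "'k \<Rightarrow> (real^'n \<Rightarrow> 'b::real_normed_vector) \<Rightarrow> real^'n \<Rightarrow> 'b" where
  "pd l f \<rho> \<equiv> frechet_derivative f (at \<rho>) (e l)"

lemma e_component: "e l $ \<iota> m = (if m = l then 1 else 0)"
  using inj_\<iota> by (auto simp: axis_def inj_eq)

lemma \<sigma>_e: "\<sigma> s (e l) = s *\<^sub>R e l"
  by (rule \<sigma>_p[OF coord_part_axis])

lemma \<sigma>_component: "\<sigma> s \<rho> $ \<iota> l = s * \<rho> $ \<iota> l"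
  by (simp add: \<sigma>_def coord_part_def algebra_simps)

lemma \<sigma>_has_derivative: "((\<lambda>s. \<sigma> s \<rho>) has_derivative (\<lambda>h. h *\<^sub>R coord_part \<iota> \<rho>)) (at s within T)"
  unfolding \<sigma>_def by (auto intro!: derivative_eq_intros)

lemma radial_curve_derivative:
  fixes f :: "real^'n \<Rightarrow> 'b::real_normed_vector"
  assumes "(f has_derivative frechet_derivative f (at (\<sigma> s \<rho>))) (at (\<sigma> s \<rho>))"
  shows "((\<lambda>s. f (\<sigma> s \<rho>)) has_vector_derivative (\<Sum>l\<in>UNIV. \<rho> $ \<iota> l *\<^sub>R pd l f (\<sigma> s \<rho>))) (at s within T)"
proof -
  have lin: "linear (frechet_derivative f (at (\<sigma> s \<rho>)))" using assms has_derivative_linear by blast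
  have "frechet_derivative f (at (\<sigma> s \<rho>)) (h *\<^sub>R coord_part \<iota> \<rho>) = h *\<^sub>R (\<Sum>l\<in>UNIV. \<rho> $ \<iota> l *\<^sub>R pd l f (\<sigma> s \<rho>))" for h
    by (simp add: linear_cmul[OF lin] linear_sum[OF lin] coord_part_eq_sum[OF inj_\<iota>])
  then show ?thesis
    using has_derivative_compose[OF \<sigma>_has_derivative assms] by (simp add: has_vector_derivative_def)
qed

definition radial_domain :: "real \<Rightarrow> (real \<times> (real^'n)) set" where
  "radial_domain d = {q. \<sigma> (fst q) (snd q) \<in> ball 0 d}"

lemma open_radial_domain: "open (radial_domain d)"
proof -
  have "radial_domain d = (\<lambda>q. \<sigma> (fst q) (snd q)) -` ball 0 d" by (auto simp: radial_domain_def)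
  then show ?thesis by (simp add: open_vimage continuous_on_\<sigma>)
qed

lemma radial_domain_contains: "{0..1} \<times> ball 0 d \<subseteq> radial_domain d"
  using \<sigma>_ball unfolding radial_domain_def by auto

lemma smooth_on_radial_pullback:
  assumes "smooth_on (ball 0 d) R"
  shows "smooth_on (radial_domain d) (\<lambda>q. R (\<sigma> (fst q) (snd q)))"
proof (rule smooth_on_compose[OF open_radial_domain open_ball _ assms])
  show "smooth_on (radial_domain d) (\<lambda>q. \<sigma> (fst q) (snd q))"
    unfolding smooth_on_def
    by (intro allI Ck_on_\<sigma> Ck_on_linear_map open_radial_domain bounded_linear_fst bounded_linear_snd)
qed (auto simp: radial_domain_def)

lemma radial_pullback_derivative:
  assumes "smooth_on (ball 0 d) R" "\<sigma> s \<rho> \<in> ball 0 d"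
  shows "((\<lambda>q. R (\<sigma> (fst q) (snd q))) has_derivative
    (\<lambda>v. frechet_derivative R (at (\<sigma> s \<rho>)) (\<sigma> s (snd v) + fst v *\<^sub>R coord_part \<iota> \<rho>))) (at (s, \<rho>))"
proof -
  have "((\<lambda>q. \<sigma> (fst q) (snd q)) has_derivative (\<lambda>v. \<sigma> s (snd v) + fst v *\<^sub>R coord_part \<iota> \<rho>)) (at (s, \<rho>))"
    unfolding \<sigma>_def
    by (auto intro!: derivative_eq_intros bounded_linear.has_derivative[OF bounded_linear_p])
  moreover have "(R has_derivative frechet_derivative R (at (\<sigma> s \<rho>))) (at ((\<lambda>q. \<sigma> (fst q) (snd q)) (s, \<rho>)))"
    using smooth_on_has_derivative[OF assms] by simp
  ultimately show ?thesis
    by (rule has_derivative_compose)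
qed

text \<open>
  The homotopy operator of the Poincare lemma along the leaves; the exponent is \<open>k = 0\<close> for 1-forms
  and \<open>k = 1\<close> for 2-forms.
\<close>

lemma radial_integral:
  fixes R :: "'k \<Rightarrow> real^'n \<Rightarrow> real" and k :: nat
  assumes R: "\<And>l. smooth_on (ball 0 d) (R l)"
  defines "\<tau> \<equiv> \<lambda>\<rho>. integral {0..1} (\<lambda>s. s ^ k * (\<Sum>l\<in>UNIV. \<rho> $ \<iota> l * R l (\<sigma> s \<rho>)))"
  shows "smooth_on (ball 0 d) \<tau>"
    and "\<And>\<rho>. \<rho> \<in> ball 0 d \<Longrightarrow> pd m \<tau> \<rho> =
      integral {0..1} (\<lambda>s. s ^ k * (R m (\<sigma> s \<rho>) + s * (\<Sum>l\<in>UNIV. \<rho> $ \<iota> l * pd m (R l) (\<sigma> s \<rho>))))"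
    and "\<And>\<rho>. \<rho> \<in> ball 0 d \<Longrightarrow>
      (\<lambda>s. s ^ k * (R m (\<sigma> s \<rho>) + s * (\<Sum>l\<in>UNIV. \<rho> $ \<iota> l * pd m (R l) (\<sigma> s \<rho>)))) integrable_on {0..1}"
proof -
  let ?G = "\<lambda>q. fst q ^ k * (\<Sum>l\<in>UNIV. snd q $ \<iota> l * R l (\<sigma> (fst q) (snd q)))"
  have O2: "open (radial_domain d)" by (rule open_radial_domain)
  have pw: "smooth_on (radial_domain d) (\<lambda>q. fst q ^ k)"
  proof (induction k)
    case (Suc k)
    then show ?case
      using smooth_on_mult[OF O2 smooth_on_linear_map[OF O2 bounded_linear_fst] Suc] by simp
  qed (simp add: smooth_on_const[OF O2])
  have cp: "smooth_on (radial_domain d) (\<lambda>q. snd q $ \<iota> l)" for l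
    by (intro smooth_on_vec_nth smooth_on_linear_map bounded_linear_snd O2)
  have G: "smooth_on (radial_domain d) ?G"
    by (intro smooth_on_mult pw smooth_on_sum cp smooth_on_radial_pullback R O2)
  have \<tau>: "\<tau> = (\<lambda>\<rho>. integral {0..1} (\<lambda>s. ?G (s, \<rho>)))" by (simp add: \<tau>_def)
  show "smooth_on (ball 0 d) \<tau>"
    unfolding \<tau> by (rule smooth_on_integral(1)[OF O2 G radial_domain_contains])
  fix \<rho> :: "real^'n" assume \<rho>: "\<rho> \<in> ball 0 d"
  have dG: "frechet_derivative ?G (at (s, \<rho>)) (0, e m) =
      s ^ k * (R m (\<sigma> s \<rho>) + s * (\<Sum>l\<in>UNIV. \<rho> $ \<iota> l * pd m (R l) (\<sigma> s \<rho>)))" if s: "s \<in> {0..1}" for s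
  proof -
    have s\<rho>: "\<sigma> s \<rho> \<in> ball 0 d" using \<sigma>_ball[OF s \<rho>] .
    have lin: "linear (frechet_derivative (R l) (at (\<sigma> s \<rho>)))" for l
      using smooth_on_has_derivative[OF R s\<rho>] has_derivative_linear by blast
    have 1: "((\<lambda>q. snd q $ \<iota> l * R l (\<sigma> (fst q) (snd q))) has_derivative
       (\<lambda>v. \<rho> $ \<iota> l * frechet_derivative (R l) (at (\<sigma> s \<rho>)) (\<sigma> s (snd v) + fst v *\<^sub>R coord_part \<iota> \<rho>)
          + snd v $ \<iota> l * R l (\<sigma> s \<rho>))) (at (s, \<rho>))" for l
    proof -
      have "((\<lambda>q::real \<times> (real^'n). snd q $ \<iota> l) has_derivative (\<lambda>v. snd v $ \<iota> l)) (at (s, \<rho>))"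
        by (intro bounded_linear.has_derivative[OF bounded_linear_vec_nth] has_derivative_snd has_derivative_ident)
      from has_derivative_mult[OF this radial_pullback_derivative[OF R s\<rho>]] show ?thesis by simp
    qed
    have 2: "((\<lambda>q::real \<times> (real^'n). fst q ^ k) has_derivative (\<lambda>v. of_nat k * fst v * s ^ (k - 1))) (at (s, \<rho>))"
      by (auto intro!: derivative_eq_intros)
    have 3: "((\<lambda>q. \<Sum>l\<in>UNIV. snd q $ \<iota> l * R l (\<sigma> (fst q) (snd q))) has_derivative
       (\<lambda>v. \<Sum>l\<in>UNIV. \<rho> $ \<iota> l * frechet_derivative (R l) (at (\<sigma> s \<rho>)) (\<sigma> s (snd v) + fst v *\<^sub>R coord_part \<iota> \<rho>)
          + snd v $ \<iota> l * R l (\<sigma> s \<rho>))) (at (s, \<rho>))"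
      by (rule has_derivative_sum[OF 1])
    have "frechet_derivative ?G (at (s, \<rho>)) (0, e m) =
        s ^ k * (\<Sum>l\<in>UNIV. \<rho> $ \<iota> l * frechet_derivative (R l) (at (\<sigma> s \<rho>)) (s *\<^sub>R e m) + e m $ \<iota> l * R l (\<sigma> s \<rho>))"
      using frechet_derivative_eqI[OF has_derivative_mult[OF 2 3]]
      by (simp add: \<sigma>_e)
    also have "\<dots> = s ^ k * ((\<Sum>l\<in>UNIV. s * (\<rho> $ \<iota> l * pd m (R l) (\<sigma> s \<rho>))) + (\<Sum>l\<in>UNIV. if l = m then R l (\<sigma> s \<rho>) else 0))"
      by (subst sum.distrib[symmetric], rule arg_cong2[where f="(*)", OF refl], rule sum.cong)
         (auto simp: e_component linear_cmul[OF lin])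
    finally show ?thesis by (simp add: sum_distrib_left algebra_simps)
  qed
  show "pd m \<tau> \<rho> = integral {0..1} (\<lambda>s. s ^ k * (R m (\<sigma> s \<rho>) + s * (\<Sum>l\<in>UNIV. \<rho> $ \<iota> l * pd m (R l) (\<sigma> s \<rho>))))"
    unfolding \<tau> using smooth_on_integral(2)[OF O2 G radial_domain_contains \<rho>, of "e m"] dG
    by (simp only: cong: integral_cong)
  have "continuous_on {0..1} (\<lambda>s. frechet_derivative ?G (at (s, \<rho>)) (0, e m))"
    by (rule continuous_on_compose2[OF smooth_on_continuous[OF smooth_on_frechet_derivative[OF G]], of _ "\<lambda>s. (s, \<rho>)", simplified])
       (use radial_domain_contains \<rho> in \<open>force intro!: continuous_intros\<close>)+
  then have "continuous_on {0..1} (\<lambda>s. s ^ k * (R m (\<sigma> s \<rho>) + s * (\<Sum>l\<in>UNIV. \<rho> $ \<iota> l * pd m (R l) (\<sigma> s \<rho>))))"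
    by (rule continuous_on_eq) (rule dG)
  then show "(\<lambda>s. s ^ k * (R m (\<sigma> s \<rho>) + s * (\<Sum>l\<in>UNIV. \<rho> $ \<iota> l * pd m (R l) (\<sigma> s \<rho>)))) integrable_on {0..1}"
    by (rule integrable_continuous_interval)
qed

lemma integral_radial_derivative:
  fixes f :: "real^'n \<Rightarrow> real"
  assumes f: "smooth_on (ball 0 d) f" and \<rho>: "\<rho> \<in> ball 0 d"
  shows "integral {0..1} (\<lambda>s. real (Suc k) * s ^ k * f (\<sigma> s \<rho>) + s ^ Suc k * (\<Sum>l\<in>UNIV. \<rho> $ \<iota> l * pd l f (\<sigma> s \<rho>))) = f \<rho>"
proof -
  have "((\<lambda>s. real (Suc k) * s ^ k * f (\<sigma> s \<rho>) + s ^ Suc k * (\<Sum>l\<in>UNIV. \<rho> $ \<iota> l * pd l f (\<sigma> s \<rho>)))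
      has_integral (1 ^ Suc k * f (\<sigma> 1 \<rho>) - 0 ^ Suc k * f (\<sigma> 0 \<rho>))) {0..1}"
  proof (rule fundamental_theorem_of_calculus)
    fix s :: real assume s: "s \<in> {0..1}"
    note df = radial_curve_derivative[OF smooth_on_has_derivative[OF f \<sigma>_ball[OF s \<rho>]],
        of "{0..1}", unfolded real_scaleR_def]
    have dp: "((\<lambda>s::real. s ^ Suc k) has_vector_derivative (real (Suc k) * s ^ k)) (at s within {0..1})"
      unfolding has_real_derivative_iff_has_vector_derivative[symmetric]
      by (auto intro!: derivative_eq_intros simp del: power_Suc)
    show "((\<lambda>s. s ^ Suc k * f (\<sigma> s \<rho>)) has_vector_derivative
        (real (Suc k) * s ^ k * f (\<sigma> s \<rho>) + s ^ Suc k * (\<Sum>l\<in>UNIV. \<rho> $ \<iota> l * pd l f (\<sigma> s \<rho>)))) (at s within {0..1})"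
      by (subst add.commute) (rule has_vector_derivative_mult[OF dp df])
  qed simp
  then show ?thesis by (simp add: integral_unique)
qed

text \<open>
  By closedness the integrand of the derivative of the homotopy operator becomes the total derivative
  of \<open>s R\<^sub>m (\<sigma> s \<rho>)\<close>.
\<close>

lemma leafwise_closed_1form_exact:
  fixes R :: "'k \<Rightarrow> real^'n \<Rightarrow> real"
  assumes R: "\<And>l. smooth_on (ball 0 d) (R l)"
    and closed: "\<And>l m \<rho>. \<rho> \<in> ball 0 d \<Longrightarrow> pd m (R l) \<rho> = pd l (R m) \<rho>"
  shows "\<exists>f. smooth_on (ball 0 d) f \<and> (\<forall>m. \<forall>\<rho>\<in>ball 0 d. pd m f \<rho> = R m \<rho>)"
proof (intro exI conjI allI ballI)
  let ?f = "\<lambda>\<rho>. integral {0..1} (\<lambda>s. s ^ 0 * (\<Sum>l\<in>UNIV. \<rho> $ \<iota> l * R l (\<sigma> s \<rho>)))"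
  show "smooth_on (ball 0 d) ?f" by (rule radial_integral(1)[OF R])
  fix m and \<rho> :: "real^'n" assume \<rho>: "\<rho> \<in> ball 0 d"
  have "pd m ?f \<rho> = integral {0..1} (\<lambda>s. s ^ 0 * (R m (\<sigma> s \<rho>) + s * (\<Sum>l\<in>UNIV. \<rho> $ \<iota> l * pd m (R l) (\<sigma> s \<rho>))))"
    by (rule radial_integral(2)[OF R \<rho>])
  also have "\<dots> = integral {0..1} (\<lambda>s. real (Suc 0) * s ^ 0 * R m (\<sigma> s \<rho>) + s ^ Suc 0 * (\<Sum>l\<in>UNIV. \<rho> $ \<iota> l * pd l (R m) (\<sigma> s \<rho>)))"
    by (rule integral_cong) (simp add: closed[OF \<sigma>_ball[OF _ \<rho>]])
  also have "\<dots> = R m \<rho>" by (rule integral_radial_derivative[OF R \<rho>])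
  finally show "pd m ?f \<rho> = R m \<rho>" .
qed

text \<open>
  As for 1-forms, the two integrals combine to the total derivative of \<open>s\<^sup>2 P\<^sub>l\<^sub>m (\<sigma> s \<rho>)\<close>.
\<close>

lemma leafwise_closed_2form_exact:
  fixes P :: "'k \<Rightarrow> 'k \<Rightarrow> real^'n \<Rightarrow> real"
  assumes P: "\<And>l m. smooth_on (ball 0 d) (P l m)"
    and anti: "\<And>l m \<rho>. \<rho> \<in> ball 0 d \<Longrightarrow> P l m \<rho> = - P m l \<rho>"
    and closed: "\<And>l m n \<rho>. \<rho> \<in> ball 0 d \<Longrightarrow> pd l (P m n) \<rho> + pd m (P n l) \<rho> + pd n (P l m) \<rho> = 0"
  shows "\<exists>\<tau>. (\<forall>m. smooth_on (ball 0 d) (\<tau> m)) \<and>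
    (\<forall>l m. \<forall>\<rho>\<in>ball 0 d. pd l (\<tau> m) \<rho> - pd m (\<tau> l) \<rho> = P l m \<rho>)"
proof (intro exI conjI allI ballI)
  let ?\<tau> = "\<lambda>m \<rho>. integral {0..1} (\<lambda>s. s ^ 1 * (\<Sum>l\<in>UNIV. \<rho> $ \<iota> l * P l m (\<sigma> s \<rho>)))"
  show "smooth_on (ball 0 d) (?\<tau> m)" for m by (rule radial_integral(1)[OF P])
  fix l m and \<rho> :: "real^'n" assume \<rho>: "\<rho> \<in> ball 0 d"
  let ?I = "\<lambda>l m s. s ^ 1 * (P l m (\<sigma> s \<rho>) + s * (\<Sum>n\<in>UNIV. \<rho> $ \<iota> n * pd l (P n m) (\<sigma> s \<rho>)))"
  have pdanti: "pd n (P l m) r = - pd n (P m l) r" if r: "r \<in> ball 0 d" for n l m r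
  proof -
    have "frechet_derivative (P l m) (at r) = frechet_derivative (\<lambda>r. - P m l r) (at r)"
      by (rule frechet_derivative_cong_open[OF open_ball r anti])
    also have "\<dots> = (\<lambda>v. - frechet_derivative (P m l) (at r) v)"
      by (rule frechet_derivative_eqI[OF has_derivative_minus[OF smooth_on_has_derivative[OF P r]]])
    finally show ?thesis by simp
  qed
  have "pd l (?\<tau> m) \<rho> - pd m (?\<tau> l) \<rho> = integral {0..1} (?I l m) - integral {0..1} (?I m l)"
    by (simp only: radial_integral(2)[OF P \<rho>])
  also have "\<dots> = integral {0..1} (\<lambda>s. ?I l m s - ?I m l s)"
    by (rule integral_diff[symmetric]; rule radial_integral(3)[OF P \<rho>])
  also have "\<dots> = integral {0..1} (\<lambda>s. real (Suc 1) * s ^ 1 * P l m (\<sigma> s \<rho>) + s ^ Suc 1 * (\<Sum>n\<in>UNIV. \<rho> $ \<iota> n * pd n (P l m) (\<sigma> s \<rho>)))"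
  proof (rule integral_cong)
    fix s :: real assume s: "s \<in> {0..1}"
    note r = \<sigma>_ball[OF s \<rho>]
    have "pd l (P n m) (\<sigma> s \<rho>) - pd m (P n l) (\<sigma> s \<rho>) = pd n (P l m) (\<sigma> s \<rho>)" for n
      using closed[OF r, of n l m] pdanti[OF r, of n m l] by linarith
    then have "(\<Sum>n\<in>UNIV. \<rho> $ \<iota> n * pd l (P n m) (\<sigma> s \<rho>)) - (\<Sum>n\<in>UNIV. \<rho> $ \<iota> n * pd m (P n l) (\<sigma> s \<rho>))
        = (\<Sum>n\<in>UNIV. \<rho> $ \<iota> n * pd n (P l m) (\<sigma> s \<rho>))"
      by (simp add: sum_subtractf[symmetric] right_diff_distrib[symmetric])
    moreover have "P m l (\<sigma> s \<rho>) = - P l m (\<sigma> s \<rho>)" by (rule anti[OF r])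
    ultimately show "?I l m s - ?I m l s = real (Suc 1) * s ^ 1 * P l m (\<sigma> s \<rho>) + s ^ Suc 1 * (\<Sum>n\<in>UNIV. \<rho> $ \<iota> n * pd n (P l m) (\<sigma> s \<rho>))"
      by (simp add: algebra_simps power2_eq_square)
  qed
  also have "\<dots> = P l m \<rho>" by (rule integral_radial_derivative[OF P \<rho>])
  finally show "pd l (?\<tau> m) \<rho> - pd m (?\<tau> l) \<rho> = P l m \<rho>" .
qed

end

section \<open>Rectification of commuting vector fields\<close>

text \<open>
  Supplies the transversal: \<open>L\<close> maps the coordinate directions outside \<open>range \<iota>\<close> to a complement of
  the span of the fields at the base point.
\<close>

lemma extend_frame:
  fixes y :: "'k::finite \<Rightarrow> real^'n::finite"
  assumes indep: "\<And>c l. (\<Sum>l\<in>UNIV. c l *\<^sub>R y l) = 0 \<Longrightarrow> c l = 0"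
  obtains \<iota> :: "'k \<Rightarrow> 'n" and L :: "real^'n \<Rightarrow> real^'n"
  where "inj \<iota>" "linear L" "inj L" "\<And>l. L (axis (\<iota> l) 1) = y l"
proof -
  have injy: "inj y"
  proof (rule injI, rule ccontr)
    fix l m assume eq: "y l = y m" and ne: "l \<noteq> m"
    have "(\<Sum>j\<in>UNIV. ((if j = l then 1 else 0) - (if j = m then 1 else 0)) *\<^sub>R y j)
        = (\<Sum>j\<in>UNIV. (if j = l then y j else 0) - (if j = m then y j else 0))"
      by (intro sum.cong) auto
    also have "\<dots> = y l - y m" by (simp add: sum_subtractf)
    finally have "(if l = l then 1 else 0) - (if l = m then 1 else (0::real)) = 0"
      using indep[of "\<lambda>j. (if j = l then 1 else 0) - (if j = m then 1 else 0)" l] eq by simp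
    then show False using ne by simp
  qed
  have "independent (range y)"
    unfolding independent_explicit
  proof (intro conjI allI impI ballI)
    fix c v assume 0: "(\<Sum>v\<in>range y. c v *\<^sub>R v) = 0" and "v \<in> range y"
    then obtain l where l: "v = y l" by blast
    have "(\<Sum>l\<in>UNIV. c (y l) *\<^sub>R y l) = 0"
      using 0 by (simp add: sum.reindex[OF injy])
    from indep[OF this] show "c v = 0" unfolding l .
  qed simp
  then obtain B where B: "range y \<subseteq> B" "independent B" "UNIV \<subseteq> span B"
    using maximal_independent_subset_extend[of "range y" UNIV] by auto
  have finB: "finite B" using B(2) independent_imp_finite by blast
  have cB: "card B = CARD('n)"
    using basis_card_eq_dim[of B UNIV] B by simp
  have cy: "card (range y) = CARD('k)" using card_image[OF injy] by simp
  have "CARD('k) \<le> CARD('n)" using card_mono[OF finB B(1)] cB cy by simp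
  then obtain \<iota> :: "'k \<Rightarrow> 'n" where \<iota>: "inj \<iota>"
    using card_le_inj[of "UNIV::'k set" "UNIV::'n set"] by auto
  have "card (UNIV - range \<iota>) = card (B - range y)"
    using card_image[OF \<iota>] cB cy B(1) finB by (simp add: card_Diff_subset)
  then obtain g where g: "bij_betw g (UNIV - range \<iota>) (B - range y)"
    using finite_same_card_bij[of "UNIV - range \<iota>" "B - range y"] finB by auto
  define h where "h j = (if j \<in> range \<iota> then y (inv \<iota> j) else g j)" for j
  have h\<iota>: "h (\<iota> l) = y l" for l using \<iota> by (simp add: h_def)
  have hg: "h j = g j" if "j \<in> UNIV - range \<iota>" for j using that by (simp add: h_def)
  have "bij_betw h (range \<iota>) (range y)"
    unfolding bij_betw_def
  proof
    show "inj_on h (range \<iota>)"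
      by (rule inj_onI) (use injy in \<open>auto simp: h\<iota> inj_eq\<close>)
    show "h ` range \<iota> = range y" by (auto simp: h\<iota> image_image)
  qed
  moreover have "bij_betw h (UNIV - range \<iota>) (B - range y)"
    using g bij_betw_cong[of "UNIV - range \<iota>" h g, OF hg] by blast
  ultimately have "bij_betw h (range \<iota> \<union> (UNIV - range \<iota>)) (range y \<union> (B - range y))"
    by (rule bij_betw_combine) auto
  then have bij: "bij_betw h UNIV B" using B(1) by (simp add: Un_absorb1 Un_Diff_cancel)
  define L where "L v = (\<Sum>j\<in>UNIV. v $ j *\<^sub>R h j)" for v
  have lin: "linear L"
    unfolding L_def by (rule linearI) (simp_all add: scaleR_left_distrib sum.distrib scaleR_sum_right)
  moreover have "inj L"
  proof (subst linear_injective_0[OF lin], intro allI impI)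
    fix v assume "L v = 0"
    then have 0: "(\<Sum>b\<in>B. v $ inv h b *\<^sub>R b) = 0"
      unfolding L_def using sum.reindex_bij_betw[OF bij, of "\<lambda>b. v $ inv h b *\<^sub>R b"] bij
      by (simp add: bij_betw_def)
    have "\<forall>b\<in>B. v $ inv h b = 0"
      using B(2) 0 unfolding independent_explicit by (elim conjE) (erule allE, erule (1) mp)
    then have "v $ j = 0" for j using bij by (metis bij_betw_def inv_f_f rangeI)
    then show "v = 0" by (simp add: vec_eq_iff)
  qed
  moreover have "L (axis (\<iota> l) 1) = y l" for l
  proof -
    have "L (axis (\<iota> l) 1) = (\<Sum>j\<in>UNIV. if j = \<iota> l then h j else 0)"
      unfolding L_def by (intro sum.cong) (auto simp: axis_def)
    then show ?thesis by (simp add: h\<iota>)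
  qed
  ultimately show thesis using that \<iota> by blast
qed

lemma continuous_on_frechet_apply:
  fixes f :: "'a::euclidean_space \<Rightarrow> 'b::real_normed_vector"
  assumes f: "smooth_on S f" and g: "continuous_on X g" "g ` X \<subseteq> S" and w: "continuous_on X w"
  shows "continuous_on X (\<lambda>t. frechet_derivative f (at (g t)) (w t))"
proof -
  obtain f' where f': "\<And>x. x \<in> S \<Longrightarrow> (f has_derivative blinfun_apply (f' x)) (at x)" and c: "continuous_on S f'"
    using Ck_on_1_blinfun[OF smooth_onD[OF f]] by blast
  have "continuous_on X (\<lambda>t. blinfun_apply (f' (g t)) (w t))"
    by (intro bounded_bilinear.continuous_on[OF bounded_bilinear_blinfun_apply] w
        continuous_on_compose2[OF c g(1)] g(2))
  then show ?thesis
    by (rule continuous_on_eq) (use f' g(2) frechet_derivative_eqI in \<open>metis image_subset_iff\<close>)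
qed

context leaf_coords
begin

text \<open>
  The right-hand side of the equation for the inverse chart: along the ray to \<open>\<rho>\<close> one follows the
  field \<open>\<Sum>\<^sub>l \<rho>\<^sub>l Y\<^sub>l\<close> for unit time.
\<close>

definition frame_field :: "('k \<Rightarrow> real^'n \<Rightarrow> real^'n) \<Rightarrow> real \<times> (real^'n) \<times> (real^'n) \<Rightarrow> real^'n" where
  "frame_field Y q = (\<Sum>l\<in>UNIV. fst (snd q) $ \<iota> l *\<^sub>R Y l (snd (snd q)))"

lemma frame_field_smooth:
  assumes "open N" "\<And>l. smooth_on N (Y l)"
  shows "smooth_on (UNIV \<times> UNIV \<times> N) (frame_field Y)"
proof -
  have o: "open (UNIV \<times> UNIV \<times> N :: (real \<times> (real^'n) \<times> (real^'n)) set)"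
    using assms(1) by (intro open_Times open_UNIV)
  have a: "smooth_on (UNIV \<times> UNIV \<times> N) (\<lambda>q::real \<times> (real^'n) \<times> (real^'n). fst (snd q) $ \<iota> l)" for l
    by (intro smooth_on_vec_nth o smooth_on_linear_map bounded_linear_compose[OF bounded_linear_fst] bounded_linear_snd)
  have b: "smooth_on (UNIV \<times> UNIV \<times> N) (\<lambda>q::real \<times> (real^'n) \<times> (real^'n). Y l (snd (snd q)))" for l
    by (rule smooth_on_compose[OF o assms(1) smooth_on_linear_map[OF o] assms(2)])
       (auto intro!: bounded_linear_compose[OF bounded_linear_snd] bounded_linear_snd)
  show ?thesis unfolding frame_field_def by (intro smooth_on_sum smooth_on_scaleR o a b)
qed

lemma frame_field_derivative:
  assumes "\<And>l. smooth_on N (Y l)" "z \<in> N"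
  shows "(frame_field Y has_derivative
    (\<lambda>v. \<Sum>l\<in>UNIV. \<rho> $ \<iota> l *\<^sub>R frechet_derivative (Y l) (at z) (snd (snd v)) + fst (snd v) $ \<iota> l *\<^sub>R Y l z))
    (at (s, \<rho>, z))"
  unfolding frame_field_def
proof (rule has_derivative_sum)
  fix l
  have 1: "((\<lambda>q::real \<times> (real^'n) \<times> (real^'n). fst (snd q) $ \<iota> l) has_derivative (\<lambda>v. fst (snd v) $ \<iota> l)) (at (s, \<rho>, z))"
    by (intro bounded_linear.has_derivative[OF bounded_linear_vec_nth] has_derivative_fst has_derivative_snd has_derivative_ident)
  have "((\<lambda>q::real \<times> (real^'n) \<times> (real^'n). snd (snd q)) has_derivative (\<lambda>v. snd (snd v))) (at (s, \<rho>, z))"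
    by (intro has_derivative_snd has_derivative_ident)
  from has_derivative_compose[OF this, of "Y l" "frechet_derivative (Y l) (at z)"] smooth_on_has_derivative[OF assms]
  have 2: "((\<lambda>q::real \<times> (real^'n) \<times> (real^'n). Y l (snd (snd q))) has_derivative
      (\<lambda>v. frechet_derivative (Y l) (at z) (snd (snd v)))) (at (s, \<rho>, z))" by simp
  from has_derivative_scaleR[OF 1 2]
  show "((\<lambda>q::real \<times> (real^'n) \<times> (real^'n). fst (snd q) $ \<iota> l *\<^sub>R Y l (snd (snd q))) has_derivative
      (\<lambda>v. \<rho> $ \<iota> l *\<^sub>R frechet_derivative (Y l) (at z) (snd (snd v)) + fst (snd v) $ \<iota> l *\<^sub>R Y l z)) (at (s, \<rho>, z))"
    by simp
qed

lemma bounded_linear_perp: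
  fixes L :: "real^'n \<Rightarrow> real^'n"
  assumes "linear L"
  shows "bounded_linear (\<lambda>\<rho>. L (\<rho> - coord_part \<iota> \<rho>))"
proof -
  have "bounded_linear L" using assms linear_conv_bounded_linear by blast
  from bounded_linear_compose[OF this bounded_linear_sub[OF bounded_linear_ident bounded_linear_p]]
  show ?thesis .
qed

text \<open>
  The radius \<open>d\<close> is chosen so small that the iteration stays near \<open>r0\<close>, where the fields are bounded
  and Lipschitz, and that the factor \<open>\<rho>\<^sub>l\<close> makes the right-hand side a contraction.
\<close>

lemma frame_flow_exists:
  assumes N: "open N" "r0 \<in> N" and Y: "\<And>l. smooth_on N (Y l)" and L: "linear L"
  shows "\<exists>d>0. \<exists>\<Omega> x. \<Omega> \<subseteq> N \<and>
    solves d (UNIV \<times> UNIV \<times> N) \<Omega> (frame_field Y) (\<lambda>\<rho>. r0 + L (\<rho> - coord_part \<iota> \<rho>)) x"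
proof -
  obtain R' where R': "R' > 0" "cball r0 R' \<subseteq> N" using N open_contains_cball by blast
  define R where "R = R' / 2"
  have R: "R > 0" "cball r0 (2 * R) \<subseteq> N" using R' by (auto simp: R_def)
  let ?Q = "cball r0 (2 * R)"
  have "\<exists>M C. 0 \<le> M \<and> 0 \<le> C \<and> (\<forall>z\<in>?Q. norm (Y l z) \<le> M) \<and>
      (\<forall>z\<in>?Q. \<forall>z'\<in>?Q. norm (Y l z' - Y l z) \<le> C * norm (z' - z))" for l
  proof -
    obtain Y' where Y': "\<And>z. z \<in> N \<Longrightarrow> (Y l has_derivative blinfun_apply (Y' z)) (at z)" and c: "continuous_on N Y'"
      using Ck_on_1_blinfun[OF smooth_onD[OF Y]] by metis
    have "\<exists>C\<ge>0. \<forall>z\<in>?Q. \<forall>z'\<in>?Q. norm (Y l z' - Y l z) \<le> C * norm (z' - z)"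
      by (rule C1_compact_Lipschitz[OF has_derivative_at_withinI[OF Y'] continuous_on_subset[OF c R(2)]])
         (use R(2) in auto)
    moreover have "bounded (Y l ` ?Q)"
      by (rule compact_imp_bounded[OF compact_continuous_image[OF continuous_on_subset[OF smooth_on_continuous[OF Y] R(2)] compact_cball]])
    then obtain M where "\<forall>z\<in>?Q. norm (Y l z) \<le> M" unfolding bounded_iff by blast
    moreover then have "0 \<le> M" using R norm_ge_zero[of "Y l r0"] by (meson centre_in_cball mult_nonneg_nonneg order_trans less_imp_le zero_le_numeral)
    ultimately show ?thesis by blast
  qed
  then obtain M C where M: "\<And>l. 0 \<le> M l" "\<And>l z. z \<in> ?Q \<Longrightarrow> norm (Y l z) \<le> M l"
    and C: "\<And>l. 0 \<le> C l" "\<And>l z z'. z \<in> ?Q \<Longrightarrow> z' \<in> ?Q \<Longrightarrow> norm (Y l z' - Y l z) \<le> C l * norm (z' - z)"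
    by metis
  define K where "K = sum M UNIV" define Lp where "Lp = sum C UNIV"
  have K: "K \<ge> 0" "Lp \<ge> 0" unfolding K_def Lp_def using M(1) C(1) by (simp_all add: sum_nonneg)
  obtain KL where KL: "KL > 0" "\<And>v. norm (L v) \<le> KL * norm v" using linear_bounded_pos[OF L] by blast
  \<comment> \<open>the first bound makes the right-hand side a contraction, the second keeps the iterates in \<open>cball r0 R\<close>\<close>
  define d where "d = min (1 / (2 * (Lp + 1))) (R / (KL + K + 1))"
  have d: "d > 0" using K KL R by (simp add: d_def)
  have d1: "d * Lp \<le> 1 / 2"
  proof -
    have "d * Lp \<le> 1 / (2 * (Lp + 1)) * Lp" using K by (intro mult_right_mono) (auto simp: d_def)
    also have "\<dots> \<le> 1 / 2" using K by (simp add: field_simps)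
    finally show ?thesis .
  qed
  have d2: "KL * d + K * d \<le> R"
  proof -
    have "KL * d + K * d = (KL + K) * d" by (simp add: algebra_simps)
    also have "\<dots> \<le> (KL + K) * (R / (KL + K + 1))" using K KL by (intro mult_left_mono) (auto simp: d_def)
    also have "\<dots> \<le> R" using K KL R by (simp add: field_simps)
    finally show ?thesis .
  qed
  have comp: "\<bar>\<rho> $ j\<bar> \<le> norm \<rho>" for \<rho> :: "real^'n" and j by (rule component_le_norm_cart)
  have Fb: "norm (frame_field Y (s, \<rho>, z)) \<le> K * d" if "norm \<rho> \<le> d" "z \<in> ?Q" for s \<rho> z
  proof -
    have "norm (frame_field Y (s, \<rho>, z)) \<le> (\<Sum>l\<in>UNIV. d * M l)"
      unfolding frame_field_def
    proof (rule sum_norm_le)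
      fix l
      show "norm (fst (snd (s, \<rho>, z)) $ \<iota> l *\<^sub>R Y l (snd (snd (s, \<rho>, z)))) \<le> d * M l"
        unfolding norm_scaleR fst_conv snd_conv
        by (rule mult_mono[OF _ M(2)[OF that(2)]]) (use comp[of \<rho> "\<iota> l"] that d in auto)
    qed
    then show ?thesis by (simp add: K_def sum_distrib_left mult.commute)
  qed
  have Fl: "norm (frame_field Y (s, \<rho>, z) - frame_field Y (s, \<rho>, z')) \<le> norm (z - z') / 2"
    if "norm \<rho> \<le> d" "z \<in> ?Q" "z' \<in> ?Q" for s \<rho> z z'
  proof -
    have "frame_field Y (s, \<rho>, z) - frame_field Y (s, \<rho>, z') = (\<Sum>l\<in>UNIV. \<rho> $ \<iota> l *\<^sub>R (Y l z - Y l z'))"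
      by (simp add: frame_field_def sum_subtractf scaleR_diff_right)
    also have "norm \<dots> \<le> (\<Sum>l\<in>UNIV. d * (C l * norm (z - z')))"
    proof (rule sum_norm_le)
      fix l
      show "norm (\<rho> $ \<iota> l *\<^sub>R (Y l z - Y l z')) \<le> d * (C l * norm (z - z'))"
        unfolding norm_scaleR
        by (rule mult_mono[OF _ C(2)[OF that(3,2)]]) (use comp[of \<rho> "\<iota> l"] that d in auto)
    qed
    also have "\<dots> = (d * Lp) * norm (z - z')" by (simp add: Lp_def sum_distrib_left sum_distrib_right mult.assoc)
    also have "\<dots> \<le> 1 / 2 * norm (z - z')" by (rule mult_right_mono[OF d1]) simp
    finally show ?thesis by simp
  qed
  let ?b = "\<lambda>\<rho>. r0 + L (\<rho> - coord_part \<iota> \<rho>)"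
  have bb: "norm (?b \<rho> - r0) \<le> KL * d" if "norm \<rho> \<le> d" for \<rho>
  proof -
    have "norm (L (\<rho> - coord_part \<iota> \<rho>)) \<le> KL * norm (\<sigma> 0 \<rho>)" using KL(2) by (simp add: \<sigma>_def)
    also have "\<dots> \<le> KL * d" using KL(1) norm_\<sigma>[of 0 \<rho>] that by (intro mult_left_mono) auto
    finally show ?thesis by simp
  qed
  have bc: "continuous_on X ?b" for X
    by (intro continuous_on_add continuous_on_const linear_continuous_on bounded_linear_perp[OF L])
  have RQ: "cball r0 R \<subseteq> ?Q" using R by auto
  have Kc: "continuous_on ({0..1} \<times> cball 0 d \<times> cball r0 R) (\<lambda>(s, \<rho>, z). frame_field Y (s, \<rho>, z))"
    unfolding split_beta prod.collapse
    by (rule continuous_on_subset[OF smooth_on_continuous[OF frame_field_smooth[OF N(1) Y]]]) (use RQ R in auto)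
  have "\<exists>x. continuous_on (cball (0::real^'n) d) x \<and> x ` cball 0 d \<subseteq> cball r0 R \<and>
    (\<forall>\<rho>\<in>cball 0 d. x \<rho> = ?b \<rho> + integral {0..1} (\<lambda>s. frame_field Y (s, \<rho>, x (\<sigma> s \<rho>))))"
  proof (rule integral_eq_solution_exists[OF compact_cball \<sigma>_cball _ Kc _ closed_cball _ bc])
    show "continuous_on ({0..1} \<times> cball 0 d) (\<lambda>(s, \<rho>). \<sigma> s \<rho>)"
      using continuous_on_\<sigma> by (simp add: split_beta)
    show "r0 \<in> cball r0 R" using R by simp
    show "norm (frame_field Y (s, \<rho>, z) - frame_field Y (s, \<rho>, z')) \<le> norm (z - z') / 2"
      if "s \<in> {0..1}" "\<rho> \<in> cball 0 d" "z \<in> cball r0 R" "z' \<in> cball r0 R" for s \<rho> z z'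
      by (rule Fl) (use that RQ in auto)
    fix x :: "real^'n \<Rightarrow> real^'n" and \<rho> :: "real^'n"
    assume x: "continuous_on (cball 0 d) x" "x ` cball 0 d \<subseteq> cball r0 R" and \<rho>: "\<rho> \<in> cball 0 d"
    have xs: "x (\<sigma> s \<rho>) \<in> cball r0 R" if "s \<in> {0..1}" for s
      using x(2) \<sigma>_cball[OF that \<rho>] by blast
    have "norm (integral {0..1} (\<lambda>s. frame_field Y (s, \<rho>, x (\<sigma> s \<rho>)))) \<le> K * d"
    proof (rule norm_integral_unit_interval_le)
      have "continuous_on {0..1} (\<lambda>s. (\<lambda>(s, \<rho>, z). frame_field Y (s, \<rho>, z)) (s, \<rho>, x (\<sigma> s \<rho>)))"
        by (rule continuous_on_compose2[OF Kc])
           (use xs \<rho> \<sigma>_cball in \<open>auto intro!: continuous_intros continuous_on_compose2[OF x(1)]\<close>)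
      then show "(\<lambda>s. frame_field Y (s, \<rho>, x (\<sigma> s \<rho>))) integrable_on {0..1}"
        by (auto intro: integrable_continuous_interval)
      show "norm (frame_field Y (s, \<rho>, x (\<sigma> s \<rho>))) \<le> K * d" if "s \<in> {0..1}" for s
        by (rule Fb) (use \<rho> xs[OF that] RQ in auto)
    qed
    then have "norm ((?b \<rho> - r0) + integral {0..1} (\<lambda>s. frame_field Y (s, \<rho>, x (\<sigma> s \<rho>)))) \<le> KL * d + K * d"
      using bb[of \<rho>] \<rho> by (intro norm_triangle_mono) auto
    also have "\<dots> \<le> R" by (rule d2)
    finally show "?b \<rho> + integral {0..1} (\<lambda>s. frame_field Y (s, \<rho>, x (\<sigma> s \<rho>))) \<in> cball r0 R"
      unfolding mem_cball dist_norm by (subst norm_minus_commute) (simp add: algebra_simps)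
  qed
  then obtain x where x: "continuous_on (cball 0 d) x" "x ` cball 0 d \<subseteq> cball r0 R"
    "\<And>\<rho>. \<rho> \<in> cball 0 d \<Longrightarrow> x \<rho> = ?b \<rho> + integral {0..1} (\<lambda>s. frame_field Y (s, \<rho>, x (\<sigma> s \<rho>)))" by blast
  have \<Omega>: "cball r0 R \<subseteq> ball r0 (2 * R)" "ball r0 (2 * R) \<subseteq> ?Q" using R by auto
  have "solves d (UNIV \<times> UNIV \<times> N) (ball r0 (2 * R)) (frame_field Y) ?b x"
    unfolding solves_def
  proof (intro conjI ballI)
    show "open (UNIV \<times> UNIV \<times> N :: (real \<times> (real^'n) \<times> (real^'n)) set)" using N(1) by (intro open_Times open_UNIV)
    show "{0..1} \<times> ball 0 d \<times> ball r0 (2 * R) \<subseteq> UNIV \<times> UNIV \<times> N" using \<Omega> R(2) by auto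
    show "continuous_on (ball 0 d) x" using continuous_on_subset[OF x(1) ball_subset_cball] .
    show "x ` ball 0 d \<subseteq> ball r0 (2 * R)" using x(2) \<Omega>(1) ball_subset_cball by blast
    show "norm (frame_field Y (s, \<rho>, z) - frame_field Y (s, \<rho>, z')) \<le> norm (z - z') / 2"
      if "s \<in> {0..1}" "\<rho> \<in> ball 0 d" "z \<in> ball r0 (2 * R)" "z' \<in> ball r0 (2 * R)" for s \<rho> z z'
      by (rule Fl) (use that \<Omega> in auto)
  qed (use x(3) in auto)
  moreover have "ball r0 (2 * R) \<subseteq> N" using \<Omega>(2) R(2) by blast
  ultimately show ?thesis using d by blast
qed

text \<open>
  The partial derivative \<open>\<partial>x/\<partial>\<rho>\<^sub>l\<close> and the function \<open>Y\<^sub>l \<circ> x\<close> solve the same linear equation along rays.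
  For the former this is the linearised equation; for the latter it is the integral of the total
  derivative of \<open>s Y\<^sub>l (x (\<sigma> s \<rho>))\<close>, after exchange of \<open>Y\<^sub>l\<close> and \<open>Y\<^sub>m\<close> by commutativity. The equation is a
  contraction, so the two coincide.
\<close>

lemma frame_flow_derivative:
  assumes N: "open N" and Y: "\<And>l. smooth_on N (Y l)" and L: "linear L" and "\<Omega> \<subseteq> N"
    and comm: "\<And>l m r. r \<in> N \<Longrightarrow> frechet_derivative (Y l) (at r) (Y m r) = frechet_derivative (Y m) (at r) (Y l r)"
    and sol: "solves d (UNIV \<times> UNIV \<times> N) \<Omega> (frame_field Y) (\<lambda>\<rho>. r0 + L (\<rho> - coord_part \<iota> \<rho>)) x"
  shows "smooth_on (ball 0 d) x"
    and "\<And>\<rho> l. \<rho> \<in> ball 0 d \<Longrightarrow> pd l x \<rho> = Y l (x \<rho>)"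
    and "d > 0 \<Longrightarrow> x 0 = r0"
    and "d > 0 \<Longrightarrow> frechet_derivative x (at 0) v = (\<Sum>l\<in>UNIV. v $ \<iota> l *\<^sub>R Y l r0) + L (v - coord_part \<iota> v)"
proof -
  let ?V = "ball (0::real^'n) d"
  let ?b = "\<lambda>\<rho>. r0 + L (\<rho> - coord_part \<iota> \<rho>)"
  note bl = bounded_linear_perp[OF L]
  have bs: "smooth_on ?V ?b"
    by (intro smooth_on_add smooth_on_const smooth_on_linear_map bl open_ball)
  have bd: "frechet_derivative ?b (at \<rho>) v = L (v - coord_part \<iota> v)" for \<rho> v
  proof -
    have "(?b has_derivative (\<lambda>v. L (v - coord_part \<iota> v))) (at \<rho>)"
      using has_derivative_add[OF has_derivative_const[of r0] bounded_linear_imp_has_derivative[OF bl]] by simp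
    then show ?thesis using frechet_derivative_eqI by metis
  qed
  note Fs = frame_field_smooth[OF N Y]
  show xs: "smooth_on ?V x" by (rule solves_smooth[OF sol Fs bs])
  have xc: "continuous_on ?V x" and xN: "\<And>\<rho>. \<rho> \<in> ?V \<Longrightarrow> x \<rho> \<in> N"
    and xeq: "\<And>\<rho>. \<rho> \<in> ?V \<Longrightarrow> x \<rho> = ?b \<rho> + integral {0..1} (\<lambda>s. frame_field Y (s, \<rho>, x (\<sigma> s \<rho>)))"
    using sol \<open>\<Omega> \<subseteq> N\<close> unfolding solves_def by blast+
  have fdF: "frechet_derivative (frame_field Y) (at (s, \<rho>, z)) (0, v, y) =
      (\<Sum>l\<in>UNIV. \<rho> $ \<iota> l *\<^sub>R frechet_derivative (Y l) (at z) y + v $ \<iota> l *\<^sub>R Y l z)" if "z \<in> N" for s \<rho> z v y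
    using frechet_derivative_eqI[OF frame_field_derivative[OF Y that]] by simp
  have dx: "frechet_derivative x (at \<rho>) v = L (v - coord_part \<iota> v) +
      integral {0..1} (\<lambda>s. \<Sum>l\<in>UNIV. \<rho> $ \<iota> l *\<^sub>R frechet_derivative (Y l) (at (x (\<sigma> s \<rho>))) (frechet_derivative x (at (\<sigma> s \<rho>)) (\<sigma> s v))
        + v $ \<iota> l *\<^sub>R Y l (x (\<sigma> s \<rho>)))" if \<rho>: "\<rho> \<in> ?V" for \<rho> v
  proof -
    have "frechet_derivative x (at \<rho>) v = frechet_derivative ?b (at \<rho>) v +
      integral {0..1} (\<lambda>s. frechet_derivative (frame_field Y) (at (s, \<rho>, x (\<sigma> s \<rho>)))
          (0, v, frechet_derivative x (at (\<sigma> s \<rho>)) (\<sigma> s v)))"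
      by (rule solves_derivative(3)[OF sol smooth_onD[OF Fs] smooth_onD[OF bs] \<rho>])
    also have "integral {0..1} (\<lambda>s. frechet_derivative (frame_field Y) (at (s, \<rho>, x (\<sigma> s \<rho>)))
          (0, v, frechet_derivative x (at (\<sigma> s \<rho>)) (\<sigma> s v))) =
        integral {0..1} (\<lambda>s. \<Sum>l\<in>UNIV. \<rho> $ \<iota> l *\<^sub>R frechet_derivative (Y l) (at (x (\<sigma> s \<rho>))) (frechet_derivative x (at (\<sigma> s \<rho>)) (\<sigma> s v))
        + v $ \<iota> l *\<^sub>R Y l (x (\<sigma> s \<rho>)))"
      by (rule integral_cong) (rule fdF[OF xN[OF \<sigma>_ball[OF _ \<rho>]]])
    finally show ?thesis by (simp only: bd)
  qed
  \<comment> \<open>along rays the solution is an integral curve: the equation at \<open>\<sigma> t \<rho>\<close> is the one at \<open>\<rho>\<close> integrated up to \<open>t\<close>\<close>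
  have ray: "((\<lambda>t. x (\<sigma> t \<rho>)) has_vector_derivative frame_field Y (0, \<rho>, x (\<sigma> t \<rho>))) (at t within {0..1})"
    if \<rho>: "\<rho> \<in> ?V" and t: "t \<in> {0..1}" for \<rho> t
  proof -
    define h where "h t = frame_field Y (0, \<rho>, x (\<sigma> t \<rho>))" for t
    have hc: "continuous_on {0..1} h"
      unfolding h_def
      by (rule continuous_on_compose2[OF smooth_on_continuous[OF Fs]])
         (use xN \<sigma>_ball \<rho> in \<open>auto intro!: continuous_intros continuous_on_compose2[OF xc]\<close>)
    define H where "H t = integral {0..t} h" for t
    have Hd: "(H has_vector_derivative h t) (at t within {0..1})" if "t \<in> {0..1}" for t
      unfolding H_def by (rule integral_has_vector_derivative[OF hc that])
    have X: "x (\<sigma> t \<rho>) = ?b \<rho> + H t" if t: "t \<in> {0..1}" for t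
    proof -
      have ff: "frame_field Y (s, \<sigma> t \<rho>, x (\<sigma> s (\<sigma> t \<rho>))) = t *\<^sub>R h (t * s)" for s
        by (simp add: h_def frame_field_def \<sigma>_component \<sigma>_\<sigma> scaleR_sum_right mult.commute)
      have p\<sigma>: "\<sigma> t \<rho> - coord_part \<iota> (\<sigma> t \<rho>) = \<rho> - coord_part \<iota> \<rho>"
        by (simp add: vec_eq_iff \<sigma>_def coord_part_def)
      have "((\<lambda>s. t *\<^sub>R h (t * s)) has_integral (H (t * 1) - H (t * 0))) {0..1}"
      proof (rule fundamental_theorem_of_calculus)
        fix s :: real assume s: "s \<in> {0..1}"
        have ts: "t * s \<in> {0..1}" using s t by (auto intro: mult_le_one)
        have sub: "(*) t ` {0..1} \<subseteq> {0..1}" using t by (auto intro: mult_le_one)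
        have "((*) t has_vector_derivative t) (at s within {0..1})"
          unfolding has_real_derivative_iff_has_vector_derivative[symmetric]
          by (auto intro!: derivative_eq_intros)
        from vector_diff_chain_within[OF this has_vector_derivative_within_subset[OF Hd[OF ts] sub]]
        show "((\<lambda>s. H (t * s)) has_vector_derivative t *\<^sub>R h (t * s)) (at s within {0..1})"
          by (simp add: o_def)
      qed simp
      from integral_unique[OF this] have "integral {0..1} (\<lambda>s. t *\<^sub>R h (t * s)) = H t"
        by (simp add: H_def)
      then show ?thesis using xeq[OF \<sigma>_ball[OF t \<rho>]] by (simp only: ff p\<sigma>)
    qed
    have "((\<lambda>t. ?b \<rho> + H t) has_vector_derivative h t) (at t within {0..1})"
      using has_vector_derivative_add[OF has_vector_derivative_const Hd[OF t]] by simp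
    then have "((\<lambda>t. x (\<sigma> t \<rho>)) has_vector_derivative h t) (at t within {0..1})"
      by (rule has_vector_derivative_transform[OF t X, rotated])
    then show ?thesis by (simp add: h_def)
  qed
  show pdx: "pd l x \<rho> = Y l (x \<rho>)" if \<rho>0: "\<rho> \<in> ?V" for \<rho> l
  proof -
    define E where "E \<rho> = norm (pd l x \<rho> - Y l (x \<rho>))" for \<rho>
    let ?D = "cball (0::real^'n) (norm \<rho>)"
    have DV: "?D \<subseteq> ?V" using \<rho>0 by auto
    have "continuous_on ?V E" unfolding E_def
      by (intro continuous_intros smooth_on_continuous[OF smooth_on_frechet_derivative[OF xs]]
          continuous_on_compose2[OF smooth_on_continuous[OF Y] xc]) (use xN in auto)
    then have "bounded (E ` ?D)"
      by (intro compact_imp_bounded compact_continuous_image continuous_on_subset[OF _ DV] compact_cball)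
    then obtain bnd where bnd: "\<And>\<rho>. \<rho> \<in> ?D \<Longrightarrow> norm (E \<rho>) \<le> bnd" unfolding bounded_iff by blast
    have "E \<rho> \<le> 2 * 0"
    proof (rule halving_bound[where D="?D" and bnd=bnd])
      show "E \<rho> \<le> bnd" if "\<rho> \<in> ?D" for \<rho> using bnd[OF that] by simp
      show "\<rho> \<in> ?D" by simp
      fix M u assume M: "\<And>u. u \<in> ?D \<Longrightarrow> E u \<le> M" and u: "u \<in> ?D"
      have uV: "u \<in> ?V" using u DV by blast
      let ?X = "\<lambda>s. x (\<sigma> s u)"
      have XN: "?X s \<in> N" if "s \<in> {0..1}" for s using xN[OF \<sigma>_ball[OF that uV]] .
      have Xc: "continuous_on {0..1} ?X"
        by (rule continuous_on_compose2[OF xc]) (use \<sigma>_ball uV in \<open>auto intro!: continuous_intros\<close>)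
      have linY: "linear (frechet_derivative (Y m) (at (?X s)))" if "s \<in> {0..1}" for m s
        using smooth_on_has_derivative[OF Y XN[OF that]] has_derivative_linear by blast
      have linx: "linear (frechet_derivative x (at (\<sigma> s u)))" if "s \<in> {0..1}" for s
        using smooth_on_has_derivative[OF xs \<sigma>_ball[OF that uV]] has_derivative_linear by blast
      let ?I1 = "\<lambda>s. Y l (?X s) + s *\<^sub>R (\<Sum>m\<in>UNIV. u $ \<iota> m *\<^sub>R frechet_derivative (Y m) (at (?X s)) (pd l x (\<sigma> s u)))"
      let ?I2 = "\<lambda>s. Y l (?X s) + s *\<^sub>R (\<Sum>m\<in>UNIV. u $ \<iota> m *\<^sub>R frechet_derivative (Y m) (at (?X s)) (Y l (?X s)))"
      have 1: "pd l x u = integral {0..1} ?I1"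
      proof -
        have "L (e l - coord_part \<iota> (e l)) = 0" using linear_0[OF L] by (simp add: coord_part_axis)
        then have "pd l x u = integral {0..1} (\<lambda>s. \<Sum>m\<in>UNIV. u $ \<iota> m *\<^sub>R frechet_derivative (Y m) (at (?X s)) (frechet_derivative x (at (\<sigma> s u)) (\<sigma> s (e l)))
            + e l $ \<iota> m *\<^sub>R Y m (?X s))" using dx[OF uV, of "e l"] by simp
        also have "\<dots> = integral {0..1} ?I1"
        proof (rule integral_cong)
          fix s :: real assume s: "s \<in> {0..1}"
          have "(\<Sum>m\<in>UNIV. e l $ \<iota> m *\<^sub>R Y m (?X s)) = (\<Sum>m\<in>UNIV. if m = l then Y m (?X s) else 0)"
            by (rule sum.cong) (auto simp: e_component)
          then show "(\<Sum>m\<in>UNIV. u $ \<iota> m *\<^sub>R frechet_derivative (Y m) (at (?X s)) (frechet_derivative x (at (\<sigma> s u)) (\<sigma> s (e l)))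
              + e l $ \<iota> m *\<^sub>R Y m (?X s)) = ?I1 s"
            by (simp add: sum.distrib \<sigma>_e linear_cmul[OF linx[OF s]] linear_cmul[OF linY[OF s]]
                scaleR_sum_right mult.commute add.commute)
        qed
        finally show ?thesis .
      qed
      have i1: "?I1 integrable_on {0..1}"
      proof (rule integrable_continuous_interval)
        have "continuous_on {0..1} (\<lambda>s. pd l x (\<sigma> s u))"
          by (rule continuous_on_compose2[OF smooth_on_continuous[OF smooth_on_frechet_derivative[OF xs]]])
             (use \<sigma>_ball uV in \<open>auto intro!: continuous_intros\<close>)
        then show "continuous_on {0..1} ?I1"
          by (intro continuous_intros continuous_on_frechet_apply[OF Y] Xc continuous_on_compose2[OF smooth_on_continuous[OF Y] Xc])
             (use XN in auto)
      qed
      have 2: "(?I2 has_integral (1 *\<^sub>R Y l (?X 1) - 0 *\<^sub>R Y l (?X 0))) {0..1}"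
      proof (rule fundamental_theorem_of_calculus)
        fix s :: real assume s: "s \<in> {0..1}"
        have "((\<lambda>s. Y l (?X s)) has_vector_derivative frechet_derivative (Y l) (at (?X s)) (frame_field Y (0, u, ?X s))) (at s within {0..1})"
          using vector_derivative_diff_chain_within[OF ray[OF uV s], of "Y l" "frechet_derivative (Y l) (at (?X s))"]
            has_derivative_at_withinI[OF smooth_on_has_derivative[OF Y XN[OF s]]]
          by (simp add: o_def)
        moreover have "frechet_derivative (Y l) (at (?X s)) (frame_field Y (0, u, ?X s)) =
            (\<Sum>m\<in>UNIV. u $ \<iota> m *\<^sub>R frechet_derivative (Y m) (at (?X s)) (Y l (?X s)))"
          by (simp add: frame_field_def linear_sum[OF linY[OF s]] linear_cmul[OF linY[OF s]] comm[OF XN[OF s], of l])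
        ultimately have d: "((\<lambda>s. Y l (?X s)) has_vector_derivative
            (\<Sum>m\<in>UNIV. u $ \<iota> m *\<^sub>R frechet_derivative (Y m) (at (?X s)) (Y l (?X s)))) (at s within {0..1})" by simp
        have "((\<lambda>s::real. s) has_real_derivative 1) (at s within {0..1})" by (auto intro!: derivative_eq_intros)
        from has_vector_derivative_scaleR[OF this d]
        show "((\<lambda>s. s *\<^sub>R Y l (?X s)) has_vector_derivative ?I2 s) (at s within {0..1})"
          by (simp add: add.commute)
      qed simp
      then have 2: "Y l (x u) = integral {0..1} ?I2" "?I2 integrable_on {0..1}"
        using integral_unique by force+
      have "pd l x u - Y l (x u) = integral {0..1} (\<lambda>s. ?I1 s - ?I2 s)"
        by (simp only: 1 2(1) integral_diff[OF i1 2(2)])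
      also have "norm \<dots> \<le> M / 2"
      proof (rule norm_integral_unit_interval_le)
        show "(\<lambda>s. ?I1 s - ?I2 s) integrable_on {0..1}" using i1 2(2) by (rule integrable_diff)
        fix s :: real assume s: "s \<in> {0..1}"
        let ?w = "pd l x (\<sigma> s u) - Y l (?X s)"
        have "?I1 s - ?I2 s = s *\<^sub>R (\<Sum>m\<in>UNIV. u $ \<iota> m *\<^sub>R frechet_derivative (Y m) (at (?X s)) ?w)"
          by (simp add: linear_diff[OF linY[OF s]] scaleR_diff_right sum_subtractf)
        then have "norm (?I1 s - ?I2 s) \<le> norm (\<Sum>m\<in>UNIV. u $ \<iota> m *\<^sub>R frechet_derivative (Y m) (at (?X s)) ?w)"
          using s by (simp add: mult_left_le_one_le)
        also have "\<dots> \<le> 1 / 2 * norm ?w"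
        proof (rule norm_derivative_le_Lipschitz[where f="\<lambda>z. frame_field Y (s, u, z)" and z="?X s" and Z=\<Omega>])
          show "((\<lambda>z. frame_field Y (s, u, z)) has_derivative
              (\<lambda>y. \<Sum>m\<in>UNIV. u $ \<iota> m *\<^sub>R frechet_derivative (Y m) (at (?X s)) y)) (at (?X s))"
            unfolding frame_field_def fst_conv snd_conv
            by (intro has_derivative_sum bounded_linear.has_derivative[OF bounded_linear_scaleR_right]
                smooth_on_has_derivative[OF Y XN[OF s]])
          show "open \<Omega>" "?X s \<in> \<Omega>" using sol \<sigma>_ball[OF s uV] unfolding solves_def by blast+
          then show "norm (frame_field Y (s, u, z') - frame_field Y (s, u, ?X s)) \<le> 1 / 2 * norm (z' - ?X s)" if "z' \<in> \<Omega>" for z'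
            using sol s uV that unfolding solves_def by simp
        qed
        also have "norm ?w \<le> M"
          using M[OF \<sigma>_cball[OF s u]] by (simp add: E_def)
        finally show "norm (?I1 s - ?I2 s) \<le> M / 2" by simp
      qed
      finally show "E u \<le> 0 + M / 2" by (simp add: E_def)
    qed
    then show ?thesis by (simp add: E_def)
  qed
  assume d: "d > 0"
  then have 0: "0 \<in> ?V" by simp
  have p0: "coord_part \<iota> 0 = 0" by (simp add: coord_part_def vec_eq_iff)
  show x0: "x 0 = r0"
    using xeq[OF 0] linear_0[OF L] by (simp add: p0 frame_field_def)
  have \<sigma>0: "\<sigma> s 0 = 0" for s by (simp add: \<sigma>_def p0)
  have "frechet_derivative x (at 0) v = L (v - coord_part \<iota> v) + integral {0..1} (\<lambda>s::real. \<Sum>l\<in>UNIV. v $ \<iota> l *\<^sub>R Y l r0)"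
    using dx[OF 0, of v] by (simp add: \<sigma>0 x0)
  then show "frechet_derivative x (at 0) v = (\<Sum>l\<in>UNIV. v $ \<iota> l *\<^sub>R Y l r0) + L (v - coord_part \<iota> v)"
    by simp
qed

end

text \<open>
  The flow map is a chart because at \<open>0\<close> its derivative is the isomorphism \<open>L\<close> of the extended frame.
\<close>

lemma rectify_commuting_fields:
  fixes Y :: "'k::finite \<Rightarrow> real^'n::finite \<Rightarrow> real^'n"
  assumes N: "open N" "r0 \<in> N" and Y: "\<And>l. smooth_on N (Y l)"
    and indep: "\<And>c l. (\<Sum>l\<in>UNIV. c l *\<^sub>R Y l r0) = 0 \<Longrightarrow> c l = 0"
    and comm: "\<And>l m r. r \<in> N \<Longrightarrow> frechet_derivative (Y l) (at r) (Y m r) = frechet_derivative (Y m) (at r) (Y l r)"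
  obtains \<epsilon> N' \<psi> \<psi>' and \<iota> :: "'k \<Rightarrow> 'n" where "\<epsilon> > 0" "inj \<iota>" "N' \<subseteq> N" "\<psi>' 0 = r0"
    "smooth_diffeo (ball 0 \<epsilon>) N' \<psi>' \<psi>"
    "\<And>l \<rho>. \<rho> \<in> ball 0 \<epsilon> \<Longrightarrow> frechet_derivative \<psi>' (at \<rho>) (axis (\<iota> l) 1) = Y l (\<psi>' \<rho>)"
proof -
  obtain \<iota> :: "'k \<Rightarrow> 'n" and L :: "real^'n \<Rightarrow> real^'n" where \<iota>: "inj \<iota>" and L: "linear L" "inj L" "\<And>l. L (axis (\<iota> l) 1) = Y l r0"
  proof (rule extend_frame[where y="\<lambda>l. Y l r0"])
    show "c l = 0" if "(\<Sum>l\<in>UNIV. c l *\<^sub>R Y l r0) = 0" for c l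
      using indep[of c l] that by blast
  qed blast
  interpret leaf_coords \<iota> by standard (rule \<iota>)
  obtain d \<Omega> x where d: "d > 0" and \<Omega>: "\<Omega> \<subseteq> N"
    and sol: "solves d (UNIV \<times> UNIV \<times> N) \<Omega> (frame_field Y) (\<lambda>\<rho>. r0 + L (\<rho> - coord_part \<iota> \<rho>)) x"
    using frame_flow_exists[of N r0 Y L, OF N Y L(1)] by (elim exE conjE) (rule that)
  have x: "smooth_on (ball 0 d) x" "\<And>\<rho> l. \<rho> \<in> ball 0 d \<Longrightarrow> pd l x \<rho> = Y l (x \<rho>)" "x 0 = r0"
    "\<And>v. frechet_derivative x (at 0) v = (\<Sum>l\<in>UNIV. v $ \<iota> l *\<^sub>R Y l r0) + L (v - coord_part \<iota> v)"
    by (rule frame_flow_derivative[OF N(1) Y L(1) \<Omega> comm sol]; (assumption | rule d))+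
  have "frechet_derivative x (at 0) v = L v" for v
  proof -
    have "L (coord_part \<iota> v) = (\<Sum>l\<in>UNIV. v $ \<iota> l *\<^sub>R Y l r0)"
      by (simp add: coord_part_eq_sum[OF \<iota>] linear_sum[OF L(1)] linear_cmul[OF L(1)] L(3))
    then show ?thesis using x(4)[of v] linear_diff[OF L(1), of v "coord_part \<iota> v"] by simp
  qed
  then have injx: "inj (frechet_derivative x (at 0))" using L(2) by (simp add: inj_def)
  have 0: "0 \<in> ball (0::real^'n) d" using d by simp
  obtain \<epsilon> N' g where g: "\<epsilon> > 0" "ball (0::real^'n) \<epsilon> \<subseteq> ball 0 d" "smooth_diffeo (ball 0 \<epsilon>) N' x g"
    by (rule smooth_inverse_function[OF open_ball x(1) 0 injx])
  have "N' \<subseteq> N"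
  proof
    fix r assume "r \<in> N'"
    then obtain \<rho> where \<rho>: "\<rho> \<in> ball 0 \<epsilon>" "r = x \<rho>"
      using g(3) by (auto simp: smooth_diffeo_def homeomorphism_def)
    then have "\<rho> \<in> ball 0 d" using g(2) by blast
    moreover have "x ` ball 0 d \<subseteq> \<Omega>" using sol unfolding solves_def by (elim conjE)
    ultimately show "r \<in> N" using \<Omega> \<rho>(2) by blast
  qed
  then show thesis
    by (intro that[of \<epsilon> \<iota> N' x g] g(1,3) \<iota> x(2,3)) (use g(2) in blast)+
qed

section \<open>Poisson brackets\<close>

definition grad :: "('a::euclidean_space \<Rightarrow> real) \<Rightarrow> 'a \<Rightarrow> 'a" where
  "grad f q = (\<Sum>b\<in>Basis. frechet_derivative f (at q) b *\<^sub>R b)"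

lemma grad_eqI:
  assumes "(f has_derivative (\<lambda>v. u \<bullet> v)) (at q)"
  shows "grad f q = u"
  unfolding grad_def frechet_derivative_eqI[OF assms] by (rule euclidean_representation)

lemma grad_inner:
  assumes "(f has_derivative frechet_derivative f (at q)) (at q)"
  shows "grad f q \<bullet> v = frechet_derivative f (at q) v"
  using linear_eq_sum_Basis[OF has_derivative_linear[OF assms], of v]
  by (simp add: grad_def inner_sum_left mult.commute inner_commute[of v])

lemma grad_cong:
  assumes "open S" "q \<in> S" "\<And>z. z \<in> S \<Longrightarrow> f z = g z"
  shows "grad f q = grad g q"
  unfolding grad_def by (simp add: frechet_derivative_cong_open[of S q f g, OF assms])

lemma has_derivative_grad:
  assumes "smooth_on S f" "q \<in> S"
  shows "(f has_derivative (\<lambda>v. grad f q \<bullet> v)) (at q)"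
  using smooth_on_has_derivative[OF assms] grad_inner[OF smooth_on_has_derivative[OF assms]] by simp

lemma grad_fst:
  fixes f :: "'a::euclidean_space \<Rightarrow> real" and y :: "'b::euclidean_space"
  assumes "smooth_on S f" "r \<in> S"
  shows "grad (\<lambda>q. f (fst q)) (r, y) = (grad f r, 0)"
proof (rule grad_eqI)
  have "((\<lambda>q::'a \<times> 'b. fst q) has_derivative fst) (at (r, y))"
    by (intro has_derivative_fst has_derivative_ident)
  from has_derivative_compose[OF this, of f "\<lambda>v. grad f r \<bullet> v"] has_derivative_grad[OF assms]
  show "((\<lambda>q. f (fst q)) has_derivative (\<lambda>v. (grad f r, 0) \<bullet> v)) (at (r, y))"
    by (simp add: inner_prod_def)
qed

lemma smooth_on_fst:
  fixes f :: "'a::euclidean_space \<Rightarrow> 'c::real_normed_vector"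
  assumes "open S" "smooth_on S f"
  shows "smooth_on (S \<times> (UNIV :: 'b::euclidean_space set)) (\<lambda>q. f (fst q))"
proof (rule smooth_on_compose[OF _ assms(1) _ assms(2)])
  show o: "open (S \<times> (UNIV :: 'b set))" using assms(1) by (intro open_Times open_UNIV)
  show "smooth_on (S \<times> (UNIV :: 'b set)) fst" by (rule smooth_on_linear_map[OF o bounded_linear_fst])
qed auto

text \<open>
  Brackets of functions on \<open>N \<times> \<real>\<^sup>k\<close> for a bivector that need not satisfy the Jacobi identity. The
  formula for the derivative of a bracket is needed before that identity is available.
\<close>

locale lifted_bivector =
  fixes N :: "'a::euclidean_space set" and W :: "'a \<times> 'b::euclidean_space \<Rightarrow> 'a \<times> 'b \<Rightarrow> 'a \<times> 'b \<Rightarrow> real"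
  assumes open_N: "open N"
    and bilin: "q \<in> N \<times> UNIV \<Longrightarrow> bilinear (W q)"
    and alt: "q \<in> N \<times> UNIV \<Longrightarrow> W q \<alpha> \<alpha> = 0"
    and smooth_W: "smooth_on (N \<times> UNIV) (\<lambda>q. W q \<alpha> \<beta>)"
begin

text \<open>
  The tangent vector that \<open>W\<close> assigns to a covector: \<open>sh q \<alpha> \<bullet> \<beta> = W q \<alpha> \<beta>\<close>.
\<close>

definition sh :: "'a \<times> 'b \<Rightarrow> 'a \<times> 'b \<Rightarrow> 'a \<times> 'b" where "sh q \<alpha> = (\<Sum>b\<in>Basis. W q \<alpha> b *\<^sub>R b)"

definition PB :: "('a \<times> 'b \<Rightarrow> real) \<Rightarrow> ('a \<times> 'b \<Rightarrow> real) \<Rightarrow> 'a \<times> 'b \<Rightarrow> real" where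
  "PB f g q = W q (grad f q) (grad g q)"

lemma open_NU: "open (N \<times> UNIV)" using open_N by (intro open_Times open_UNIV)

lemma linear_W: "q \<in> N \<times> UNIV \<Longrightarrow> linear (W q \<alpha>)" "q \<in> N \<times> UNIV \<Longrightarrow> linear (\<lambda>\<alpha>. W q \<alpha> \<beta>)"
  using bilin[of q] unfolding bilinear_def by blast+

lemmas W_simps = linear_add[OF linear_W(1)] linear_add[OF linear_W(2)]
  linear_diff[OF linear_W(1)] linear_diff[OF linear_W(2)]
  linear_cmul[OF linear_W(1)] linear_cmul[OF linear_W(2)] linear_0[OF linear_W(1)] linear_0[OF linear_W(2)]

lemma W_antisym: "q \<in> N \<times> UNIV \<Longrightarrow> W q \<alpha> \<beta> = - W q \<beta> \<alpha>"
  using alt[of q "\<alpha> + \<beta>"] alt[of q \<alpha>] alt[of q \<beta>] by (simp add: W_simps)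

lemma sh_inner: "q \<in> N \<times> UNIV \<Longrightarrow> sh q \<alpha> \<bullet> \<beta> = W q \<alpha> \<beta>"
  using linear_eq_sum_Basis[OF linear_W(1), of q \<alpha> \<beta>]
  by (simp add: sh_def inner_sum_left mult.commute inner_commute[of \<beta>])

lemma W_expand:
  assumes "q \<in> N \<times> UNIV"
  shows "W q \<alpha> \<beta> = (\<Sum>b\<in>Basis. \<Sum>c\<in>Basis. ((\<alpha> \<bullet> b) * (\<beta> \<bullet> c)) * W q b c)"
proof -
  have "W q \<alpha> \<beta> = (\<Sum>b\<in>Basis. (\<alpha> \<bullet> b) * W q b \<beta>)"
    using linear_eq_sum_Basis[OF linear_W(2)[OF assms], of \<alpha> \<beta>] by simp
  also have "\<dots> = (\<Sum>b\<in>Basis. (\<alpha> \<bullet> b) * (\<Sum>c\<in>Basis. (\<beta> \<bullet> c) * W q b c))"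
    by (subst linear_eq_sum_Basis[OF linear_W(1)[OF assms]]) simp
  finally show ?thesis by (simp add: sum_distrib_left mult.assoc)
qed

lemma PB_eq_derivative:
  assumes "q \<in> N \<times> UNIV" "(g has_derivative frechet_derivative g (at q)) (at q)"
  shows "PB f g q = frechet_derivative g (at q) (sh q (grad f q))"
  unfolding PB_def sh_inner[OF assms(1), symmetric] grad_inner[OF assms(2), symmetric]
  by (rule inner_commute)

lemma PB_antisym: "q \<in> N \<times> UNIV \<Longrightarrow> PB f g q = - PB g f q"
  unfolding PB_def by (rule W_antisym)

lemma PB_cong:
  assumes "open S" "q \<in> S" "\<And>z. z \<in> S \<Longrightarrow> g z = g' z"
  shows "PB f g q = PB f g' q"
  unfolding PB_def by (simp add: grad_cong[of S q g g', OF assms])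

lemma PB_const:
  assumes "open S" "q \<in> S" "S \<subseteq> N \<times> UNIV" "\<And>z. z \<in> S \<Longrightarrow> g z = c"
  shows "PB f g q = 0"
proof -
  have "grad g q = grad (\<lambda>_. c) q" by (rule grad_cong[OF assms(1,2,4)])
  also have "\<dots> = 0" by (rule grad_eqI) simp
  finally show ?thesis unfolding PB_def by (simp add: W_simps(7)[OF subsetD[OF assms(3,2)]])
qed

lemma PB_eq_sum:
  assumes "q \<in> N \<times> UNIV" "(f has_derivative frechet_derivative f (at q)) (at q)"
    "(g has_derivative frechet_derivative g (at q)) (at q)"
  shows "PB f g q = (\<Sum>b\<in>Basis. \<Sum>c\<in>Basis.
    (frechet_derivative f (at q) b * frechet_derivative g (at q) c) * W q b c)"
  unfolding PB_def W_expand[OF assms(1), of "grad f q"] grad_inner[OF assms(2)] grad_inner[OF assms(3)] ..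

lemma smooth_on_PB:
  assumes O: "open O'" "O' \<subseteq> N \<times> UNIV" and f: "smooth_on O' f" and g: "smooth_on O' g"
  shows "smooth_on O' (PB f g)"
proof (rule smooth_on_cong[OF O(1)])
  show "smooth_on O' (\<lambda>q. \<Sum>b\<in>Basis. \<Sum>c\<in>Basis.
    (frechet_derivative f (at q) b * frechet_derivative g (at q) c) * W q b c)"
    by (intro smooth_on_sum smooth_on_mult smooth_on_frechet_derivative f g smooth_on_subset[OF smooth_W O(2)] O(1))
  show "(\<Sum>b\<in>Basis. \<Sum>c\<in>Basis. (frechet_derivative f (at q) b * frechet_derivative g (at q) c) * W q b c) = PB f g q"
    if "q \<in> O'" for q
    using PB_eq_sum[of q f g] O(2) that smooth_on_has_derivative[OF f that] smooth_on_has_derivative[OF g that] by auto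
qed

text \<open>
  Leibniz rule. The terms with second derivatives of \<open>g\<close> and \<open>h\<close> are written with the vectors
  \<open>sh q (grad h q)\<close> and \<open>sh q (grad g q)\<close>, so that they can cancel in the Jacobi identity.
\<close>

lemma PB_derivative:
  assumes O: "open O'" "O' \<subseteq> N \<times> UNIV" and g: "smooth_on O' g" and h: "smooth_on O' h" and q: "q \<in> O'"
  shows "frechet_derivative (PB g h) (at q) v =
    frechet_derivative (\<lambda>q'. W q' (grad g q) (grad h q)) (at q) v
    - frechet_derivative (\<lambda>z. frechet_derivative g (at z) (sh q (grad h q))) (at q) v
    + frechet_derivative (\<lambda>z. frechet_derivative h (at z) (sh q (grad g q))) (at q) v"
proof -
  have qN: "q \<in> N \<times> UNIV" using q O(2) by blast
  define D where "D f b = frechet_derivative (\<lambda>z. frechet_derivative f (at z) b) (at q) v"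
    for f :: "'a \<times> 'b \<Rightarrow> real" and b
  have dd: "((\<lambda>z. frechet_derivative f (at z) b) has_derivative
      frechet_derivative (\<lambda>z. frechet_derivative f (at z) b) (at q)) (at q)" if "smooth_on O' f" for f :: "'a \<times> 'b \<Rightarrow> real" and b
    by (rule smooth_on_has_derivative[OF smooth_on_frechet_derivative[OF that] q])
  have dW: "((\<lambda>q. W q b c) has_derivative frechet_derivative (\<lambda>q. W q b c) (at q)) (at q)" for b c
    by (rule smooth_on_has_derivative[OF smooth_W qN])
  have lind: "D f u = (\<Sum>b\<in>Basis. (u \<bullet> b) * D f b)" if f: "smooth_on O' f" for f u
  proof -
    have "frechet_derivative f (at z) u = (\<Sum>b\<in>Basis. (u \<bullet> b) * frechet_derivative f (at z) b)" if "z \<in> O'" for z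
      using linear_eq_sum_Basis[OF has_derivative_linear[OF smooth_on_has_derivative[OF f that]], of u] by simp
    then have "D f u = frechet_derivative (\<lambda>z. \<Sum>b\<in>Basis. (u \<bullet> b) * frechet_derivative f (at z) b) (at q) v"
      unfolding D_def by (subst frechet_derivative_cong_open[OF O(1) q]) auto
    also have "\<dots> = (\<Sum>b\<in>Basis. (u \<bullet> b) * D f b)"
    proof -
      have "((\<lambda>z. \<Sum>b\<in>Basis. (u \<bullet> b) * frechet_derivative f (at z) b) has_derivative
        (\<lambda>v. \<Sum>b\<in>Basis. (u \<bullet> b) * frechet_derivative (\<lambda>z. frechet_derivative f (at z) b) (at q) v)) (at q)"
        by (intro has_derivative_sum has_derivative_mult_right dd f)
      then show ?thesis unfolding D_def by (simp only: frechet_derivative_eqI)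
    qed
    finally show ?thesis .
  qed
  have "((\<lambda>q. \<Sum>b\<in>Basis. \<Sum>c\<in>Basis. (frechet_derivative g (at q) b * frechet_derivative h (at q) c) * W q b c)
    has_derivative (\<lambda>v. \<Sum>b\<in>Basis. \<Sum>c\<in>Basis.
      (frechet_derivative g (at q) b * frechet_derivative h (at q) c) * frechet_derivative (\<lambda>q. W q b c) (at q) v +
      (frechet_derivative g (at q) b * frechet_derivative (\<lambda>z. frechet_derivative h (at z) c) (at q) v +
       frechet_derivative (\<lambda>z. frechet_derivative g (at z) b) (at q) v * frechet_derivative h (at q) c) * W q b c)) (at q)"
    by (intro has_derivative_sum has_derivative_mult dd g h dW)
  moreover have "PB g h z = (\<Sum>b\<in>Basis. \<Sum>c\<in>Basis. (frechet_derivative g (at z) b * frechet_derivative h (at z) c) * W z b c)"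
    if "z \<in> O'" for z
    by (rule PB_eq_sum) (use that O(2) smooth_on_has_derivative[OF g that] smooth_on_has_derivative[OF h that] in auto)
  ultimately have "frechet_derivative (PB g h) (at q) v = (\<Sum>b\<in>Basis. \<Sum>c\<in>Basis.
      (frechet_derivative g (at q) b * frechet_derivative h (at q) c) * frechet_derivative (\<lambda>q. W q b c) (at q) v +
      (frechet_derivative g (at q) b * D h c + D g b * frechet_derivative h (at q) c) * W q b c)"
    using frechet_derivative_eqI frechet_derivative_cong_open[OF O(1) q] unfolding D_def by (metis (no_types, lifting))
  also have "\<dots> = (\<Sum>b\<in>Basis. \<Sum>c\<in>Basis. (frechet_derivative g (at q) b * frechet_derivative h (at q) c) * frechet_derivative (\<lambda>q. W q b c) (at q) v)
     + ((\<Sum>b\<in>Basis. \<Sum>c\<in>Basis. (frechet_derivative g (at q) b * D h c) * W q b c)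
     + (\<Sum>b\<in>Basis. \<Sum>c\<in>Basis. (D g b * frechet_derivative h (at q) c) * W q b c))"
    by (simp add: sum.distrib distrib_right)
  also have "(\<Sum>b\<in>Basis. \<Sum>c\<in>Basis. (frechet_derivative g (at q) b * frechet_derivative h (at q) c) * frechet_derivative (\<lambda>q. W q b c) (at q) v)
     = frechet_derivative (\<lambda>q'. W q' (grad g q) (grad h q)) (at q) v"
  proof -
    have "frechet_derivative (\<lambda>q'. W q' (grad g q) (grad h q)) (at q) =
      frechet_derivative (\<lambda>q'. \<Sum>b\<in>Basis. \<Sum>c\<in>Basis. ((grad g q \<bullet> b) * (grad h q \<bullet> c)) * W q' b c) (at q)"
      by (rule frechet_derivative_cong_open[OF open_NU qN W_expand])
    also have "\<dots> = (\<lambda>v. \<Sum>b\<in>Basis. \<Sum>c\<in>Basis. ((grad g q \<bullet> b) * (grad h q \<bullet> c)) * frechet_derivative (\<lambda>q. W q b c) (at q) v)"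
      by (rule frechet_derivative_eqI) (intro has_derivative_sum has_derivative_mult_right dW)
    finally show ?thesis
      by (simp add: grad_inner[OF smooth_on_has_derivative[OF g q]] grad_inner[OF smooth_on_has_derivative[OF h q]])
  qed
  also have "(\<Sum>b\<in>Basis. \<Sum>c\<in>Basis. (frechet_derivative g (at q) b * D h c) * W q b c) = D h (sh q (grad g q))"
  proof -
    have "D h (sh q (grad g q)) = (\<Sum>c\<in>Basis. W q (grad g q) c * D h c)"
      unfolding lind[OF h, of "sh q (grad g q)"] sh_inner[OF qN] ..
    also have "\<dots> = (\<Sum>c\<in>Basis. (\<Sum>b\<in>Basis. frechet_derivative g (at q) b * W q b c) * D h c)"
      using linear_eq_sum_Basis[OF linear_W(2)[OF qN], of "grad g q"]
      by (simp add: grad_inner[OF smooth_on_has_derivative[OF g q]])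
    finally show ?thesis
      by (subst sum.swap) (simp add: sum_distrib_left sum_distrib_right mult_ac)
  qed
  also have "(\<Sum>b\<in>Basis. \<Sum>c\<in>Basis. (D g b * frechet_derivative h (at q) c) * W q b c) = - D g (sh q (grad h q))"
  proof -
    have "D g (sh q (grad h q)) = (\<Sum>b\<in>Basis. W q (grad h q) b * D g b)"
      unfolding lind[OF g, of "sh q (grad h q)"] sh_inner[OF qN] ..
    also have "\<dots> = (\<Sum>b\<in>Basis. - W q b (grad h q) * D g b)"
      using W_antisym[OF qN, of "grad h q"] by simp
    also have "\<dots> = (\<Sum>b\<in>Basis. - (\<Sum>c\<in>Basis. frechet_derivative h (at q) c * W q b c) * D g b)"
      using linear_eq_sum_Basis[OF linear_W(1)[OF qN], of _ "grad h q"]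
      by (simp add: grad_inner[OF smooth_on_has_derivative[OF h q]])
    finally show ?thesis
      by (simp add: sum_distrib_left sum_distrib_right sum_negf mult_ac)
  qed
  finally show ?thesis unfolding D_def by simp
qed

end

text \<open>
  The Jacobi identity for constant covectors, that is, in components. It is local and makes sense for
  functions that are not periodic.
\<close>

locale lifted_poisson = lifted_bivector N W
  for N :: "'a::euclidean_space set" and W :: "'a \<times> 'b::euclidean_space \<Rightarrow> 'a \<times> 'b \<Rightarrow> 'a \<times> 'b \<Rightarrow> real" +
  assumes jacobi: "q \<in> N \<times> UNIV \<Longrightarrow>
      frechet_derivative (\<lambda>q. W q \<beta> \<gamma>) (at q) (\<Sum>b\<in>Basis. W q \<alpha> b *\<^sub>R b) +
      frechet_derivative (\<lambda>q. W q \<gamma> \<alpha>) (at q) (\<Sum>b\<in>Basis. W q \<beta> b *\<^sub>R b) +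
      frechet_derivative (\<lambda>q. W q \<alpha> \<beta>) (at q) (\<Sum>b\<in>Basis. W q \<gamma> b *\<^sub>R b) = 0"
begin

text \<open>
  In the cyclic sum each second derivative occurs twice with opposite signs and its two arguments
  exchanged.
\<close>

lemma jacobi_PB:
  assumes O: "open O'" "O' \<subseteq> N \<times> UNIV" and f: "smooth_on O' f" and g: "smooth_on O' g" and h: "smooth_on O' h"
    and q: "q \<in> O'"
  shows "PB f (PB g h) q + PB g (PB h f) q + PB h (PB f g) q = 0"
proof -
  have qN: "q \<in> N \<times> UNIV" using q O(2) by blast
  have sym: "frechet_derivative (\<lambda>z. frechet_derivative k (at z) u) (at q) v =
      frechet_derivative (\<lambda>z. frechet_derivative k (at z) v) (at q) u" if "smooth_on O' k" for k :: "'a \<times> 'b \<Rightarrow> real" and u v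
    by (rule frechet_derivative_symmetric[OF O(1) smooth_onD[OF that] q])
  have e: "PB k (PB k' k'') q = frechet_derivative (PB k' k'') (at q) (sh q (grad k q))"
    if "smooth_on O' k'" "smooth_on O' k''" for k k' k''
    by (rule PB_eq_derivative[OF qN smooth_on_has_derivative[OF smooth_on_PB[OF O that] q]])
  show ?thesis
    unfolding e[OF g h] e[OF h f] e[OF f g] PB_derivative[OF O g h q] PB_derivative[OF O h f q] PB_derivative[OF O f g q]
    using jacobi[OF qN, of "grad g q" "grad h q" "grad f q"] unfolding sh_def[symmetric]
    using sym[OF f, of "sh q (grad g q)" "sh q (grad h q)"] sym[OF g, of "sh q (grad f q)" "sh q (grad h q)"]
      sym[OF h, of "sh q (grad g q)" "sh q (grad f q)"]
    by linarith
qed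

end

section \<open>Partially integrable systems on the universal cover\<close>

lemma matrix_rows_span:
  fixes A :: "real^'k::finite^'k"
  assumes "invertible A"
  shows "v = (\<Sum>l\<in>UNIV. (\<Sum>m\<in>UNIV. v $ m * matrix_inv A $ m $ l) *\<^sub>R A $ l)"
proof -
  have "(\<Sum>l\<in>UNIV. (\<Sum>m\<in>UNIV. v $ m * matrix_inv A $ m $ l) * A $ l $ j) = v $ j" for j
  proof -
    have "(\<Sum>l\<in>UNIV. (\<Sum>m\<in>UNIV. v $ m * matrix_inv A $ m $ l) * A $ l $ j)
        = (\<Sum>l\<in>UNIV. \<Sum>m\<in>UNIV. v $ m * (matrix_inv A $ m $ l * A $ l $ j))"
      by (simp add: sum_distrib_right mult.assoc)
    also have "\<dots> = (\<Sum>m\<in>UNIV. v $ m * (matrix_inv A ** A) $ m $ j)"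
      by (subst sum.swap) (simp add: matrix_matrix_mult_def sum_distrib_left)
    also have "\<dots> = v $ j"
      by (simp add: matrix_inv_left_right[OF assms] mat_def if_distrib cong: if_cong)
    finally show ?thesis .
  qed
  then show ?thesis by (simp add: vec_eq_iff)
qed

text \<open>
  Used to pass from the Hamiltonian fields, which are the rows, to all vertical directions.
\<close>

lemma linear_zero_on_rows:
  fixes A :: "real^'k::finite^'k" and f :: "real^'k \<Rightarrow> 'b::real_vector"
  assumes "invertible A" and lin: "linear f" and "\<And>l. f (A $ l) = 0"
  shows "f v = 0"
  by (subst matrix_rows_span[OF assms(1), of v])
     (simp add: linear_sum[OF lin] linear_cmul[OF lin] assms(3))

lemma frechet_derivative_vertical:
  assumes f: "smooth_on S f" "(r, y) \<in> S"
    and g: "((\<lambda>y. f (r, y)) has_derivative g) (at y)"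
  shows "frechet_derivative f (at (r, y)) (0, v) = g v"
proof -
  have "((\<lambda>y. (r, y)) has_derivative (\<lambda>v. (0, v))) (at y)" by (auto intro!: derivative_eq_intros)
  from has_derivative_compose[OF this smooth_on_has_derivative[OF f]]
  have "((\<lambda>y. f (r, y)) has_derivative (\<lambda>v. frechet_derivative f (at (r, y)) (0, v))) (at y)" .
  from has_derivative_unique[OF this g] show ?thesis by metis
qed

lemma vertically_constant:
  fixes f :: "'a::euclidean_space \<times> 'b::euclidean_space \<Rightarrow> real"
  assumes f: "smooth_on (S \<times> UNIV) f" and r: "r \<in> S"
    and 0: "\<And>y v. frechet_derivative f (at (r, y)) (0, v) = 0"
  shows "f (r, y) = f (r, 0)"
proof -
  have "((\<lambda>y. f (r, y)) has_derivative (\<lambda>v. 0)) (at y)" for y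
  proof -
    have "((\<lambda>y. (r, y)) has_derivative (\<lambda>v. (0, v))) (at y)" by (auto intro!: derivative_eq_intros)
    from has_derivative_compose[OF this smooth_on_has_derivative[OF f, of "(r, y)"]] r 0
    show ?thesis by simp
  qed
  then obtain c where "\<forall>y\<in>UNIV. f (r, y) = c"
    using has_derivative_zero_constant[of UNIV "\<lambda>y. f (r, y)"] by auto
  then show ?thesis by simp
qed

text \<open>
  What a partially integrable system becomes on the universal cover: \<open>H l\<close> are the given integrals of
  motion as functions on the base, and row \<open>l\<close> of \<open>M r\<close> consists of the components of the Hamiltonian
  field of \<open>H l\<close>.
\<close>

locale lifted_pis = lifted_poisson N W
  for N :: "(real^'n::finite) set" and W :: "(real^'n) \<times> (real^'k::finite) \<Rightarrow> (real^'n) \<times> (real^'k) \<Rightarrow> (real^'n) \<times> (real^'k) \<Rightarrow> real" +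
  fixes J :: "'k set" and H :: "'k \<Rightarrow> real^'n \<Rightarrow> real" and M :: "real^'n \<Rightarrow> real^'k^'k"
  assumes periodic: "i \<in> J \<Longrightarrow> r \<in> N \<Longrightarrow> W (r, y + (2 * pi) *\<^sub>R axis i 1) = W (r, y)"
    and horizontal: "q \<in> N \<times> UNIV \<Longrightarrow> W q (a, 0) (a', 0) = 0"
    and smooth_H: "smooth_on N (H l)"
    and H_field: "r \<in> N \<Longrightarrow> W (r, y) (grad (H l) r, 0) (0, \<beta>) = M r $ l \<bullet> \<beta>"
    and M_invertible: "r \<in> N \<Longrightarrow> invertible (M r)"
begin

text \<open>
  The mixed part of the bivector as a linear map from fibre covectors to base vectors:
  \<open>a \<bullet> X r \<beta> = W (r, y) (a, 0) (0, \<beta>)\<close> for every \<open>y\<close>.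
\<close>

definition X :: "real^'n \<Rightarrow> real^'k \<Rightarrow> real^'n" where
  "X r \<beta> = (\<Sum>a\<in>Basis. W (r, 0) (a, 0) (0, \<beta>) *\<^sub>R a)"

lemma sh_horizontal:
  assumes "q \<in> N \<times> UNIV"
  shows "sh q (a, 0) = (0, \<Sum>b\<in>Basis. W q (a, 0) (0, b) *\<^sub>R b)"
proof -
  have "sh q (a, 0) \<bullet> v = (0, \<Sum>b\<in>Basis. W q (a, 0) (0, b) *\<^sub>R b) \<bullet> v" for v
  proof -
    obtain v1 v2 where v: "v = (v1, v2)" by (cases v) blast
    have "sh q (a, 0) \<bullet> v = W q (a, 0) ((v1, 0) + (0, v2))" by (simp add: sh_inner[OF assms] v)
    also have "\<dots> = W q (a, 0) (0, v2)" unfolding W_simps(1)[OF assms] by (simp add: horizontal[OF assms])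
    also have "\<dots> = (\<Sum>b\<in>Basis. (v2 \<bullet> b) * W q (a, 0) (0, b))"
    proof -
      have "linear (\<lambda>v2::real^'k. (0::real^'n, v2))" by (rule linearI) auto
      from linear_compose[OF this linear_W(1)[OF assms, of "(a, 0)"]]
      have "linear (\<lambda>v2. W q (a, 0) (0, v2))" by (simp add: o_def)
      from linear_eq_sum_Basis[OF this, of v2] show ?thesis by simp
    qed
    finally show ?thesis by (simp add: v inner_sum_left mult.commute inner_commute[of v2])
  qed
  then show ?thesis by (rule vector_eq_rdot[THEN iffD1, OF allI])
qed

text \<open>
  The Jacobi identity for \<open>(a, 0)\<close>, \<open>(0, \<beta>)\<close> and the differential of \<open>H\<^sub>l\<close>, frozen at \<open>r\<close>. One of its terms
  vanishes since base covectors are in involution, another one because the Hamiltonian field of \<open>H\<^sub>l\<close> is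
  constant on the fibre. What remains is the derivative along that field, and these fields span the fibre.
\<close>

lemma W_vertically_constant:
  assumes r: "r \<in> N"
  shows "W (r, y) (a, 0) (0, \<beta>) = W (r, 0) (a, 0) (0, \<beta>)"
proof (rule vertically_constant[OF smooth_W r])
  fix y v
  let ?D = "\<lambda>y v. frechet_derivative (\<lambda>q. W q (a, 0) (0, \<beta>)) (at (r, y)) (0, v)"
  have q: "(r, y) \<in> N \<times> UNIV" for y using r by simp
  have "?D y (M r $ l) = 0" for l
  proof -
    \<comment> \<open>the differential of \<open>H\<^sub>l\<close> at the fixed \<open>r\<close>, as a constant covector\<close>
    let ?h = "(grad (H l) r, 0) :: (real^'n) \<times> (real^'k)"
    have "frechet_derivative (\<lambda>q. W q (a, 0) (0, \<beta>)) (at (r, y)) (sh (r, y) ?h)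
        + frechet_derivative (\<lambda>q. W q (0, \<beta>) ?h) (at (r, y)) (sh (r, y) (a, 0))
        + frechet_derivative (\<lambda>q. W q ?h (a, 0)) (at (r, y)) (sh (r, y) (0, \<beta>)) = 0"
      using jacobi[OF q, where \<alpha>="?h" and \<beta>="(a, 0)" and \<gamma>="(0, \<beta>)"] unfolding sh_def .
    moreover have "frechet_derivative (\<lambda>q. W q ?h (a, 0)) (at (r, y)) = (\<lambda>_. 0)"
      using frechet_derivative_cong_open[OF open_NU q, of "\<lambda>q. W q ?h (a, 0)" "\<lambda>_. 0"] horizontal
        frechet_derivative_eqI[OF has_derivative_const] by metis
    moreover have "frechet_derivative (\<lambda>q. W q (0, \<beta>) ?h) (at (r, y)) (0, u) = 0" for u
    proof (rule frechet_derivative_vertical[OF smooth_W q])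
      have "(\<lambda>y. W (r, y) (0, \<beta>) ?h) = (\<lambda>y. - (M r $ l \<bullet> \<beta>))"
        using W_antisym[OF q, of _ "(0, \<beta>)" ?h] H_field[OF r] by simp
      then show "((\<lambda>y. W (r, y) (0, \<beta>) ?h) has_derivative (\<lambda>v. 0)) (at y)" by simp
    qed
    moreover have "sh (r, y) ?h = (0, M r $ l)"
      unfolding sh_horizontal[OF q] H_field[OF r] by (simp add: euclidean_representation)
    ultimately show ?thesis unfolding sh_horizontal[OF q] by simp
  qed
  moreover have "linear (?D y)"
  proof -
    have "linear (\<lambda>v2::real^'k. (0::real^'n, v2))" by (rule linearI) auto
    from linear_compose[OF this has_derivative_linear[OF smooth_on_has_derivative[OF smooth_W q]]]
    show ?thesis by (simp add: o_def)
  qed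
  ultimately show "?D y v = 0" using linear_zero_on_rows[OF M_invertible[OF r], of "?D y" v] by blast
qed

lemma X_inner:
  assumes r: "r \<in> N"
  shows "a \<bullet> X r \<beta> = W (r, y) (a, 0) (0, \<beta>)"
proof -
  have q: "(r, 0) \<in> N \<times> UNIV" using r by simp
  have "linear (\<lambda>a::real^'n. (a, 0::real^'k))" by (rule linearI) auto
  from linear_compose[OF this linear_W(2)[OF q, of "(0, \<beta>)"]]
  have "linear (\<lambda>a. W (r, 0) (a, 0) (0, \<beta>))" by (simp add: o_def)
  from linear_eq_sum_Basis[OF this, of a]
  have "a \<bullet> X r \<beta> = W (r, 0) (a, 0) (0, \<beta>)"
    by (simp add: X_def inner_sum_right mult.commute)
  then show ?thesis unfolding W_vertically_constant[OF r, of y] .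
qed

lemma linear_X: "r \<in> N \<Longrightarrow> linear (X r)"
proof (rule linearI)
  assume r: "r \<in> N"
  then have q: "(r, 0) \<in> N \<times> UNIV" by simp
  show "X r (b1 + b2) = X r b1 + X r b2" for b1 b2
  proof -
    have "(0, b1 + b2) = (0, b1) + ((0, b2) :: (real^'n) \<times> (real^'k))" by simp
    then show ?thesis unfolding X_def by (simp only: W_simps(1)[OF q] scaleR_left_distrib sum.distrib)
  qed
  show "X r (c *\<^sub>R b) = c *\<^sub>R X r b" for c b
  proof -
    have "(0, c *\<^sub>R b) = c *\<^sub>R ((0, b) :: (real^'n) \<times> (real^'k))" by simp
    then show ?thesis unfolding X_def by (simp only: W_simps(5)[OF q] scaleR_sum_right scaleR_scaleR real_scaleR_def)
  qed
qed

lemma smooth_X: "smooth_on N (\<lambda>r. X r \<beta>)"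
  unfolding X_def
proof (intro smooth_on_sum smooth_on_scaleR smooth_on_const open_N)
  fix a :: "real^'n"
  have "smooth_on N (\<lambda>r. (r, 0::real^'k))"
    by (intro smooth_on_linear_map open_N bounded_linear_Pair bounded_linear_ident bounded_linear_zero)
  then show "smooth_on N (\<lambda>r. W (r, 0) (a, 0) (0, \<beta>))"
    by (rule smooth_on_compose[OF open_N open_NU _ smooth_W]) auto
qed

lemma PB_base:
  assumes f: "smooth_on S f" "r \<in> S" "S \<subseteq> N"
  shows "PB (\<lambda>q. f (fst q)) g (r, y) = grad f r \<bullet> X r (snd (grad g (r, y)))"
proof -
  have r: "r \<in> N" using f by blast
  then have q: "(r, y) \<in> N \<times> UNIV" by simp
  obtain g1 g2 where g: "grad g (r, y) = (g1, g2)" by (cases "grad g (r, y)") blast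
  have "PB (\<lambda>q. f (fst q)) g (r, y) = W (r, y) (grad f r, 0) ((g1, 0) + (0, g2))"
    unfolding PB_def grad_fst[OF f(1,2)] g by simp
  also have "\<dots> = W (r, y) (grad f r, 0) (0, g2)"
    unfolding W_simps(1)[OF q] by (simp add: horizontal[OF q])
  finally show ?thesis by (simp add: X_inner[OF r, of _ _ y] g)
qed

lemma PB_base_base:
  assumes f: "smooth_on S f" "r \<in> S" "S \<subseteq> N" and g: "smooth_on S g"
  shows "PB (\<lambda>q. f (fst q)) (\<lambda>q. g (fst q)) (r, y) = 0"
  unfolding PB_base[OF f] grad_fst[OF g f(2)] using linear_0[OF linear_X] f by auto

end

text \<open>
  A family \<open>K\<close> of functions on a part of the base with vertical Hamiltonian fields, the rows of \<open>A\<close>, that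
  form a frame. Two families are used, the given integrals and the action functions adapted to the
  cyclic coordinates.
\<close>

locale momentum_family = lifted_pis N W J H M
  for N :: "(real^'n::finite) set" and W :: "(real^'n) \<times> (real^'k::finite) \<Rightarrow> (real^'n) \<times> (real^'k) \<Rightarrow> (real^'n) \<times> (real^'k) \<Rightarrow> real"
    and J H M +
  fixes N1 :: "(real^'n) set" and K :: "'k \<Rightarrow> real^'n \<Rightarrow> real" and A :: "real^'n \<Rightarrow> real^'k^'k"
  assumes open_N1: "open N1" and N1_sub: "N1 \<subseteq> N" and smooth_K: "smooth_on N1 (K l)"
    and K_field: "r \<in> N1 \<Longrightarrow> grad (K l) r \<bullet> X r \<beta> = A r $ l \<bullet> \<beta>"
    and A_invertible: "r \<in> N1 \<Longrightarrow> invertible (A r)"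
begin

definition R :: "real^'n \<Rightarrow> real^'k^'k" where "R r = matrix_inv (A r)"

text \<open>
  Fibre coordinates conjugate to \<open>K\<close>.
\<close>

definition fibre_coord :: "'k \<Rightarrow> (real^'n) \<times> (real^'k) \<Rightarrow> real" where
  "fibre_coord l q = (\<Sum>m\<in>UNIV. snd q $ m * R (fst q) $ m $ l)"

text \<open>
  The base field \<open>f \<mapsto> {f, y'\<^sub>l}\<close>, where \<open>y'\<^sub>l = fibre_coord l\<close>.
\<close>

definition Y :: "'k \<Rightarrow> real^'n \<Rightarrow> real^'n" where "Y l r = X r (column l (R r))"

text \<open>
  The bracket of two conjugate fibre coordinates, evaluated at the fibre point \<open>0\<close>; it is the same at all
  points of the fibre.
\<close>

definition P :: "'k \<Rightarrow> 'k \<Rightarrow> real^'n \<Rightarrow> real" where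
  "P l m r = PB (fibre_coord l) (fibre_coord m) (r, 0)"

lemma open_N1U: "open (N1 \<times> UNIV)" using open_N1 by (intro open_Times open_UNIV)

lemma N1U_sub: "N1 \<times> UNIV \<subseteq> N \<times> UNIV" using N1_sub by auto

lemma smooth_A: "smooth_on N1 (\<lambda>r. A r $ l $ m)"
proof (rule smooth_on_cong[OF open_N1])
  show "(\<Sum>b\<in>Basis. frechet_derivative (K l) (at r) b * (b \<bullet> X r (axis m 1))) = A r $ l $ m" if r: "r \<in> N1" for r
  proof -
    have "(\<Sum>b\<in>Basis. frechet_derivative (K l) (at r) b * (b \<bullet> X r (axis m 1))) = grad (K l) r \<bullet> X r (axis m 1)"
      by (simp add: grad_def inner_sum_left)
    then show ?thesis using K_field[OF r, of l "axis m 1"] by (simp add: inner_axis)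
  qed
  show "smooth_on N1 (\<lambda>r. \<Sum>b\<in>Basis. frechet_derivative (K l) (at r) b * (b \<bullet> X r (axis m 1)))"
    by (intro smooth_on_sum smooth_on_mult smooth_on_frechet_derivative smooth_K open_N1
        smooth_on_inner smooth_on_const smooth_on_subset[OF smooth_X N1_sub])
qed

lemma smooth_R: "smooth_on N1 (\<lambda>r. R r $ l $ m)"
  unfolding R_def by (rule smooth_on_matrix_inv[OF open_N1 smooth_A A_invertible])

lemma A_R: "r \<in> N1 \<Longrightarrow> A r ** R r = mat 1" "r \<in> N1 \<Longrightarrow> R r ** A r = mat 1"
  unfolding R_def using matrix_inv_left_right[OF A_invertible] by auto

lemma smooth_Y: "smooth_on N1 (Y l)"
proof (rule smooth_on_cong[OF open_N1])
  show "(\<Sum>m\<in>UNIV. R r $ m $ l *\<^sub>R X r (axis m 1)) = Y l r" if r: "r \<in> N1" for r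
  proof -
    have rN: "r \<in> N" using r N1_sub by blast
    have "column l (R r) = (\<Sum>m\<in>UNIV. R r $ m $ l *\<^sub>R axis m 1)"
      by (simp add: vec_eq_iff column_def axis_def if_distrib cong: if_cong)
    then show ?thesis unfolding Y_def by (simp add: linear_sum[OF linear_X[OF rN]] linear_cmul[OF linear_X[OF rN]])
  qed
  show "smooth_on N1 (\<lambda>r. \<Sum>m\<in>UNIV. R r $ m $ l *\<^sub>R X r (axis m 1))"
    by (intro smooth_on_sum smooth_on_scaleR smooth_R smooth_on_subset[OF smooth_X N1_sub] open_N1)
qed

lemma smooth_fibre_coord: "smooth_on (N1 \<times> UNIV) (fibre_coord l)"
  unfolding fibre_coord_def
  by (intro smooth_on_sum smooth_on_mult open_N1U smooth_on_fst[OF open_N1 smooth_R]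
      smooth_on_vec_nth smooth_on_linear_map bounded_linear_snd)

lemma fibre_coord_vertical:
  assumes r: "r \<in> N1"
  shows "snd (grad (fibre_coord l) (r, y)) = column l (R r)"
proof -
  have q: "(r, y) \<in> N1 \<times> UNIV" using r by simp
  have "snd (grad (fibre_coord l) (r, y)) \<bullet> v = column l (R r) \<bullet> v" for v
  proof -
    have "snd (grad (fibre_coord l) (r, y)) \<bullet> v = frechet_derivative (fibre_coord l) (at (r, y)) (0, v)"
      using grad_inner[OF smooth_on_has_derivative[OF smooth_fibre_coord q], of l "(0, v)"] by (simp add: inner_prod_def)
    also have "\<dots> = v \<bullet> column l (R r)"
    proof (rule frechet_derivative_vertical[OF smooth_fibre_coord q])
      have "(\<lambda>y. fibre_coord l (r, y)) = (\<lambda>y. y \<bullet> column l (R r))"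
        by (simp add: fibre_coord_def inner_vec_def column_def)
      then show "((\<lambda>y. fibre_coord l (r, y)) has_derivative (\<lambda>v. v \<bullet> column l (R r))) (at y)"
        by (auto intro!: derivative_eq_intros)
    qed
    finally show ?thesis by (simp add: inner_commute)
  qed
  then show ?thesis by (rule vector_eq_rdot[THEN iffD1, OF allI])
qed

lemma PB_base_fibre:
  assumes f: "smooth_on S f" "r \<in> S" "S \<subseteq> N1"
  shows "PB (\<lambda>q. f (fst q)) (fibre_coord m) (r, y) = frechet_derivative f (at r) (Y m r)"
proof -
  have "S \<subseteq> N" using f N1_sub by blast
  then show ?thesis
    unfolding PB_base[OF f(1,2) \<open>S \<subseteq> N\<close>] Y_def using f
    by (simp add: fibre_coord_vertical grad_inner[OF smooth_on_has_derivative[OF f(1,2)]] subset_iff)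
qed

lemma PB_fibre_base:
  assumes f: "smooth_on S f" "r \<in> S" "S \<subseteq> N1"
  shows "PB (fibre_coord m) (\<lambda>q. f (fst q)) (r, y) = - frechet_derivative f (at r) (Y m r)"
  using PB_antisym[of "(r, y)" "fibre_coord m"] PB_base_fibre[OF f] f N1_sub by auto

lemma Y_K:
  assumes r: "r \<in> N1"
  shows "frechet_derivative (K l) (at r) (Y m r) = (if l = m then 1 else 0)"
proof -
  have "frechet_derivative (K l) (at r) (Y m r) = A r $ l \<bullet> column m (R r)"
    unfolding grad_inner[OF smooth_on_has_derivative[OF smooth_K r], symmetric] Y_def K_field[OF r] ..
  also have "\<dots> = (A r ** R r) $ l $ m" by (simp add: matrix_matrix_mult_def inner_vec_def column_def)
  finally show ?thesis by (simp add: A_R[OF r] mat_def)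
qed

text \<open>
  The Jacobi identity for \<open>K\<^sub>n\<close> and two conjugate fibre coordinates: brackets of \<open>K\<^sub>n\<close> with these are constant,
  so the bracket of \<open>K\<^sub>n\<close> with \<open>{y'\<^sub>l, y'\<^sub>m}\<close> vanishes, which is the derivative along a row of \<open>A\<close>.
\<close>

lemma PB_fibre_coords:
  assumes r: "r \<in> N1"
  shows "PB (fibre_coord l) (fibre_coord m) (r, y) = P l m r"
  unfolding P_def
proof (rule vertically_constant[OF smooth_on_PB[OF open_N1U N1U_sub smooth_fibre_coord smooth_fibre_coord] r])
  fix y v :: "real^'k"
  let ?p = "PB (fibre_coord l) (fibre_coord m)"
  have q: "(r, y) \<in> N1 \<times> UNIV" using r by simp
  have qN: "(r, y) \<in> N \<times> UNIV" using q N1U_sub by blast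
  have sp: "smooth_on (N1 \<times> UNIV) ?p" by (rule smooth_on_PB[OF open_N1U N1U_sub smooth_fibre_coord smooth_fibre_coord])
  have "frechet_derivative ?p (at (r, y)) (0, A r $ n) = 0" for n
  proof -
    have "PB (\<lambda>q. K n (fst q)) ?p (r, y) + PB (fibre_coord l) (PB (fibre_coord m) (\<lambda>q. K n (fst q))) (r, y)
        + PB (fibre_coord m) (PB (\<lambda>q. K n (fst q)) (fibre_coord l)) (r, y) = 0"
      by (rule jacobi_PB[OF open_N1U N1U_sub smooth_on_fst[OF open_N1 smooth_K] smooth_fibre_coord smooth_fibre_coord q])
    moreover have "PB (fibre_coord l) (PB (fibre_coord m) (\<lambda>q. K n (fst q))) (r, y) = 0"
      by (rule PB_const[OF open_N1U q N1U_sub, of _ "- (if n = m then 1 else 0)"])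
         (auto simp: PB_fibre_base[OF smooth_K _ order_refl] Y_K)
    moreover have "PB (fibre_coord m) (PB (\<lambda>q. K n (fst q)) (fibre_coord l)) (r, y) = 0"
      by (rule PB_const[OF open_N1U q N1U_sub, of _ "(if n = l then 1 else 0)"])
         (auto simp: PB_base_fibre[OF smooth_K _ order_refl] Y_K)
    ultimately have "PB (\<lambda>q. K n (fst q)) ?p (r, y) = 0" by simp
    moreover have "PB (\<lambda>q. K n (fst q)) ?p (r, y) = grad (K n) r \<bullet> X r (snd (grad ?p (r, y)))"
      by (rule PB_base[OF smooth_K r N1_sub])
    moreover have "\<dots> = snd (grad ?p (r, y)) \<bullet> A r $ n"
      by (simp add: K_field[OF r] inner_commute)
    moreover have "\<dots> = frechet_derivative ?p (at (r, y)) (0, A r $ n)"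
      using grad_inner[OF smooth_on_has_derivative[OF sp q], of "(0, A r $ n)"] by (simp add: inner_prod_def)
    ultimately show ?thesis by simp
  qed
  moreover have "linear (\<lambda>v. frechet_derivative ?p (at (r, y)) (0, v))"
  proof -
    have "linear (\<lambda>v2::real^'k. (0::real^'n, v2))" by (rule linearI) auto
    from linear_compose[OF this has_derivative_linear[OF smooth_on_has_derivative[OF sp q]]]
    show ?thesis by (simp add: o_def)
  qed
  ultimately show "frechet_derivative ?p (at (r, y)) (0, v) = 0"
    using linear_zero_on_rows[OF A_invertible[OF r], of "\<lambda>v. frechet_derivative ?p (at (r, y)) (0, v)" v] by blast
qed

lemma smooth_P: "smooth_on N1 (P l m)"
proof -
  have "smooth_on N1 (\<lambda>r. (r, 0::real^'k))"
    by (intro smooth_on_linear_map open_N1 bounded_linear_Pair bounded_linear_ident bounded_linear_zero)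
  then show ?thesis unfolding P_def
    by (rule smooth_on_compose[OF open_N1 open_N1U _ smooth_on_PB[OF open_N1U N1U_sub smooth_fibre_coord smooth_fibre_coord]]) auto
qed

lemma P_antisym: "r \<in> N1 \<Longrightarrow> P l m r = - P m l r"
  unfolding P_def using N1_sub by (intro PB_antisym) auto

text \<open>
  The Jacobi identity for a linear function of \<open>r\<close> and two conjugate fibre coordinates.
\<close>

lemma Y_commute:
  assumes r: "r \<in> N1"
  shows "frechet_derivative (Y l) (at r) (Y m r) = frechet_derivative (Y m) (at r) (Y l r)"
proof -
  have "a \<bullet> frechet_derivative (Y l) (at r) (Y m r) = a \<bullet> frechet_derivative (Y m) (at r) (Y l r)" for a
  proof -
    \<comment> \<open>a linear function of \<open>r\<close> suffices as the fields are determined by their components\<close>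
    let ?f = "\<lambda>r::real^'n. a \<bullet> r"
    have fs: "smooth_on N1 ?f" by (intro smooth_on_linear_map open_N1 bounded_linear_inner_right)
    have fd: "frechet_derivative ?f (at z) v = a \<bullet> v" for z v
      using frechet_derivative_eqI[OF bounded_linear_imp_has_derivative[OF bounded_linear_inner_right]] by metis
    have aY: "smooth_on N1 (\<lambda>r. c * (a \<bullet> Y n r))" for n c
      by (intro smooth_on_mult smooth_on_inner smooth_on_const smooth_Y open_N1)
    have daY: "frechet_derivative (\<lambda>r. c * (a \<bullet> Y n r)) (at r) v = c * (a \<bullet> frechet_derivative (Y n) (at r) v)" for n v c
    proof -
      have "((\<lambda>r. c * (a \<bullet> Y n r)) has_derivative (\<lambda>v. c * (a \<bullet> frechet_derivative (Y n) (at r) v))) (at r)"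
        by (intro has_derivative_mult_right has_derivative_inner_right smooth_on_has_derivative[OF smooth_Y r])
      then show ?thesis using frechet_derivative_eqI by metis
    qed
    have q: "(r, 0::real^'k) \<in> N1 \<times> UNIV" using r by simp
    have "PB (\<lambda>q. ?f (fst q)) (PB (fibre_coord l) (fibre_coord m)) (r, 0)
        + PB (fibre_coord l) (PB (fibre_coord m) (\<lambda>q. ?f (fst q))) (r, 0)
        + PB (fibre_coord m) (PB (\<lambda>q. ?f (fst q)) (fibre_coord l)) (r, 0) = 0"
      by (rule jacobi_PB[OF open_N1U N1U_sub smooth_on_fst[OF open_N1 fs] smooth_fibre_coord smooth_fibre_coord q])
    moreover have "PB (\<lambda>q. ?f (fst q)) (PB (fibre_coord l) (fibre_coord m)) (r, 0) = 0"
    proof -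
      have "PB (\<lambda>q. ?f (fst q)) (PB (fibre_coord l) (fibre_coord m)) (r, 0) = PB (\<lambda>q. ?f (fst q)) (\<lambda>q. P l m (fst q)) (r, 0)"
        by (rule PB_cong[OF open_N1U q]) (auto simp: PB_fibre_coords)
      then show ?thesis using PB_base_base[OF fs r N1_sub smooth_P] by simp
    qed
    moreover have "PB (fibre_coord l) (PB (fibre_coord m) (\<lambda>q. ?f (fst q))) (r, 0) = PB (fibre_coord l) (\<lambda>q. (-1) * (a \<bullet> Y m (fst q))) (r, 0)"
      by (rule PB_cong[OF open_N1U q]) (auto simp: PB_fibre_base[OF fs _ order_refl] fd)
    moreover have "\<dots> = a \<bullet> frechet_derivative (Y m) (at r) (Y l r)"
      unfolding PB_fibre_base[OF aY r order_refl] daY by simp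
    moreover have "PB (fibre_coord m) (PB (\<lambda>q. ?f (fst q)) (fibre_coord l)) (r, 0) = PB (fibre_coord m) (\<lambda>q. 1 * (a \<bullet> Y l (fst q))) (r, 0)"
      by (rule PB_cong[OF open_N1U q]) (auto simp: PB_base_fibre[OF fs _ order_refl] fd)
    moreover have "\<dots> = - (a \<bullet> frechet_derivative (Y l) (at r) (Y m r))"
      unfolding PB_fibre_base[OF aY r order_refl] daY by simp
    ultimately show ?thesis by simp
  qed
  then show ?thesis by (rule vector_eq_ldot[THEN iffD1, OF allI])
qed

text \<open>
  The Jacobi identity for three conjugate fibre coordinates.
\<close>

lemma P_closed:
  assumes r: "r \<in> N1"
  shows "frechet_derivative (P m n) (at r) (Y l r) + frechet_derivative (P n l) (at r) (Y m r)
    + frechet_derivative (P l m) (at r) (Y n r) = 0"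
proof -
  have q: "(r, 0::real^'k) \<in> N1 \<times> UNIV" using r by simp
  have e: "PB (fibre_coord a) (PB (fibre_coord b) (fibre_coord c)) (r, 0) = - frechet_derivative (P b c) (at r) (Y a r)" for a b c
  proof -
    have "PB (fibre_coord a) (PB (fibre_coord b) (fibre_coord c)) (r, 0) = PB (fibre_coord a) (\<lambda>q. P b c (fst q)) (r, 0)"
      by (rule PB_cong[OF open_N1U q]) (auto simp: PB_fibre_coords)
    then show ?thesis using PB_fibre_base[OF smooth_P r order_refl] by simp
  qed
  show ?thesis
    using jacobi_PB[OF open_N1U N1U_sub smooth_fibre_coord[of l] smooth_fibre_coord[of m] smooth_fibre_coord[of n] q]
    unfolding e by linarith
qed

text \<open>
  Translation by \<open>2\<pi>\<close> along a cyclic coordinate \<open>y\<^sub>i\<close> preserves \<open>W\<close> and adds \<open>2\<pi>R\<^sub>i\<^sub>l\<close> to \<open>y'\<^sub>l\<close>. As the brackets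
  \<open>{y'\<^sub>l, y'\<^sub>m}\<close> are constant on the fibre, the brackets of the added terms must cancel; the bracket of
  \<open>R\<^sub>i\<^sub>l\<close> with \<open>R\<^sub>i\<^sub>m\<close> vanishes.
\<close>

lemma cyclic_row_closed:
  assumes r: "r \<in> N1" and i: "i \<in> J"
  shows "frechet_derivative (\<lambda>r. R r $ i $ l) (at r) (Y m r) = frechet_derivative (\<lambda>r. R r $ i $ m) (at r) (Y l r)"
proof -
  let ?c = "(2 * pi) *\<^sub>R axis i 1 :: real^'k"
  let ?g = "\<lambda>l. grad (fibre_coord l) (r, 0)" and ?a = "\<lambda>l. (grad (\<lambda>r. R r $ i $ l) r, 0) :: (real^'n) \<times> (real^'k)"
  have rN: "r \<in> N" and q: "(r, 0::real^'k) \<in> N1 \<times> UNIV" "(r, ?c) \<in> N1 \<times> UNIV" and qN: "(r, 0::real^'k) \<in> N \<times> UNIV"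
    using r N1_sub by auto
  have shift: "grad (fibre_coord l) (r, ?c) = ?g l + (2 * pi) *\<^sub>R ?a l" for l
  proof (rule grad_eqI)
    have "((\<lambda>q. q - (0, ?c)) has_derivative (\<lambda>v. v)) (at (r, ?c))" by (auto intro!: derivative_eq_intros)
    from has_derivative_compose[OF this, of "fibre_coord l" "\<lambda>v. ?g l \<bullet> v"] has_derivative_grad[OF smooth_fibre_coord q(1)]
    have 1: "((\<lambda>q. fibre_coord l (q - (0, ?c))) has_derivative (\<lambda>v. ?g l \<bullet> v)) (at (r, ?c))" by simp
    have 2: "((\<lambda>q. R (fst q) $ i $ l) has_derivative (\<lambda>v. ?a l \<bullet> v)) (at (r, ?c))"
      using has_derivative_grad[OF smooth_on_fst[OF open_N1 smooth_R] q(2)] grad_fst[OF smooth_R r] by metis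
    have "fibre_coord l q = fibre_coord l (q - (0, ?c)) + (2 * pi) * R (fst q) $ i $ l" for q
    proof -
      have "fibre_coord l q - fibre_coord l (q - (0, ?c)) = (\<Sum>m\<in>UNIV. ?c $ m * R (fst q) $ m $ l)"
        unfolding fibre_coord_def sum_subtractf[symmetric] by (rule sum.cong) (auto simp: algebra_simps)
      also have "\<dots> = (\<Sum>m\<in>UNIV. if m = i then (2 * pi) * R (fst q) $ i $ l else 0)"
        by (rule sum.cong) (auto simp: axis_def)
      finally show ?thesis by simp
    qed
    then have eq: "fibre_coord l = (\<lambda>q. fibre_coord l (q - (0, ?c)) + (2 * pi) * R (fst q) $ i $ l)" by blast
    have "((\<lambda>q. fibre_coord l (q - (0, ?c)) + (2 * pi) * R (fst q) $ i $ l) has_derivative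
        (\<lambda>v. ?g l \<bullet> v + (2 * pi) * (?a l \<bullet> v))) (at (r, ?c))"
      by (intro has_derivative_add 1 has_derivative_mult_right 2)
    note this[folded eq]
    then show "(fibre_coord l has_derivative (\<lambda>v. (?g l + (2 * pi) *\<^sub>R ?a l) \<bullet> v)) (at (r, ?c))"
      unfolding inner_add_left inner_scaleR_left .
  qed
  have ag: "W (r, 0) (?a l) (?g m) = frechet_derivative (\<lambda>r. R r $ i $ l) (at r) (Y m r)" for l m
    using PB_base_fibre[OF smooth_R r order_refl, of i l m 0] grad_fst[OF smooth_R r] unfolding PB_def by metis
  have "P l m r = W (r, 0) (?g l + (2 * pi) *\<^sub>R ?a l) (?g m + (2 * pi) *\<^sub>R ?a m)"
    unfolding PB_fibre_coords[OF r, of l m ?c, symmetric] PB_def shift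
    using periodic[OF i rN, of 0] by simp
  also have "\<dots> = W (r, 0) (?g l) (?g m) + (2 * pi) * W (r, 0) (?g l) (?a m) + (2 * pi) * W (r, 0) (?a l) (?g m)"
    unfolding W_simps(1,2)[OF qN] W_simps(5,6)[OF qN] horizontal[OF qN] by simp
  also have "W (r, 0) (?g l) (?g m) = P l m r" by (simp add: P_def PB_def)
  also have "W (r, 0) (?g l) (?a m) = - W (r, 0) (?a m) (?g l)" by (rule W_antisym[OF qN])
  finally show ?thesis unfolding ag by simp
qed

end

section \<open>Canonical charts on the universal cover\<close>

lemma smooth_diffeo_sym: "smooth_diffeo S T f g \<Longrightarrow> smooth_diffeo T S g f"
  unfolding smooth_diffeo_def using homeomorphism_symD by blast

lemma smooth_diffeoD:
  assumes "smooth_diffeo S T f g"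
  shows "open S" "open T" "smooth_on S f" "smooth_on T g" "\<And>x. x \<in> S \<Longrightarrow> f x \<in> T" "\<And>y. y \<in> T \<Longrightarrow> g y \<in> S"
    "\<And>x. x \<in> S \<Longrightarrow> g (f x) = x" "\<And>y. y \<in> T \<Longrightarrow> f (g y) = y"
  using assms unfolding smooth_diffeo_def homeomorphism_def by auto

lemma frechet_derivative_chain:
  assumes f: "smooth_on S f" "x \<in> S" and g: "smooth_on T g" "f x \<in> T"
  shows "frechet_derivative (\<lambda>x. g (f x)) (at x) v = frechet_derivative g (at (f x)) (frechet_derivative f (at x) v)"
  using frechet_derivative_eqI[OF has_derivative_compose[OF smooth_on_has_derivative[OF f] smooth_on_has_derivative[OF g]]]
  by simp

lemma smooth_diffeo_inverse_derivative:
  assumes d: "smooth_diffeo S T f g" and x: "x \<in> S"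
  shows "frechet_derivative g (at (f x)) (frechet_derivative f (at x) v) = v"
proof -
  note D = smooth_diffeoD[OF d]
  have "frechet_derivative (\<lambda>x. g (f x)) (at x) = frechet_derivative (\<lambda>x. x) (at x)"
    by (rule frechet_derivative_cong_open[OF D(1) x D(7)])
  also have "\<dots> = (\<lambda>v. v)" by (rule frechet_derivative_eqI) simp
  finally show ?thesis
    using frechet_derivative_chain[OF D(3) x D(4) D(5)[OF x], of v] by simp
qed

context momentum_family
begin

lemma Y_independent:
  assumes r: "r \<in> N1" and 0: "(\<Sum>l\<in>UNIV. c l *\<^sub>R Y l r) = 0"
  shows "c l = 0"
proof -
  have lin: "linear (frechet_derivative (K l) (at r))"
    using smooth_on_has_derivative[OF smooth_K r] has_derivative_linear by blast
  have "0 = frechet_derivative (K l) (at r) (\<Sum>m\<in>UNIV. c m *\<^sub>R Y m r)"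
    unfolding 0 by (simp add: linear_0[OF lin])
  also have "\<dots> = c l"
    by (simp add: linear_sum[OF lin] linear_cmul[OF lin] Y_K[OF r] if_distrib cong: if_cong)
  finally show ?thesis by simp
qed

lemma X_eq_sum_Y:
  assumes r: "r \<in> N1"
  shows "X r \<beta> = (\<Sum>m\<in>UNIV. (A r $ m \<bullet> \<beta>) *\<^sub>R Y m r)"
proof -
  have rN: "r \<in> N" using r N1_sub by blast
  have "(\<Sum>m\<in>UNIV. (A r $ m \<bullet> \<beta>) *\<^sub>R column m (R r)) = \<beta>"
  proof -
    have "(\<Sum>m\<in>UNIV. (A r $ m \<bullet> \<beta>) * R r $ j $ m) = \<beta> $ j" for j
    proof -
      have "(\<Sum>m\<in>UNIV. (A r $ m \<bullet> \<beta>) * R r $ j $ m) = (R r *v (A r *v \<beta>)) $ j"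
        by (simp add: matrix_vector_mult_def inner_vec_def mult.commute)
      then show ?thesis by (simp add: matrix_vector_mul_assoc A_R[OF r])
    qed
    then show ?thesis by (simp add: vec_eq_iff column_def)
  qed
  then have "X r \<beta> = X r (\<Sum>m\<in>UNIV. (A r $ m \<bullet> \<beta>) *\<^sub>R column m (R r))" by simp
  then show ?thesis
    unfolding Y_def by (simp add: linear_sum[OF linear_X[OF rN]] linear_cmul[OF linear_X[OF rN]])
qed

lemma rectified_chart:
  assumes r0: "r0 \<in> N1"
  obtains \<epsilon> N' \<psi> \<psi>' and \<iota> :: "'k \<Rightarrow> 'n" where "\<epsilon> > 0" "inj \<iota>" "N' \<subseteq> N1" "r0 \<in> N'"
    "smooth_diffeo (ball 0 \<epsilon>) N' \<psi>' \<psi>"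
    "\<And>l \<rho>. \<rho> \<in> ball 0 \<epsilon> \<Longrightarrow> frechet_derivative \<psi>' (at \<rho>) (axis (\<iota> l) 1) = Y l (\<psi>' \<rho>)"
proof (rule rectify_commuting_fields[where Y=Y, OF open_N1 r0 smooth_Y])
  show "c l = 0" if "(\<Sum>l\<in>UNIV. c l *\<^sub>R Y l r0) = 0" for c l by (rule Y_independent[OF r0 that])
  show "frechet_derivative (Y l) (at r) (Y m r) = frechet_derivative (Y m) (at r) (Y l r)" if "r \<in> N1" for l m r
    by (rule Y_commute[OF that])
  fix \<epsilon> N' \<psi> \<psi>' and \<iota> :: "'k \<Rightarrow> 'n"
  assume *: "0 < \<epsilon>" "inj \<iota>" "N' \<subseteq> N1" "\<psi>' 0 = r0" "smooth_diffeo (ball 0 \<epsilon>) N' \<psi>' \<psi>"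
    "\<And>l \<rho>. \<rho> \<in> ball 0 \<epsilon> \<Longrightarrow> frechet_derivative \<psi>' (at \<rho>) (axis (\<iota> l) 1) = Y l (\<psi>' \<rho>)"
  have "r0 \<in> N'" using smooth_diffeoD(5)[OF *(5), of 0] *(1,4) by simp
  then show thesis using that[of \<epsilon> \<iota> N' \<psi>' \<psi>] * by blast
qed

end

context lifted_pis
begin

lemma H_family: "momentum_family N W J H M N H M"
proof unfold_locales
  show "grad (H l) r \<bullet> X r \<beta> = M r $ l \<bullet> \<beta>" if "r \<in> N" for l r \<beta>
    using X_inner[OF that, of "grad (H l) r" \<beta> 0] H_field[OF that] by simp
qed (auto intro: open_N smooth_H M_invertible)

text \<open>
  In the chart that straightens the fields of the given integrals, each row \<open>R\<^sub>i\<close> with \<open>i\<close> cyclic is a closed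
  1-form along the leaves. Its primitive has the Hamiltonian field \<open>\<partial>/\<partial>y\<^sub>i\<close>, since \<open>R ** M\<close> is the
  identity. The remaining functions are combinations of the given integrals with the constant
  coefficients \<open>matrix_inv (M r0)\<close>, so that \<open>A r0\<close> is the identity and \<open>A\<close> is invertible near \<open>r0\<close>.
\<close>

lemma adapted_momenta_exist:
  assumes r0: "r0 \<in> N"
  obtains N2 K A where "momentum_family N W J H M N2 K A" "r0 \<in> N2"
    "\<And>r i. r \<in> N2 \<Longrightarrow> i \<in> J \<Longrightarrow> A r $ i = axis i 1"
proof -
  interpret h: momentum_family N W J H M N H M by (rule H_family)
  obtain \<epsilon> N' \<psi> \<psi>' and \<iota> :: "'k \<Rightarrow> 'n" where \<epsilon>: "\<epsilon> > 0" "inj \<iota>" "N' \<subseteq> N" "r0 \<in> N'"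
    and diff: "smooth_diffeo (ball 0 \<epsilon>) N' \<psi>' \<psi>"
    and d\<psi>': "\<And>l \<rho>. \<rho> \<in> ball 0 \<epsilon> \<Longrightarrow> frechet_derivative \<psi>' (at \<rho>) (axis (\<iota> l) 1) = h.Y l (\<psi>' \<rho>)"
    by (rule h.rectified_chart[OF r0]) blast
  interpret leaf_coords \<iota> by standard (rule \<epsilon>)
  note D = smooth_diffeoD[OF diff]
  have chain: "pd m (\<lambda>\<rho>. f (\<psi>' \<rho>)) \<rho> = frechet_derivative f (at (\<psi>' \<rho>)) (h.Y m (\<psi>' \<rho>))"
    if "smooth_on N' f" "\<rho> \<in> ball 0 \<epsilon>" for f :: "real^'n \<Rightarrow> real" and m \<rho>
    using frechet_derivative_chain[OF D(3) that(2,1) D(5)[OF that(2)]] d\<psi>'[OF that(2)] by simp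
  have smR: "smooth_on N' (\<lambda>r. h.R r $ i $ l)" for i l
    by (rule smooth_on_subset[OF h.smooth_R \<epsilon>(3)])
  have "\<exists>f. smooth_on (ball 0 \<epsilon>) f \<and> (\<forall>m. \<forall>\<rho>\<in>ball 0 \<epsilon>. pd m f \<rho> = h.R (\<psi>' \<rho>) $ i $ m)" if i: "i \<in> J" for i
  proof (rule leafwise_closed_1form_exact)
    show "smooth_on (ball 0 \<epsilon>) (\<lambda>\<rho>. h.R (\<psi>' \<rho>) $ i $ l)" for l
      by (rule smooth_on_compose[OF D(1,2,3) smR]) (use D(5) in auto)
    show "pd m (\<lambda>\<rho>. h.R (\<psi>' \<rho>) $ i $ l) \<rho> = pd l (\<lambda>\<rho>. h.R (\<psi>' \<rho>) $ i $ m) \<rho>" if \<rho>: "\<rho> \<in> ball 0 \<epsilon>" for l m \<rho>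
      unfolding chain[OF smR \<rho>] using h.cyclic_row_closed[of "\<psi>' \<rho>" i l m] D(5)[OF \<rho>] \<epsilon>(3) i by blast
  qed
  then obtain f where f: "\<And>i. i \<in> J \<Longrightarrow> smooth_on (ball 0 \<epsilon>) (f i)"
    "\<And>i m \<rho>. i \<in> J \<Longrightarrow> \<rho> \<in> ball 0 \<epsilon> \<Longrightarrow> pd m (f i) \<rho> = h.R (\<psi>' \<rho>) $ i $ m" by metis
  define K where "K l r = (if l \<in> J then f l (\<psi> r) else (\<Sum>m\<in>UNIV. matrix_inv (M r0) $ l $ m * H m r))" for l r
  define A where "A r = (\<chi> l. if l \<in> J then axis l 1 else (matrix_inv (M r0) ** M r) $ l)" for r
  have smK: "smooth_on N' (K l)" for l
  proof (cases "l \<in> J")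
    case True
    then have "K l = (\<lambda>r. f l (\<psi> r))" by (intro ext) (simp add: K_def)
    moreover have "smooth_on N' (\<lambda>r. f l (\<psi> r))"
      by (rule smooth_on_compose[OF D(2,1,4) f(1)[OF True]]) (use D(6) in auto)
    ultimately show ?thesis by simp
  next
    case False
    then have "K l = (\<lambda>r. \<Sum>m\<in>UNIV. matrix_inv (M r0) $ l $ m * H m r)" by (intro ext) (simp add: K_def)
    moreover have "smooth_on N' (\<lambda>r. \<Sum>m\<in>UNIV. matrix_inv (M r0) $ l $ m * H m r)"
      by (intro smooth_on_sum smooth_on_mult smooth_on_const D(2) smooth_on_subset[OF smooth_H \<epsilon>(3)])
    ultimately show ?thesis by simp
  qed
  have dK: "frechet_derivative (K l) (at r) (h.Y m r) = (if l \<in> J then h.R r $ l $ m else matrix_inv (M r0) $ l $ m)"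
    if r: "r \<in> N'" for l m r
  proof (cases "l \<in> J")
    case True
    have \<rho>: "\<psi> r \<in> ball 0 \<epsilon>" "\<psi>' (\<psi> r) = r" using D(6,8) r by auto
    have "pd m (f l) (\<psi> r) = pd m (\<lambda>\<rho>. K l (\<psi>' \<rho>)) (\<psi> r)"
      using frechet_derivative_cong_open[OF D(1) \<rho>(1), of "f l" "\<lambda>\<rho>. K l (\<psi>' \<rho>)"] True by (simp add: K_def D(7))
    then show ?thesis using chain[OF smK \<rho>(1), of l m] f(2)[OF True \<rho>(1), of m] True \<rho>(2) by simp
  next
    case False
    have rN: "r \<in> N" using r \<epsilon> by blast
    have K: "K l = (\<lambda>r. \<Sum>m\<in>UNIV. matrix_inv (M r0) $ l $ m * H m r)" using False by (intro ext) (simp add: K_def)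
    have dsum: "((\<lambda>r. \<Sum>m\<in>UNIV. matrix_inv (M r0) $ l $ m * H m r) has_derivative
        (\<lambda>v. \<Sum>m\<in>UNIV. matrix_inv (M r0) $ l $ m * frechet_derivative (H m) (at r) v)) (at r)"
      by (intro has_derivative_sum has_derivative_mult_right smooth_on_has_derivative[OF smooth_H rN])
    have "frechet_derivative (K l) (at r) (h.Y m r) =
        (\<Sum>n\<in>UNIV. matrix_inv (M r0) $ l $ n * frechet_derivative (H n) (at r) (h.Y m r))"
      unfolding K by (simp only: frechet_derivative_eqI[OF dsum])
    then show ?thesis using False by (simp add: h.Y_K[OF rN] if_distrib cong: if_cong)
  qed
  have KX: "grad (K l) r \<bullet> X r \<beta> = A r $ l \<bullet> \<beta>" if r: "r \<in> N'" for l r \<beta>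
  proof -
    have rN: "r \<in> N" using r \<epsilon> by blast
    let ?c = "\<lambda>m. if l \<in> J then h.R r $ l $ m else matrix_inv (M r0) $ l $ m"
    have "grad (K l) r \<bullet> X r \<beta> = (\<Sum>m\<in>UNIV. (M r $ m \<bullet> \<beta>) * frechet_derivative (K l) (at r) (h.Y m r))"
      unfolding h.X_eq_sum_Y[OF rN] grad_inner[OF smooth_on_has_derivative[OF smK r], symmetric]
      by (simp add: inner_sum_right)
    also have "\<dots> = (\<Sum>m\<in>UNIV. ?c m *\<^sub>R M r $ m) \<bullet> \<beta>"
      unfolding dK[OF r] by (simp add: inner_sum_left mult.commute)
    also have "(\<Sum>m\<in>UNIV. ?c m *\<^sub>R M r $ m) = A r $ l"
    proof (cases "l \<in> J")
      case True
      have "(\<Sum>m\<in>UNIV. h.R r $ l $ m *\<^sub>R M r $ m) = (h.R r ** M r) $ l"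
        by (simp add: vec_eq_iff matrix_matrix_mult_def)
      then show ?thesis using True h.A_R(2)[OF rN] by (simp add: A_def mat_def axis_def vec_eq_iff)
    next
      case False
      have "(\<Sum>m\<in>UNIV. matrix_inv (M r0) $ l $ m *\<^sub>R M r $ m) = (matrix_inv (M r0) ** M r) $ l"
        by (simp add: vec_eq_iff matrix_matrix_mult_def)
      then show ?thesis using False by (simp add: A_def)
    qed
    finally show ?thesis .
  qed
  have smA: "smooth_on N' (\<lambda>r. A r $ l $ m)" for l m
  proof (cases "l \<in> J")
    case True
    then show ?thesis by (simp add: A_def smooth_on_const[OF D(2)])
  next
    case False
    have "smooth_on N' (\<lambda>r. \<Sum>n\<in>UNIV. matrix_inv (M r0) $ l $ n * M r $ n $ m)"
      by (intro smooth_on_sum smooth_on_mult smooth_on_const D(2) smooth_on_subset[OF h.smooth_A \<epsilon>(3)])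
    then show ?thesis using False by (simp add: A_def matrix_matrix_mult_def)
  qed
  \<comment> \<open>\<open>A\<close> is invertible at \<open>r0\<close>, hence nearby\<close>
  define N2 where "N2 = N' \<inter> (\<lambda>r. det (A r)) -` (- {0})"
  have "open N2" unfolding N2_def
    by (rule continuous_open_preimage[OF smooth_on_continuous[OF smooth_on_det[OF D(2) smA]] D(2)]) auto
  moreover have "A r0 = mat 1"
    using matrix_inv_left_right(1)[OF M_invertible[OF r0]] by (simp add: A_def vec_eq_iff mat_def axis_def)
  then have "r0 \<in> N2" using \<epsilon>(4) by (simp add: N2_def)
  moreover have N2: "N2 \<subseteq> N'" by (auto simp: N2_def)
  ultimately have "momentum_family N W J H M N2 K A"
    by unfold_locales
       (use \<epsilon>(3) KX smooth_on_subset[OF smK] in \<open>auto simp: N2_def invertible_det_nz\<close>)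
  then show thesis using that[of N2 K A] \<open>r0 \<in> N2\<close> by (simp add: A_def)
qed

end

context momentum_family
begin

lemma PB_diff_right:
  assumes q: "q \<in> S" "S \<subseteq> N \<times> UNIV" and g: "smooth_on S g" and h: "smooth_on S h"
  shows "PB f (\<lambda>q. g q - h q) q = PB f g q - PB f h q"
proof -
  have "grad (\<lambda>q. g q - h q) q = grad g q - grad h q"
    by (rule grad_eqI)
       (use has_derivative_diff[OF has_derivative_grad[OF g q(1)] has_derivative_grad[OF h q(1)]] in \<open>simp add: inner_diff_left\<close>)
  then show ?thesis unfolding PB_def using W_simps(3)[OF subsetD[OF q(2,1)]] by simp
qed

text \<open>
  In a chart that straightens the fields \<open>Y\<^sub>l\<close>, minus \<open>P\<close> is a closed 2-form along the leaves. Subtracting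
  its primitive \<open>\<tau>\<close> from the conjugate fibre coordinates makes their brackets vanish and leaves the brackets
  with base functions as they are. The function \<open>\<psi>\<^sub>\<iota>\<^sub>l\<close> has the same Hamiltonian field as \<open>K\<^sub>l\<close>, because
  both have the derivative \<open>\<delta>\<^sub>l\<^sub>m\<close> along \<open>Y\<^sub>m\<close>.
\<close>

lemma canonical_chart:
  assumes r0: "r0 \<in> N1"
  obtains \<epsilon> N' \<psi> \<psi>' \<tau> and \<iota> :: "'k \<Rightarrow> 'n" where "\<epsilon> > 0" "inj \<iota>" "N' \<subseteq> N1"
    "smooth_diffeo (ball 0 \<epsilon>) N' \<psi>' \<psi>"
    "\<And>l. smooth_on (ball 0 \<epsilon>) (\<tau> l)"
    "\<And>l r \<beta>. r \<in> N' \<Longrightarrow> grad (\<lambda>r. \<psi> r $ \<iota> l) r \<bullet> X r \<beta> = A r $ l \<bullet> \<beta>"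
    "\<And>j l r y. r \<in> N' \<Longrightarrow> PB (\<lambda>q. \<psi> (fst q) $ j) (\<lambda>q. fibre_coord l q - \<tau> l (\<psi> (fst q))) (r, y) = (if j = \<iota> l then 1 else 0)"
    "\<And>l m r y. r \<in> N' \<Longrightarrow> PB (\<lambda>q. fibre_coord l q - \<tau> l (\<psi> (fst q))) (\<lambda>q. fibre_coord m q - \<tau> m (\<psi> (fst q))) (r, y) = 0"
proof -
  obtain \<epsilon> N' \<psi> \<psi>' and \<iota> :: "'k \<Rightarrow> 'n" where \<epsilon>: "\<epsilon> > 0" "inj \<iota>" "N' \<subseteq> N1" "r0 \<in> N'"
    and diff: "smooth_diffeo (ball 0 \<epsilon>) N' \<psi>' \<psi>"
    and d\<psi>': "\<And>l \<rho>. \<rho> \<in> ball 0 \<epsilon> \<Longrightarrow> frechet_derivative \<psi>' (at \<rho>) (axis (\<iota> l) 1) = Y l (\<psi>' \<rho>)"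
    by (rule rectified_chart[OF r0]) blast
  interpret lc: leaf_coords \<iota> by standard (rule \<epsilon>)
  note D = smooth_diffeoD[OF diff]
  have chain: "lc.pd m (\<lambda>\<rho>. f (\<psi>' \<rho>)) \<rho> = frechet_derivative f (at (\<psi>' \<rho>)) (Y m (\<psi>' \<rho>))"
    if "smooth_on N' f" "\<rho> \<in> ball 0 \<epsilon>" for f :: "real^'n \<Rightarrow> real" and m \<rho>
    using frechet_derivative_chain[OF D(3) that(2,1) D(5)[OF that(2)]] d\<psi>'[OF that(2)] by simp
  have smP: "smooth_on N' (\<lambda>r. - P l m r)" for l m
    by (rule smooth_on_minus[OF D(2) smooth_on_subset[OF smooth_P \<epsilon>(3)]])
  have dmP: "frechet_derivative (\<lambda>r. - P l m r) (at r) v = - frechet_derivative (P l m) (at r) v" if "r \<in> N1" for l m r v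
    using frechet_derivative_eqI[OF has_derivative_minus[OF smooth_on_has_derivative[OF smooth_P that]]] by simp
  have "\<exists>\<tau>. (\<forall>m. smooth_on (ball 0 \<epsilon>) (\<tau> m)) \<and>
    (\<forall>l m. \<forall>\<rho>\<in>ball 0 \<epsilon>. lc.pd l (\<tau> m) \<rho> - lc.pd m (\<tau> l) \<rho> = - P l m (\<psi>' \<rho>))"
  proof (rule lc.leafwise_closed_2form_exact)
    show "smooth_on (ball 0 \<epsilon>) (\<lambda>\<rho>. - P l m (\<psi>' \<rho>))" for l m
      by (rule smooth_on_compose[OF D(1,2,3) smP]) (use D(5) in auto)
    fix l m n and \<rho> :: "real^'n" assume \<rho>: "\<rho> \<in> ball 0 \<epsilon>"
    have r: "\<psi>' \<rho> \<in> N1" using D(5)[OF \<rho>] \<epsilon>(3) by blast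
    show "- P l m (\<psi>' \<rho>) = - (- P m l (\<psi>' \<rho>))" using P_antisym[OF r, of l m] by simp
    show "lc.pd l (\<lambda>\<rho>. - P m n (\<psi>' \<rho>)) \<rho> + lc.pd m (\<lambda>\<rho>. - P n l (\<psi>' \<rho>)) \<rho> + lc.pd n (\<lambda>\<rho>. - P l m (\<psi>' \<rho>)) \<rho> = 0"
      unfolding chain[OF smP \<rho>] dmP[OF r] using P_closed[OF r, of m n l] by linarith
  qed
  then obtain \<tau> where \<tau>: "\<And>m. smooth_on (ball 0 \<epsilon>) (\<tau> m)"
    "\<And>l m \<rho>. \<rho> \<in> ball 0 \<epsilon> \<Longrightarrow> lc.pd l (\<tau> m) \<rho> - lc.pd m (\<tau> l) \<rho> = - P l m (\<psi>' \<rho>)" by blast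
  \<comment> \<open>in the chart \<open>Y\<^sub>l\<close> is a coordinate field\<close>
  have \<psi>Y: "frechet_derivative \<psi> (at r) (Y l r) = axis (\<iota> l) 1" if r: "r \<in> N'" for l r
    using smooth_diffeo_inverse_derivative[OF diff D(6)[OF r], of "axis (\<iota> l) 1"] d\<psi>'[OF D(6)[OF r], of l] D(8)[OF r] by simp
  have sm\<psi>: "smooth_on N' (\<lambda>r. \<psi> r $ j)" for j by (rule smooth_on_vec_nth[OF D(2,4)])
  have \<psi>jY: "frechet_derivative (\<lambda>r. \<psi> r $ j) (at r) (Y l r) = (if j = \<iota> l then 1 else 0)" if r: "r \<in> N'" for j l r
  proof -
    have "frechet_derivative (\<lambda>r. \<psi> r $ j) (at r) (Y l r) = frechet_derivative \<psi> (at r) (Y l r) $ j"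
      using frechet_derivative_eqI[OF bounded_linear.has_derivative[OF bounded_linear_vec_nth smooth_on_has_derivative[OF D(4) r]]] by simp
    then show ?thesis by (simp add: \<psi>Y[OF r] axis_def)
  qed
  have smT: "smooth_on N' (\<lambda>r. \<tau> l (\<psi> r))" for l
    by (rule smooth_on_compose[OF D(2,1,4) \<tau>(1)]) (use D(6) in auto)
  have TY: "frechet_derivative (\<lambda>r. \<tau> l (\<psi> r)) (at r) (Y m r) = lc.pd m (\<tau> l) (\<psi> r)" if r: "r \<in> N'" for l m r
    using frechet_derivative_chain[OF D(4) r \<tau>(1) D(6)[OF r]] by (simp add: \<psi>Y[OF r])
  have sub: "N' \<times> (UNIV::(real^'k) set) \<subseteq> N \<times> UNIV" "N' \<subseteq> N" "N' \<subseteq> N1" using \<epsilon>(3) N1_sub by auto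
  have smf: "smooth_on (N' \<times> UNIV) (fibre_coord l)" for l
    by (rule smooth_on_subset[OF smooth_fibre_coord]) (use \<epsilon>(3) in auto)
  have smTf: "smooth_on (N' \<times> (UNIV::(real^'k) set)) (\<lambda>q. \<tau> l (\<psi> (fst q)))" for l
    by (rule smooth_on_fst[OF D(2) smT])
  let ?\<eta> = "\<lambda>l q. fibre_coord l q - \<tau> l (\<psi> (fst q))"
  show thesis
  proof (rule that[OF \<epsilon>(1,2,3) diff \<tau>(1)])
    show "grad (\<lambda>r. \<psi> r $ \<iota> l) r \<bullet> X r \<beta> = A r $ l \<bullet> \<beta>" if r: "r \<in> N'" for l r \<beta>
    proof -
      have rN1: "r \<in> N1" using r \<epsilon> by blast
      have "grad (\<lambda>r. \<psi> r $ \<iota> l) r \<bullet> X r \<beta> = (\<Sum>m\<in>UNIV. (A r $ m \<bullet> \<beta>) * frechet_derivative (\<lambda>r. \<psi> r $ \<iota> l) (at r) (Y m r))"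
        unfolding X_eq_sum_Y[OF rN1] grad_inner[OF smooth_on_has_derivative[OF sm\<psi> r], symmetric]
        by (simp add: inner_sum_right)
      also have "\<dots> = (\<Sum>m\<in>UNIV. if m = l then A r $ m \<bullet> \<beta> else 0)"
        by (rule sum.cong) (use \<epsilon>(2) in \<open>auto simp: \<psi>jY[OF r] inj_eq\<close>)
      finally show ?thesis by simp
    qed
    show "PB (\<lambda>q. \<psi> (fst q) $ j) (?\<eta> l) (r, y) = (if j = \<iota> l then 1 else 0)" if r: "r \<in> N'" for j l r y
    proof -
      have q: "(r, y) \<in> N' \<times> UNIV" using r by simp
      show ?thesis
        unfolding PB_diff_right[OF q sub(1) smf smTf] PB_base_fibre[OF sm\<psi> r sub(3)] \<psi>jY[OF r]
          PB_base_base[OF sm\<psi> r sub(2) smT] by simp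
    qed
    show "PB (?\<eta> l) (?\<eta> m) (r, y) = 0" if r: "r \<in> N'" for l m r y
    proof -
      have q: "(r, y) \<in> N' \<times> UNIV" and qN: "(r, y) \<in> N \<times> UNIV" using r sub by auto
      have rN1: "r \<in> N1" using r \<epsilon> by blast
      have 1: "PB (?\<eta> l) (fibre_coord m) (r, y) = P l m r - frechet_derivative (\<lambda>r. \<tau> l (\<psi> r)) (at r) (Y m r)"
        unfolding PB_antisym[OF qN, of "?\<eta> l"] PB_diff_right[OF q sub(1) smf smTf] PB_fibre_base[OF smT r sub(3)]
          PB_fibre_coords[OF rN1] using P_antisym[OF rN1, of l m] by simp
      have 2: "PB (?\<eta> l) (\<lambda>q. \<tau> m (\<psi> (fst q))) (r, y) = - frechet_derivative (\<lambda>r. \<tau> m (\<psi> r)) (at r) (Y l r)"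
        unfolding PB_antisym[OF qN, of "?\<eta> l"] PB_diff_right[OF q sub(1) smf smTf] PB_base_fibre[OF smT r sub(3)]
          PB_base_base[OF smT r sub(2) smT] by simp
      show ?thesis
        unfolding PB_diff_right[OF q sub(1) smf smTf] 1 2 TY[OF r]
        using \<tau>(2)[OF D(6)[OF r], of m l] D(8)[OF r] by simp
    qed
  qed
qed

end

section \<open>From the cylinder to its universal cover\<close>

definition lift :: "'k::finite set \<Rightarrow> (real^'n::finite) \<times> (real^'k) \<Rightarrow> ('n, 'k) point" where
  "lift J q = (fst q, cov J (snd q))"

lemma lift_simps [simp]: "lift J (r, y) = (r, cov J y)" "fst (lift J q) = fst q"
  by (simp_all add: lift_def)

lemma cov_in_cyl: "cov J y \<in> cyl J"
  by (simp add: cov_def cyl_def)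

lemma cov_surj:
  assumes "u \<in> cyl J"
  obtains y where "u = cov J y"
proof
  show "u = cov J (\<chi> l. if l \<in> J then Arg (u $ l) else Re (u $ l))"
  proof (rule vec_eq_iff[THEN iffD2], rule allI)
    fix l
    have "if l \<in> J then cmod (u $ l) = 1 else u $ l \<in> \<real>" using assms by (auto simp: cyl_def)
    then show "u $ l = cov J (\<chi> l. if l \<in> J then Arg (u $ l) else Re (u $ l)) $ l"
      using rcis_cmod_Arg[of "u $ l"] by (auto simp: cov_def rcis_def split: if_splits)
  qed
qed

lemma cylinder_point:
  assumes "p \<in> N \<times> cyl J"
  obtains r y where "r \<in> N" "p = lift J (r, y)"
  using assms cov_surj by (metis SigmaE lift_simps(1))

lemma lift_in: "r \<in> N \<Longrightarrow> lift J (r, y) \<in> N \<times> cyl J"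
  by (simp add: cov_in_cyl)

lemma cov_periodic: "i \<in> J \<Longrightarrow> cov J (y + (2 * pi) *\<^sub>R axis i 1) = cov J y"
  by (auto simp: cov_def vec_eq_iff axis_def cis.ctr)

lemma cov_add: "cov J (y + y') = act J y (cov J y')"
  by (simp add: cov_def act_def vec_eq_iff cis_mult)

lemma frechet_derivative_translate:
  fixes F :: "'a::real_normed_vector \<Rightarrow> 'b::real_normed_vector"
  shows "frechet_derivative (\<lambda>q. F (q + c)) (at x) = frechet_derivative F (at (x + c))"
proof -
  have "((\<lambda>q. F (q + c)) has_derivative D) (at x) \<longleftrightarrow> (F has_derivative D) (at (x + c))" for D
  proof
    assume D: "((\<lambda>q. F (q + c)) has_derivative D) (at x)"
    have "((\<lambda>q. q - c) has_derivative (\<lambda>v. v)) (at (x + c))" by (auto intro!: derivative_eq_intros)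
    from has_derivative_compose[OF this, of "\<lambda>q. F (q + c)" D] D
    show "(F has_derivative D) (at (x + c))" by simp
  next
    assume D: "(F has_derivative D) (at (x + c))"
    have "((\<lambda>q. q + c) has_derivative (\<lambda>v. v)) (at x)" by (auto intro!: derivative_eq_intros)
    from has_derivative_compose[OF this D] show "((\<lambda>q. F (q + c)) has_derivative D) (at x)" .
  qed
  then show ?thesis unfolding frechet_derivative_def by simp
qed

text \<open>
  The derivative on the cylinder is taken at the origin of the translation action; in the universal cover
  this is a translation.
\<close>

lemma deriv_cyl_lift: "deriv_cyl J f (lift J q) v = frechet_derivative (\<lambda>q. f (lift J q)) (at q) v"
proof -
  have eq: "(\<lambda>(r, y). f (r, act J y (snd (lift J q)))) = (\<lambda>q'. f (lift J (q' + (0, snd q))))"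
    by (auto simp: lift_def cov_add[symmetric] fun_eq_iff)
  have "deriv_cyl J f (lift J q) = frechet_derivative (\<lambda>q'. f (lift J (q' + (0, snd q)))) (at (fst q, 0))"
    by (rule ext) (simp only: deriv_cyl_def eq lift_simps(2))
  also have "\<dots> = frechet_derivative (\<lambda>q. f (lift J q)) (at ((fst q, 0) + (0, snd q)))"
    by (rule frechet_derivative_translate)
  finally show ?thesis by simp
qed

lemma dif_lift: "dif J f (lift J q) = grad (\<lambda>q. f (lift J q)) q"
  unfolding dif_def grad_def deriv_cyl_lift ..

lemma smooth_cyl_lift: "smooth_cyl J N f \<longleftrightarrow> smooth_on (N \<times> UNIV) (\<lambda>q. f (lift J q))"
proof -
  have "(\<lambda>(r, y). f (r, cov J y)) = (\<lambda>q. f (lift J q))" by (auto simp: lift_def)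
  then show ?thesis by (simp add: smooth_cyl_def)
qed

lemma poisson_lifted_bivector:
  assumes N: "open N" and w: "poisson_structure J N w"
  shows "lifted_bivector N (\<lambda>q. w (lift J q))"
proof
  show "bilinear (w (lift J q))" "w (lift J q) \<alpha> \<alpha> = 0" if "q \<in> N \<times> UNIV" for q \<alpha>
  proof -
    have L: "lift J q \<in> N \<times> cyl J" using lift_in[of "fst q" N J "snd q"] that by auto
    have "\<forall>p\<in>N \<times> cyl J. bilinear (w p) \<and> (\<forall>\<alpha>. w p \<alpha> \<alpha> = 0)"
      using w unfolding poisson_structure_def by (elim conjE)
    note * = bspec[OF this L]
    show "bilinear (w (lift J q))" by (rule conjunct1[OF *])
    show "w (lift J q) \<alpha> \<alpha> = 0" by (rule conjunct2[OF *, THEN spec])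
  qed
  show "smooth_on (N \<times> UNIV) (\<lambda>q. w (lift J q) \<alpha> \<beta>)" for \<alpha> \<beta>
    using w unfolding poisson_structure_def smooth_cyl_lift by blast
qed fact

text \<open>
  A function on the cylinder whose lift has a prescribed gradient and no second derivatives at a given
  point. For a cyclic coordinate take \<open>sin (y\<^sub>l - y0\<^sub>l)\<close>, which is periodic.
\<close>

lemma test_function:
  fixes \<alpha> :: "(real^'n::finite) \<times> (real^'k::finite)" and y0 :: "real^'k"
  obtains f :: "('n, 'k) point \<Rightarrow> real" where "smooth_on UNIV (\<lambda>q. f (lift J q))"
    "grad (\<lambda>q. f (lift J q)) (r0, y0) = \<alpha>"
    "\<And>u v. frechet_derivative (\<lambda>z. frechet_derivative (\<lambda>q. f (lift J q)) (at z) u) (at (r0, y0)) v = 0"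
proof -
  let ?f = "\<lambda>p::('n, 'k) point. fst \<alpha> \<bullet> fst p + (\<Sum>l\<in>UNIV. snd \<alpha> $ l *
    (if l \<in> J then Im (cis (- (y0 $ l)) * snd p $ l) else Re (snd p $ l)))"
  define s where "s l t = (if l \<in> J then sin (t - y0 $ l) else t)" for l and t :: real
  define c where "c l t = (if l \<in> J then cos (t - y0 $ l) else 1)" for l and t :: real
  have fl: "(\<lambda>q. ?f (lift J q)) = (\<lambda>q. fst \<alpha> \<bullet> fst q + (\<Sum>l\<in>UNIV. snd \<alpha> $ l * s l (snd q $ l)))"
    by (rule ext, rule arg_cong2[where f="(+)"], simp, rule sum.cong)
       (auto simp: lift_def cov_def s_def sin_diff algebra_simps)
  have ds: "((\<lambda>q. s l (snd q $ l)) has_derivative (\<lambda>v. c l (snd q $ l) * snd v $ l)) (at q)" for l and q :: "(real^'n) \<times> (real^'k)"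
  proof -
    have 1: "((\<lambda>q::(real^'n) \<times> (real^'k). snd q $ l) has_derivative (\<lambda>v. snd v $ l)) (at q)"
      by (intro bounded_linear.has_derivative[OF bounded_linear_vec_nth] has_derivative_snd has_derivative_ident)
    have "(s l has_real_derivative c l t) (at t)" for t
      unfolding s_def c_def by (cases "l \<in> J") (auto intro!: derivative_eq_intros)
    then have 2: "(s l has_derivative (\<lambda>h. c l t * h)) (at t)" for t by (simp add: has_field_derivative_def)
    show ?thesis using has_derivative_compose[OF 1 2] .
  qed
  have dc: "((\<lambda>q. c l (snd q $ l)) has_derivative (\<lambda>v. 0)) (at (r0, y0))" for l
  proof -
    have 1: "((\<lambda>q::(real^'n) \<times> (real^'k). snd q $ l) has_derivative (\<lambda>v. snd v $ l)) (at (r0, y0))"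
      by (intro bounded_linear.has_derivative[OF bounded_linear_vec_nth] has_derivative_snd has_derivative_ident)
    have "(c l has_real_derivative 0) (at (y0 $ l))"
      unfolding c_def by (cases "l \<in> J") (auto intro!: derivative_eq_intros)
    then have 2: "(c l has_derivative (\<lambda>h. 0)) (at (snd (r0, y0) $ l))"
      using has_derivative_eq_rhs[OF has_field_derivative_imp_has_derivative, of "c l" 0 _ "\<lambda>h. 0"]
      by (simp add: fun_eq_iff)
    show ?thesis using has_derivative_compose[OF 1 2] .
  qed
  have d: "((\<lambda>q. ?f (lift J q)) has_derivative (\<lambda>v. fst \<alpha> \<bullet> fst v + (\<Sum>l\<in>UNIV. snd \<alpha> $ l * (c l (snd q $ l) * snd v $ l)))) (at q)" for q
    unfolding fl
    by (intro has_derivative_add has_derivative_sum has_derivative_mult_right ds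
        has_derivative_inner_right has_derivative_fst has_derivative_ident)
  show thesis
  proof (rule that[of ?f])
    have sy: "smooth_on (UNIV :: ((real^'n) \<times> (real^'k)) set) (\<lambda>q. snd q $ l)" for l
      by (rule smooth_on_vec_nth[OF open_UNIV smooth_on_linear_map[OF open_UNIV bounded_linear_snd]])
    have sn: "smooth_on (UNIV :: ((real^'n) \<times> (real^'k)) set) (\<lambda>q. cov J (snd q) $ l)" for l
    proof (cases "l \<in> J")
      case True
      have "smooth_on (UNIV :: ((real^'n) \<times> (real^'k)) set) (\<lambda>q. cis (snd q $ l))"
        by (rule smooth_on_compose[OF open_UNIV open_UNIV sy smooth_on_cis]) simp
      then show ?thesis using True by (simp add: cov_def)
    next
      case False
      have "smooth_on (UNIV :: ((real^'n) \<times> (real^'k)) set) (\<lambda>q. complex_of_real (snd q $ l))"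
        by (rule smooth_on_bounded_linear[OF open_UNIV bounded_linear_of_real sy])
      then show ?thesis using False by (simp add: cov_def)
    qed
    have sl: "smooth_on (UNIV :: ((real^'n) \<times> (real^'k)) set) (\<lambda>q. if l \<in> J then Im (cis (- (y0 $ l)) * cov J (snd q) $ l) else Re (cov J (snd q) $ l))" for l
    proof (cases "l \<in> J")
      case True
      have "bounded_linear (\<lambda>z. Im (cis (- (y0 $ l)) * z))"
        using bounded_linear_compose[OF bounded_linear_Im bounded_linear_mult_right] .
      from smooth_on_bounded_linear[OF open_UNIV this sn] True show ?thesis by simp
    next
      case False
      then show ?thesis using smooth_on_bounded_linear[OF open_UNIV bounded_linear_Re sn] by simp
    qed
    show "smooth_on UNIV (\<lambda>q. ?f (lift J q))"
      unfolding lift_def fst_conv snd_conv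
      by (intro smooth_on_add smooth_on_sum smooth_on_mult smooth_on_const open_UNIV sl
          smooth_on_linear_map bounded_linear_compose[OF bounded_linear_inner_right] bounded_linear_fst)
    show "grad (\<lambda>q. ?f (lift J q)) (r0, y0) = \<alpha>"
    proof (rule grad_eqI)
      have c1: "c l (y0 $ l) = 1" for l by (simp add: c_def)
      have "(\<lambda>v. fst \<alpha> \<bullet> fst v + (\<Sum>l\<in>UNIV. snd \<alpha> $ l * (c l (snd (r0, y0) $ l) * snd v $ l))) = (\<lambda>v. \<alpha> \<bullet> v)"
        by (auto simp: inner_prod_def inner_vec_def c1 fun_eq_iff)
      then show "((\<lambda>q. ?f (lift J q)) has_derivative (\<lambda>v. \<alpha> \<bullet> v)) (at (r0, y0))" using d[of "(r0, y0)"] by simp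
    qed
    fix u v :: "(real^'n) \<times> (real^'k)"
    have "(\<lambda>z. frechet_derivative (\<lambda>q. ?f (lift J q)) (at z) u) =
        (\<lambda>z. fst \<alpha> \<bullet> fst u + (\<Sum>l\<in>UNIV. snd \<alpha> $ l * (c l (snd z $ l) * snd u $ l)))"
      by (rule ext) (simp only: frechet_derivative_eqI[OF d])
    moreover have "((\<lambda>z. fst \<alpha> \<bullet> fst u + (\<Sum>l\<in>UNIV. snd \<alpha> $ l * (c l (snd z $ l) * snd u $ l))) has_derivative
        (\<lambda>v. 0 + (\<Sum>l\<in>UNIV. snd \<alpha> $ l * (0 * snd u $ l)))) (at (r0, y0))"
      by (intro has_derivative_add has_derivative_sum has_derivative_mult_right has_derivative_mult_left dc has_derivative_const)
    ultimately show "frechet_derivative (\<lambda>z. frechet_derivative (\<lambda>q. ?f (lift J q)) (at z) u) (at (r0, y0)) v = 0"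
      using frechet_derivative_eqI by fastforce
  qed
qed

text \<open>
  Test functions without second derivatives turn the Jacobi identity for periodic functions into the one
  in components.
\<close>

lemma poisson_lifted:
  assumes N: "open N" and w: "poisson_structure J N w"
  shows "lifted_poisson N (\<lambda>q. w (lift J q))"
proof -
  interpret lifted_bivector N "\<lambda>q. w (lift J q)" by (rule poisson_lifted_bivector[OF assms])
  show ?thesis
  proof unfold_locales
    fix q \<alpha> \<beta> \<gamma> :: "(real^'a) \<times> (real^'b)"
    assume q: "q \<in> N \<times> UNIV"
    obtain r0 y0 where q0: "q = (r0, y0)" by (cases q) blast
    obtain f where f: "smooth_on UNIV (\<lambda>q. f (lift J q))" "grad (\<lambda>q. f (lift J q)) q = \<alpha>"
      "\<And>u v. frechet_derivative (\<lambda>z. frechet_derivative (\<lambda>q. f (lift J q)) (at z) u) (at q) v = 0"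
      unfolding q0 by (rule test_function) blast
    obtain g where g: "smooth_on UNIV (\<lambda>q. g (lift J q))" "grad (\<lambda>q. g (lift J q)) q = \<beta>"
      "\<And>u v. frechet_derivative (\<lambda>z. frechet_derivative (\<lambda>q. g (lift J q)) (at z) u) (at q) v = 0"
      unfolding q0 by (rule test_function) blast
    obtain h where h: "smooth_on UNIV (\<lambda>q. h (lift J q))" "grad (\<lambda>q. h (lift J q)) q = \<gamma>"
      "\<And>u v. frechet_derivative (\<lambda>z. frechet_derivative (\<lambda>q. h (lift J q)) (at z) u) (at q) v = 0"
      unfolding q0 by (rule test_function) blast
    note sm = smooth_on_subset[OF f(1) subset_UNIV, of "N \<times> UNIV"] smooth_on_subset[OF g(1) subset_UNIV, of "N \<times> UNIV"]
      smooth_on_subset[OF h(1) subset_UNIV, of "N \<times> UNIV"]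
    have pb: "pbracket J w a b (lift J q) = PB (\<lambda>q. a (lift J q)) (\<lambda>q. b (lift J q)) q" for a b q
      by (simp add: pbracket_def PB_def dif_lift)
    have pb2: "(\<lambda>q. pbracket J w a b (lift J q)) = PB (\<lambda>q. a (lift J q)) (\<lambda>q. b (lift J q))" for a b
      using pb by blast
    have qc: "lift J q \<in> N \<times> cyl J" using q lift_in q0 by blast
    have "pbracket J w f (pbracket J w g h) (lift J q) + pbracket J w g (pbracket J w h f) (lift J q)
             + pbracket J w h (pbracket J w f g) (lift J q) = 0"
      by (rule w[unfolded poisson_structure_def, THEN conjunct2, THEN conjunct2, rule_format, OF _ _ _ qc])
         (use sm in \<open>simp_all add: smooth_cyl_lift\<close>)
    then have 0: "PB (\<lambda>q. f (lift J q)) (PB (\<lambda>q. g (lift J q)) (\<lambda>q. h (lift J q))) q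
        + PB (\<lambda>q. g (lift J q)) (PB (\<lambda>q. h (lift J q)) (\<lambda>q. f (lift J q))) q
        + PB (\<lambda>q. h (lift J q)) (PB (\<lambda>q. f (lift J q)) (\<lambda>q. g (lift J q))) q = 0"
      unfolding pb pb2 .
    have e: "PB a (PB b c) q = frechet_derivative (\<lambda>q'. w (lift J q') (grad b q) (grad c q)) (at q) (sh q (grad a q))"
      if "smooth_on (N \<times> UNIV) b" "smooth_on (N \<times> UNIV) c"
        "\<And>u v. frechet_derivative (\<lambda>z. frechet_derivative b (at z) u) (at q) v = 0"
        "\<And>u v. frechet_derivative (\<lambda>z. frechet_derivative c (at z) u) (at q) v = 0" for a b c
    proof -
      have "PB a (PB b c) q = frechet_derivative (PB b c) (at q) (sh q (grad a q))"
        by (rule PB_eq_derivative[OF q smooth_on_has_derivative[OF smooth_on_PB[OF open_NU order_refl that(1,2)] q]])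
      then show ?thesis unfolding PB_derivative[OF open_NU order_refl that(1,2) q] that(3,4) by simp
    qed
    show "frechet_derivative (\<lambda>q. w (lift J q) \<beta> \<gamma>) (at q) (\<Sum>b\<in>Basis. w (lift J q) \<alpha> b *\<^sub>R b) +
      frechet_derivative (\<lambda>q. w (lift J q) \<gamma> \<alpha>) (at q) (\<Sum>b\<in>Basis. w (lift J q) \<beta> b *\<^sub>R b) +
      frechet_derivative (\<lambda>q. w (lift J q) \<alpha> \<beta>) (at q) (\<Sum>b\<in>Basis. w (lift J q) \<gamma> b *\<^sub>R b) = 0"
      using 0 unfolding e[OF sm(2,3) g(3) h(3)] e[OF sm(3,1) h(3) f(3)] e[OF sm(1,2) f(3) g(3)] f(2) g(2) h(2) sh_def .
  qed
qed

lemma ham_lift: "ham J w f (lift J q) = (\<Sum>b\<in>Basis. w (lift J q) (grad (\<lambda>q. f (lift J q)) q) b *\<^sub>R b)"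
  by (simp add: ham_def sharp_def dif_lift)

text \<open>
  Row \<open>l\<close> consists of the fibre components of the field \<open>\<vartheta>\<^sub>l\<close>.
\<close>

definition theta_matrix :: "'k::finite set \<Rightarrow> (real^'n::finite \<Rightarrow> real^'k^'k) \<Rightarrow> (real^'n \<Rightarrow> real^'k^'k)
    \<Rightarrow> real^'n \<Rightarrow> real^'k^'k" where
  "theta_matrix J B C r = (\<chi> l. snd (theta J B C l (r, 0)))"

lemma theta_eq: "theta J B C l p = (0, theta_matrix J B C (fst p) $ l)"
  unfolding theta_matrix_def theta_def Let_def fst_conv vec_lambda_beta by simp

text \<open>
  Row \<open>k\<close> expresses \<open>\<partial>/\<partial>y\<^sup>k\<close> by the fields \<open>\<vartheta>\<close>: for a cyclic index,
  \<open>\<partial>\<^sub>k = C\<^sub>l\<^sub>k \<vartheta>\<^sub>l + B\<^sub>a\<^sub>k \<vartheta>\<^sub>a\<close>. It shows that these fields are a frame and that \<open>theta_matrix\<close> is smooth.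
\<close>

definition theta_inverse :: "'k::finite set \<Rightarrow> (real^'n::finite \<Rightarrow> real^'k^'k) \<Rightarrow> (real^'n \<Rightarrow> real^'k^'k)
    \<Rightarrow> real^'n \<Rightarrow> real^'k^'k" where
  "theta_inverse J B C r = (\<chi> k l. if k \<in> J then (if l \<in> J then C r $ l $ k else B r $ l $ k)
     else if k = l then 1 else 0)"

lemma theta_inverse_theta:
  assumes "invertible (block J (C r))"
  shows "theta_inverse J B C r ** theta_matrix J B C r = mat 1"
proof -
  let ?D = "matrix_inv (block J (C r))"
  have DC: "(\<Sum>l\<in>J. ?D $ \<nu> $ l * C r $ l $ k) = (if \<nu> = k then 1 else 0)" if k: "k \<in> J" for \<nu> k
  proof -
    have "(if \<nu> = k then 1 else 0) = (?D ** block J (C r)) $ \<nu> $ k"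
      by (simp add: matrix_inv_left_right[OF assms] mat_def)
    also have "\<dots> = (\<Sum>l\<in>UNIV. if l \<in> J then ?D $ \<nu> $ l * C r $ l $ k else 0)"
      unfolding matrix_matrix_mult_def using k by (auto simp: block_def intro!: sum.cong)
    also have "\<dots> = (\<Sum>l\<in>J. ?D $ \<nu> $ l * C r $ l $ k)" by (simp add: sum.If_cases)
    finally show ?thesis ..
  qed
  have th: "theta_matrix J B C r $ l $ m = (if l \<in> J then (if m \<in> J then ?D $ m $ l else - (\<Sum>\<nu>\<in>UNIV. B r $ m $ \<nu> * ?D $ \<nu> $ l))
      else if m = l then 1 else 0)" for l m
    by (simp add: theta_matrix_def theta_def Let_def matrix_matrix_mult_def axis_def)
  have "(theta_inverse J B C r ** theta_matrix J B C r) $ k $ m = mat 1 $ k $ m" for k m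
  proof (cases "k \<in> J")
    case False
    then have "(theta_inverse J B C r ** theta_matrix J B C r) $ k $ m = (\<Sum>l\<in>UNIV. if l = k then theta_matrix J B C r $ l $ m else 0)"
      by (simp add: matrix_matrix_mult_def theta_inverse_def mult_delta_left)
    then show ?thesis using False by (auto simp: th mat_def)
  next
    case True
    have split: "(\<Sum>l\<in>UNIV. g l) = (\<Sum>l\<in>J. g l) + (\<Sum>l\<in>-J. g l)" for g :: "'a \<Rightarrow> real"
      using sum.union_disjoint[of J "-J" g] by (simp add: Un_commute)
    have *: "(theta_inverse J B C r ** theta_matrix J B C r) $ k $ m =
        (\<Sum>l\<in>J. C r $ l $ k * theta_matrix J B C r $ l $ m) + (\<Sum>l\<in>-J. B r $ l $ k * theta_matrix J B C r $ l $ m)"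
      unfolding matrix_matrix_mult_def using True by (simp add: split theta_inverse_def)
    show ?thesis
    proof (cases "m \<in> J")
      case m: True
      have "(\<Sum>l\<in>-J. B r $ l $ k * theta_matrix J B C r $ l $ m) = 0"
        using m by (intro sum.neutral) (auto simp: th)
      moreover have "(\<Sum>l\<in>J. C r $ l $ k * theta_matrix J B C r $ l $ m) = (\<Sum>l\<in>J. ?D $ m $ l * C r $ l $ k)"
        using m by (intro sum.cong) (auto simp: th)
      ultimately show ?thesis using * DC[OF True, of m] by (auto simp: mat_def)
    next
      case m: False
      have "(\<Sum>l\<in>-J. B r $ l $ k * theta_matrix J B C r $ l $ m) = (\<Sum>l\<in>-J. if l = m then B r $ m $ k else 0)"
        by (intro sum.cong) (auto simp: th)
      also have "\<dots> = B r $ m $ k" using m by simp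
      finally have 1: "(\<Sum>l\<in>-J. B r $ l $ k * theta_matrix J B C r $ l $ m) = B r $ m $ k" .
      have "(\<Sum>l\<in>J. C r $ l $ k * theta_matrix J B C r $ l $ m) = - (\<Sum>l\<in>J. \<Sum>\<nu>\<in>UNIV. B r $ m $ \<nu> * (?D $ \<nu> $ l * C r $ l $ k))"
        using m by (simp add: th sum_distrib_left sum_negf mult_ac)
      also have "\<dots> = - (\<Sum>\<nu>\<in>UNIV. B r $ m $ \<nu> * (if \<nu> = k then 1 else 0))"
        by (subst sum.swap) (simp add: sum_distrib_left[symmetric] DC[OF True])
      finally have "(\<Sum>l\<in>J. C r $ l $ k * theta_matrix J B C r $ l $ m) = - B r $ m $ k"
        by (simp add: if_distrib cong: if_cong)
      then show ?thesis using * 1 m True by (auto simp: mat_def)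
    qed
  qed
  then show ?thesis by (simp add: vec_eq_iff)
qed

lemma theta_matrix_invertible:
  assumes "invertible (block J (C r))"
  shows "invertible (theta_matrix J B C r)" "invertible (theta_inverse J B C r)"
    "matrix_inv (theta_inverse J B C r) = theta_matrix J B C r"
proof -
  have 1: "theta_inverse J B C r ** theta_matrix J B C r = mat 1" by (rule theta_inverse_theta[of J C r B, OF assms])
  have 2: "theta_matrix J B C r ** theta_inverse J B C r = mat 1" using 1 matrix_left_right_inverse by blast
  show "invertible (theta_matrix J B C r)" "invertible (theta_inverse J B C r)"
    using 1 2 by (auto simp: invertible_def)
  then show "matrix_inv (theta_inverse J B C r) = theta_matrix J B C r"
    using 1 matrix_inv_left_right(1)[of "theta_inverse J B C r"]
    by (metis matrix_mul_assoc matrix_mul_lid matrix_mul_rid)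
qed

lemma smooth_theta:
  assumes "toroidal_domain J N B C"
  shows "smooth_on N (\<lambda>r. theta_inverse J B C r $ k $ l)" "smooth_on N (\<lambda>r. theta_matrix J B C r $ k $ l)"
proof -
  have N: "open N" and inv: "\<And>r. r \<in> N \<Longrightarrow> invertible (block J (C r))"
    using assms by (auto simp: toroidal_domain_def domain_def)
  show 1: "smooth_on N (\<lambda>r. theta_inverse J B C r $ k $ l)" for k l
    using assms N unfolding theta_inverse_def toroidal_domain_def
    by (cases "k \<in> J"; cases "l \<in> J"; cases "k = l") (auto intro: smooth_on_const)
  have "smooth_on N (\<lambda>r. matrix_inv (theta_inverse J B C r) $ k $ l)"
    by (rule smooth_on_matrix_inv[OF N 1]) (rule theta_matrix_invertible(2)[OF inv])
  then show "smooth_on N (\<lambda>r. theta_matrix J B C r $ k $ l)"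
    by (rule smooth_on_cong[OF N, rotated]) (simp add: theta_matrix_invertible(3) inv)
qed

lemma integral_is_basic:
  assumes tor: "toroidal_domain J N B C" and f: "f \<in> integrals J N (theta J B C)" and r: "r \<in> N"
  shows "f (lift J (r, y)) = f (lift J (r, 0))"
proof (rule vertically_constant[of N "\<lambda>q. f (lift J q)", OF _ r])
  show s: "smooth_on (N \<times> UNIV) (\<lambda>q. f (lift J q))"
    using f by (simp add: integrals_def smooth_cyl_lift)
  fix y :: "real^'a" and v :: "real^'a"
  have q: "(r, y) \<in> N \<times> UNIV" using r by simp
  have inv: "invertible (block J (C r))" using tor r by (simp add: toroidal_domain_def)
  have lin: "linear (\<lambda>v. frechet_derivative (\<lambda>q. f (lift J q)) (at (r, y)) (0, v))"
  proof -
    have "linear (\<lambda>v2::real^'a. (0::real^'b, v2))" by (rule linearI) auto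
    from linear_compose[OF this has_derivative_linear[OF smooth_on_has_derivative[OF s q]]]
    show ?thesis by (simp add: o_def)
  qed
  have "frechet_derivative (\<lambda>q. f (lift J q)) (at (r, y)) (0, theta_matrix J B C r $ l) = 0" for l
    using f lift_in[OF r, of J y] deriv_cyl_lift[of J f "(r, y)"] theta_eq[of J B C l "lift J (r, y)"]
    unfolding integrals_def by (metis (mono_tags, lifting) fst_conv lift_simps(2) mem_Collect_eq)
  then show "frechet_derivative (\<lambda>q. f (lift J q)) (at (r, y)) (0, v) = 0"
    using linear_zero_on_rows[OF theta_matrix_invertible(1)[of J C r B, OF inv] lin] by blast
qed

lemma basic_is_integral:
  assumes N: "open N" and g: "smooth_on N g"
  shows "(\<lambda>p. g (fst p)) \<in> integrals J N (theta J B C)"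
  unfolding integrals_def
proof (intro CollectI conjI allI ballI)
  show "smooth_cyl J N (\<lambda>p. g (fst p))"
    unfolding smooth_cyl_lift lift_simps by (rule smooth_on_fst[OF N g])
  fix l p assume "p \<in> N \<times> cyl J"
  then obtain r y where p: "r \<in> N" "p = lift J (r, y)" by (rule cylinder_point) blast
  have "frechet_derivative (\<lambda>q. g (fst q)) (at (r, y)) (0, theta_matrix J B C r $ l) = 0"
    by (rule frechet_derivative_vertical[OF smooth_on_fst[OF N g]]) (use p in \<open>auto intro!: derivative_eq_intros\<close>)
  then show "deriv_cyl J (\<lambda>p. g (fst p)) p (theta J B C l p) = 0"
    unfolding p(2) theta_eq deriv_cyl_lift by simp
qed

text \<open>
  Coefficients that are integrals of motion are functions on the base, so a base-dependent change of
  generators can be absorbed into them.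
\<close>

lemma generated_by_subset:
  assumes N: "open N" and c: "\<And>l m. smooth_on N (\<lambda>r. c r $ l $ m)"
    and X: "\<And>l p. p \<in> N \<times> cyl J \<Longrightarrow> X l p = (\<Sum>m\<in>UNIV. c (fst p) $ l $ m *\<^sub>R Z m p)"
    and tor: "toroidal_domain J N B C"
  shows "generated_by J N (integrals J N (theta J B C)) X \<subseteq> generated_by J N (integrals J N (theta J B C)) Z"
proof
  let ?S = "integrals J N (theta J B C)"
  fix F assume "F \<in> generated_by J N ?S X"
  then obtain s where s: "\<And>l. s l \<in> ?S" "\<And>p. p \<in> N \<times> cyl J \<Longrightarrow> F p = (\<Sum>l\<in>UNIV. s l p *\<^sub>R X l p)"
    unfolding generated_by_def by auto
  let ?t = "\<lambda>m p. \<Sum>l\<in>UNIV. s l (lift J (fst p, 0)) * c (fst p) $ l $ m"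
  have ss: "smooth_on N (\<lambda>r. s l (lift J (r, 0)))" for l
  proof -
    have 1: "smooth_on (N \<times> UNIV) (\<lambda>q. s l (lift J q))" using s(1)[of l] by (simp add: integrals_def smooth_cyl_lift)
    show ?thesis
      by (rule smooth_on_compose[OF N open_Times[OF N open_UNIV] _ 1])
         (auto intro!: smooth_on_linear_map N bounded_linear_Pair bounded_linear_ident bounded_linear_zero)
  qed
  have "?t m \<in> ?S" for m
    by (rule basic_is_integral[OF N, of "\<lambda>r. \<Sum>l\<in>UNIV. s l (lift J (r, 0)) * c r $ l $ m"])
       (intro smooth_on_sum smooth_on_mult ss c N)
  moreover have "F p = (\<Sum>m\<in>UNIV. ?t m p *\<^sub>R Z m p)" if p: "p \<in> N \<times> cyl J" for p
  proof -
    obtain r y where r: "r \<in> N" "p = lift J (r, y)" using p by (rule cylinder_point) blast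
    have "F p = (\<Sum>l\<in>UNIV. s l (lift J (r, 0)) *\<^sub>R (\<Sum>m\<in>UNIV. c r $ l $ m *\<^sub>R Z m p))"
      using s(2)[OF p] X[OF p] integral_is_basic[OF tor s(1) r(1), of _ y] r(2) by simp
    also have "\<dots> = (\<Sum>l\<in>UNIV. \<Sum>m\<in>UNIV. (s l (lift J (r, 0)) * c r $ l $ m) *\<^sub>R Z m p)"
      by (simp add: scaleR_sum_right)
    also have "\<dots> = (\<Sum>m\<in>UNIV. ?t m p *\<^sub>R Z m p)"
      by (subst sum.swap) (simp add: r(2) scaleR_sum_left)
    finally show ?thesis .
  qed
  ultimately show "F \<in> generated_by J N ?S Z" unfolding generated_by_def
    by (intro CollectI exI[of _ ?t]) blast
qed

section \<open>Trivializations and their coordinate fields\<close>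

text \<open>
  The fields \<open>\<vartheta>\<close> and the Hamiltonian fields of \<open>H\<close> are combinations of each other with coefficients from
  the base. The former are a frame of the fibre directions that does not depend on the point of the
  fibre, hence so are the latter.
\<close>

lemma partially_integrable_lifted:
  fixes J :: "'k::finite set" and N :: "(real^'n::finite) set"
  assumes tor: "toroidal_domain J N B C" and w: "poisson_structure J N w"
    and pis: "partially_integrable J N (theta J B C) w"
  obtains h M where "lifted_pis N (\<lambda>q. w (lift J q)) J h M"
proof -
  let ?S = "integrals J N (theta J B C)" and ?W = "\<lambda>q. w (lift J q)"
  have N: "open N" using tor by (simp add: toroidal_domain_def domain_def)
  interpret lp: lifted_poisson N ?W by (rule poisson_lifted[OF N w])
  obtain H where H: "\<And>l. H l \<in> ?S"
    and gen: "dyn_algebra J N (theta J B C) = generated_by J N ?S (\<lambda>l. ham J w (H l))"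
    using pis unfolding partially_integrable_def by blast
  have inv: "\<And>f g p. f \<in> ?S \<Longrightarrow> g \<in> ?S \<Longrightarrow> p \<in> N \<times> cyl J \<Longrightarrow> pbracket J w f g p = 0"
    using pis unfolding partially_integrable_def by (elim conjE) blast
  define h where "h l r = H l (lift J (r, 0))" for l r
  define M where "M r = (\<chi> l. snd (ham J w (H l) (lift J (r, 0))))" for r
  have basic: "s (lift J (r, y)) = s (lift J (r, 0))" if "s \<in> ?S" "r \<in> N" for s r y
    by (rule integral_is_basic[OF tor that])
  have smh: "smooth_on N (h l)" for l
  proof -
    have 1: "smooth_on (N \<times> UNIV) (\<lambda>q. H l (lift J q))" using H[of l] by (simp add: integrals_def smooth_cyl_lift)
    show ?thesis unfolding h_def
      by (rule smooth_on_compose[OF N open_Times[OF N open_UNIV] _ 1])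
         (auto intro!: smooth_on_linear_map N bounded_linear_Pair bounded_linear_ident bounded_linear_zero)
  qed
  have gradH: "grad (\<lambda>q. H l (lift J q)) (r, y) = (grad (h l) r, 0)" if "r \<in> N" for l r y
  proof -
    have "grad (\<lambda>q. H l (lift J q)) (r, y) = grad (\<lambda>q. h l (fst q)) (r, y)"
    proof (rule grad_cong[OF lp.open_NU])
      show "(r, y) \<in> N \<times> UNIV" using that by simp
      fix z :: "(real^'n) \<times> (real^'k)" assume "z \<in> N \<times> UNIV"
      then have "fst z \<in> N" by auto
      from basic[OF H this, of l "snd z"] show "H l (lift J z) = h l (fst z)"
        unfolding h_def by (simp only: prod.collapse)
    qed
    also have "\<dots> = (grad (h l) r, 0)" by (rule grad_fst[OF smh that])
    finally show ?thesis .
  qed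
  have mem: "X l \<in> generated_by J N ?S X" for X and l :: 'k
  proof -
    have "(\<lambda>p. if m = l then 1 else 0) \<in> ?S" for m
      by (rule basic_is_integral[OF N smooth_on_const[OF N]])
    moreover have "X l p = (\<Sum>m\<in>UNIV. (if m = l then 1 else 0) *\<^sub>R X m p)" for p
      by (simp add: if_distrib[of "\<lambda>c. c *\<^sub>R _"] cong: if_cong)
    ultimately show ?thesis
      unfolding generated_by_def by (intro CollectI exI[of _ "\<lambda>m p. if m = l then 1 else 0"]) blast
  qed
  \<comment> \<open>a combination of the fields \<open>\<vartheta>\<close> with base-dependent coefficients is constant on the fibre\<close>
  have hamM: "ham J w (H l) (lift J (r, y)) = (0, M r $ l)" if r: "r \<in> N" for l r y
  proof -
    have "ham J w (H l) \<in> generated_by J N ?S (theta J B C)"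
      using mem[of "\<lambda>l. ham J w (H l)" l] gen unfolding dyn_algebra_def by simp
    then obtain s where s: "\<And>m. s m \<in> ?S"
      "\<And>p. p \<in> N \<times> cyl J \<Longrightarrow> ham J w (H l) p = (\<Sum>m\<in>UNIV. s m p *\<^sub>R theta J B C m p)"
      unfolding generated_by_def by auto
    have *: "ham J w (H l) (lift J (r, y)) = (0, \<Sum>m\<in>UNIV. s m (lift J (r, 0)) *\<^sub>R theta_matrix J B C r $ m)" for y
      unfolding s(2)[OF lift_in[OF r]] theta_eq
      by (simp add: basic[OF s(1) r, of _ y] sum_prod prod_eq_iff fst_sum snd_sum del: lift_simps(1))
    show ?thesis using *[of y] *[of 0] by (simp add: M_def)
  qed
  have "lifted_pis N ?W J h M"
  proof unfold_locales
    show "w (lift J (r, y + (2 * pi) *\<^sub>R axis i 1)) = w (lift J (r, y))" if "i \<in> J" for i r y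
      using that by (simp add: cov_periodic)
    show "w (lift J q) (a, 0) (a', 0) = 0" if q: "q \<in> N \<times> UNIV" for q a a'
    proof -
      obtain r y where qq: "q = (r, y)" "r \<in> N" using q by auto
      have lin: "smooth_on N (\<lambda>r. a \<bullet> r)" for a :: "real^'n"
        by (intro smooth_on_linear_map N bounded_linear_inner_right)
      have gl: "grad (\<lambda>r. a \<bullet> r) r = a" for a r :: "real^'n"
        by (rule grad_eqI) (auto intro!: derivative_eq_intros)
      have "pbracket J w (\<lambda>p. a \<bullet> fst p) (\<lambda>p. a' \<bullet> fst p) (lift J q) = 0"
        by (intro inv basic_is_integral[OF N] lin) (use qq lift_in in blast)
      then show ?thesis
        unfolding pbracket_def dif_lift lift_simps(2) qq(1) grad_fst[OF lin qq(2)] gl .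
    qed
    show "smooth_on N (h l)" for l by (rule smh)
    show "w (lift J (r, y)) (grad (h l) r, 0) (0, \<beta>) = M r $ l \<bullet> \<beta>" if r: "r \<in> N" for l r y \<beta>
    proof -
      have q: "(r, y) \<in> N \<times> UNIV" using r by simp
      have "lp.sh (r, y) (grad (h l) r, 0) = (0, M r $ l)"
        using hamM[OF r, of l y] unfolding ham_lift gradH[OF r] lp.sh_def .
      then show ?thesis using lp.sh_inner[OF q, of "(grad (h l) r, 0)" "(0, \<beta>)"] by (simp add: inner_prod_def)
    qed
    show "invertible (M r)" if r: "r \<in> N" for r
    proof -
      have "\<exists>s. theta_matrix J B C r $ m = (\<Sum>l\<in>UNIV. s l *\<^sub>R M r $ l)" for m
      proof -
        have "theta J B C m \<in> generated_by J N ?S (\<lambda>l. ham J w (H l))"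
          using mem[of "theta J B C" m] gen unfolding dyn_algebra_def by simp
        then obtain s where s: "\<And>p. p \<in> N \<times> cyl J \<Longrightarrow> theta J B C m p = (\<Sum>l\<in>UNIV. s l p *\<^sub>R ham J w (H l) p)"
          unfolding generated_by_def by auto
        have "theta J B C m (lift J (r, 0)) = (\<Sum>l\<in>UNIV. s l (lift J (r, 0)) *\<^sub>R (0, M r $ l))"
          unfolding s[OF lift_in[OF r]] hamM[OF r] ..
        then have "theta_matrix J B C r $ m = (\<Sum>l\<in>UNIV. s l (lift J (r, 0)) *\<^sub>R M r $ l)"
          unfolding theta_eq by (simp add: prod_eq_iff snd_sum)
        then show ?thesis by (intro exI[of _ "\<lambda>l. s l (lift J (r, 0))"])
      qed
      then obtain s where s: "\<And>m. theta_matrix J B C r $ m = (\<Sum>l\<in>UNIV. s m l *\<^sub>R M r $ l)" by metis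
      have "(\<chi> m l. s m l) ** M r = theta_matrix J B C r"
        by (simp add: vec_eq_iff matrix_matrix_mult_def s)
      moreover have "theta_inverse J B C r ** theta_matrix J B C r = mat 1"
        by (rule theta_inverse_theta) (use tor r in \<open>simp add: toroidal_domain_def\<close>)
      ultimately have "(theta_inverse J B C r ** (\<chi> m l. s m l)) ** M r = mat 1"
        by (simp add: matrix_mul_assoc[symmetric])
      then show ?thesis using invertible_left_inverse by blast
    qed
  qed
  then show thesis by (rule that)
qed

lemma smooth_on_cov: "smooth_on UNIV (cov J)"
  unfolding cov_def
proof (rule smooth_on_vec_lambda[OF open_UNIV])
  fix l
  have sy: "smooth_on UNIV (\<lambda>y::real^'a. y $ l)"
    by (rule smooth_on_linear_map[OF open_UNIV bounded_linear_vec_nth])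
  show "smooth_on UNIV (\<lambda>y. if l \<in> J then cis (y $ l) else complex_of_real (y $ l))"
  proof (cases "l \<in> J")
    case True
    then show ?thesis using smooth_on_compose[OF open_UNIV open_UNIV sy smooth_on_cis] by simp
  next
    case False
    then show ?thesis using smooth_on_bounded_linear[OF open_UNIV bounded_linear_of_real sy] by simp
  qed
qed

lemma cov_has_derivative:
  "(cov J has_derivative (\<lambda>v. \<chi> l. if l \<in> J then v $ l *\<^sub>R (\<i> * cis (y $ l)) else complex_of_real (v $ l))) (at y)"
  unfolding cov_def vec_lambda_eq_sum_axis
proof (intro has_derivative_sum bounded_linear.has_derivative[OF bounded_linear_vec_axis])
  fix l
  have nth: "((\<lambda>y. y $ l) has_derivative (\<lambda>v. v $ l)) (at y)"
    by (rule bounded_linear.has_derivative[OF bounded_linear_vec_nth has_derivative_ident])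
  show "((\<lambda>y. if l \<in> J then cis (y $ l) else complex_of_real (y $ l)) has_derivative
      (\<lambda>v. if l \<in> J then v $ l *\<^sub>R (\<i> * cis (y $ l)) else complex_of_real (v $ l))) (at y)"
    using has_derivative_cis[OF nth] has_derivative_of_real[OF nth] by (cases "l \<in> J") simp_all
qed

text \<open>
  The tangent map of a map of the cylinder is the derivative of its lift.
\<close>

lemma tangent_lift:
  assumes "open S" "q \<in> S" and G: "\<And>q. q \<in> S \<Longrightarrow> G (lift J q) = lift J (g q)"
    and g: "(g has_derivative g') (at q)"
  shows "tangent J G (lift J q) v = g' v"
proof -
  let ?c = "\<lambda>v. \<chi> l. if l \<in> J then v $ l *\<^sub>R (\<i> * cis (snd (g q) $ l)) else complex_of_real (v $ l)"
  have "((\<lambda>q. (fst (g q), cov J (snd (g q)))) has_derivative (\<lambda>v. (fst (g' v), ?c (snd (g' v))))) (at q)"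
    by (intro has_derivative_Pair has_derivative_fst g has_derivative_compose[OF has_derivative_snd[OF g] cov_has_derivative])
  then have d: "((\<lambda>q. lift J (g q)) has_derivative (\<lambda>v. (fst (g' v), ?c (snd (g' v))))) (at q)"
    by (simp add: lift_def)
  have "frechet_derivative (\<lambda>q. G (lift J q)) (at q) = frechet_derivative (\<lambda>q. lift J (g q)) (at q)"
    by (rule frechet_derivative_cong_open[OF assms(1,2) G])
  then have D: "deriv_cyl J G (lift J q) v = (fst (g' v), ?c (snd (g' v)))"
    unfolding deriv_cyl_lift by (simp only: frechet_derivative_eqI[OF d])
  have "Im (cnj (cis t) * (x *\<^sub>R (\<i> * cis t))) = x" for t x :: real
  proof -
    have "cnj (cis t) * (x *\<^sub>R (\<i> * cis t)) = of_real x * \<i> * (cnj (cis t) * cis t)"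
      by (simp add: scaleR_conv_of_real mult_ac)
    also have "cnj (cis t) * cis t = 1" by (simp add: cis_cnj cis_mult)
    finally show ?thesis by simp
  qed
  then show ?thesis
    unfolding tangent_def D G[OF assms(2)]
    by (simp add: lift_def cov_def vec_eq_iff prod_eq_iff)
qed

definition row_comb :: "real^'k::finite \<Rightarrow> real^'k^'k \<Rightarrow> real^'k" where
  "row_comb y D = (\<chi> l. \<Sum>m\<in>UNIV. y $ m * D $ m $ l)"

lemma row_comb_mat_1: "row_comb y (mat 1) = y"
  by (simp add: row_comb_def vec_eq_iff mat_def if_distrib cong: if_cong)

lemma row_comb_mult: "row_comb (row_comb y D) E = row_comb y (D ** E)"
proof -
  have "(\<Sum>m\<in>UNIV. (\<Sum>n\<in>UNIV. y $ n * D $ n $ m) * E $ m $ l) = (\<Sum>n\<in>UNIV. y $ n * (\<Sum>m\<in>UNIV. D $ n $ m * E $ m $ l))" for l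
    by (simp add: sum_distrib_left sum_distrib_right mult.assoc) (rule sum.swap)
  then show ?thesis by (simp add: row_comb_def vec_eq_iff matrix_matrix_mult_def)
qed

lemma row_comb_add: "row_comb (y + z) D = row_comb y D + row_comb z D"
  and row_comb_minus: "row_comb (- y) D = - row_comb y D"
  by (simp_all add: row_comb_def vec_eq_iff distrib_right sum.distrib sum_negf)

text \<open>
  The map of the cylinder covered by \<open>y \<mapsto> c r + y D r\<close>, provided that the rows of \<open>D r\<close> with cyclic index
  are unit vectors. Only the noncyclic components of a point enter the sums; taking real parts makes
  these well defined outside the cylinder too.
\<close>

definition fibre_map :: "'k::finite set \<Rightarrow> (real^'n::finite \<Rightarrow> real^'k^'k) \<Rightarrow> (real^'n \<Rightarrow> real^'k)
    \<Rightarrow> ('n, 'k) point \<Rightarrow> ('n, 'k) point" where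
  "fibre_map J D c p = (fst p, \<chi> l.
     if l \<in> J then cis (c (fst p) $ l + (\<Sum>m\<in>-J. Re (snd p $ m) * D (fst p) $ m $ l)) * snd p $ l
     else of_real (c (fst p) $ l + (\<Sum>m\<in>-J. Re (snd p $ m) * D (fst p) $ m $ l)))"

lemma fibre_map_lift:
  assumes "\<And>i. i \<in> J \<Longrightarrow> D r $ i = axis i 1"
  shows "fibre_map J D c (lift J (r, y)) = lift J (r, c r + row_comb y (D r))"
proof -
  have "(\<Sum>m\<in>UNIV. y $ m * D r $ m $ l) = (\<Sum>m\<in>-J. y $ m * D r $ m $ l) + (if l \<in> J then y $ l else 0)" for l
  proof -
    have "(\<Sum>m\<in>UNIV. y $ m * D r $ m $ l) = (\<Sum>m\<in>-J. y $ m * D r $ m $ l) + (\<Sum>m\<in>J. y $ m * D r $ m $ l)"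
      using sum.union_disjoint[of "-J" J "\<lambda>m. y $ m * D r $ m $ l"] by (simp add: Un_commute)
    also have "(\<Sum>m\<in>J. y $ m * D r $ m $ l) = (\<Sum>m\<in>J. if m = l then y $ l else 0)"
      by (rule sum.cong) (auto simp: assms axis_def)
    finally show ?thesis by simp
  qed
  moreover have "(\<Sum>m\<in>-J. Re (cov J y $ m) * D r $ m $ l) = (\<Sum>m\<in>-J. y $ m * D r $ m $ l)" for l
    by (rule sum.cong) (auto simp: cov_def)
  ultimately show ?thesis
    by (simp add: fibre_map_def cov_def row_comb_def vec_eq_iff cis_mult[symmetric] add.assoc[symmetric])
qed

lemma continuous_on_fibre_map:
  fixes N :: "(real^'n::finite) set"
  assumes D: "\<And>m l. continuous_on N (\<lambda>r. D r $ m $ l)" and c: "\<And>l. continuous_on N (\<lambda>r. c r $ l)"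
  shows "continuous_on (N \<times> X) (fibre_map J D c)"
proof -
  have D': "continuous_on (N \<times> X) (\<lambda>p. D (fst p) $ m $ l)" and c': "continuous_on (N \<times> X) (\<lambda>p. c (fst p) $ l)" for m l
    by (rule continuous_on_compose2[OF D continuous_on_fst[OF continuous_on_id]], auto)
       (rule continuous_on_compose2[OF c continuous_on_fst[OF continuous_on_id]], auto)
  have s: "continuous_on (N \<times> X) (\<lambda>p. snd p $ l)" for l
    by (intro continuous_intros bounded_linear.continuous_on[OF bounded_linear_vec_nth])
  have k: "continuous_on (N \<times> X) (\<lambda>p. if l \<in> J then cis (c (fst p) $ l + (\<Sum>m\<in>-J. Re (snd p $ m) * D (fst p) $ m $ l)) * snd p $ l
     else of_real (c (fst p) $ l + (\<Sum>m\<in>-J. Re (snd p $ m) * D (fst p) $ m $ l)))" for l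
    by (cases "l \<in> J") (auto intro!: continuous_intros D' c' s)
  show ?thesis unfolding fibre_map_def
    by (intro continuous_on_Pair continuous_on_fst continuous_on_id continuous_on_vec_lambda k)
qed

lemma smooth_affine:
  fixes D :: "real^'n::finite \<Rightarrow> real^'k::finite^'k"
  assumes N: "open N" and D: "\<And>m l. smooth_on N (\<lambda>r. D r $ m $ l)" and c: "\<And>l. smooth_on N (\<lambda>r. c r $ l)"
  shows "smooth_on (N \<times> UNIV) (\<lambda>q. c (fst q) + row_comb (snd q) (D (fst q)))"
proof -
  have o: "open (N \<times> (UNIV::(real^'k) set))" using N by (intro open_Times open_UNIV)
  have s: "smooth_on (N \<times> UNIV) (\<lambda>q::(real^'n) \<times> (real^'k). c (fst q) $ l + (\<Sum>m\<in>UNIV. snd q $ m * D (fst q) $ m $ l))" for l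
    by (intro smooth_on_add smooth_on_sum smooth_on_mult o smooth_on_fst[OF N D] smooth_on_fst[OF N c]
        smooth_on_vec_nth smooth_on_linear_map bounded_linear_snd)
  have "smooth_on (N \<times> UNIV) (\<lambda>q::(real^'n) \<times> (real^'k). \<chi> l. c (fst q) $ l + (\<Sum>m\<in>UNIV. snd q $ m * D (fst q) $ m $ l))"
    by (rule smooth_on_vec_lambda[OF o s])
  then show ?thesis
    by (rule smooth_on_cong[OF o, rotated]) (simp add: row_comb_def vec_eq_iff)
qed

lemma smooth_cyl_fibre_map:
  fixes N :: "(real^'n::finite) set"
  assumes N: "open N" and D: "\<And>m l. smooth_on N (\<lambda>r. D r $ m $ l)" and c: "\<And>l. smooth_on N (\<lambda>r. c r $ l)"
    and rows: "\<And>r i. r \<in> N \<Longrightarrow> i \<in> J \<Longrightarrow> D r $ i = axis i 1"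
  shows "smooth_cyl J N (fibre_map J D c)"
  unfolding smooth_cyl_lift
proof -
  have o: "open (N \<times> (UNIV::(real^'a) set))" using N by (intro open_Times open_UNIV)
  have "smooth_on (N \<times> UNIV) (\<lambda>q. cov J (c (fst q) + row_comb (snd q) (D (fst q))))"
    by (rule smooth_on_compose[OF o open_UNIV smooth_affine[OF N D c] smooth_on_cov]) simp
  then have "smooth_on (N \<times> UNIV) (\<lambda>q. (fst q, cov J (c (fst q) + row_comb (snd q) (D (fst q)))))"
    by (rule smooth_on_Pair[OF o smooth_on_linear_map[OF o bounded_linear_fst]])
  then show "smooth_on (N \<times> UNIV) (\<lambda>q. fibre_map J D c (lift J q))"
    by (rule smooth_on_cong[OF o, rotated]) (auto simp: fibre_map_lift rows simp del: lift_simps(1), simp add: lift_def)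
qed

text \<open>
  Fibrewise affine maps with mutually inverse linear parts, the translation parts being matched by \<open>cc\<close>.
\<close>

lemma fibre_map_trivialization:
  fixes N :: "(real^'n::finite) set"
  assumes N: "open N" and D: "\<And>m l. smooth_on N (\<lambda>r. D r $ m $ l)" and E: "\<And>m l. smooth_on N (\<lambda>r. E r $ m $ l)"
    and c: "\<And>l. smooth_on N (\<lambda>r. c r $ l)" and c': "\<And>l. smooth_on N (\<lambda>r. c' r $ l)"
    and rowsD: "\<And>r i. r \<in> N \<Longrightarrow> i \<in> J \<Longrightarrow> D r $ i = axis i 1"
    and rowsE: "\<And>r i. r \<in> N \<Longrightarrow> i \<in> J \<Longrightarrow> E r $ i = axis i 1"
    and DE: "\<And>r. r \<in> N \<Longrightarrow> D r ** E r = mat 1" and ED: "\<And>r. r \<in> N \<Longrightarrow> E r ** D r = mat 1"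
    and cc: "\<And>r. r \<in> N \<Longrightarrow> c r = - row_comb (c' r) (D r)"
  shows "trivialization J N (fibre_map J E c') (fibre_map J D c)"
proof -
  have fD: "fibre_map J D c (lift J (r, y)) = lift J (r, c r + row_comb y (D r))" if "r \<in> N" for r y
    by (rule fibre_map_lift) (rule rowsD[OF that])
  have fE: "fibre_map J E c' (lift J (r, y)) = lift J (r, c' r + row_comb y (E r))" if "r \<in> N" for r y
    by (rule fibre_map_lift) (rule rowsE[OF that])
  have D_E: "fibre_map J D c (fibre_map J E c' p) = p" if p: "p \<in> N \<times> cyl J" for p
  proof -
    obtain r y where r: "r \<in> N" "p = lift J (r, y)" using p by (rule cylinder_point) blast
    have "c r + row_comb (c' r + row_comb y (E r)) (D r) = y"
      by (simp add: row_comb_add row_comb_mult ED[OF r(1)] row_comb_mat_1 cc[OF r(1)])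
    then show ?thesis unfolding r(2) fD[OF r(1)] fE[OF r(1)] by simp
  qed
  have E_D: "fibre_map J E c' (fibre_map J D c p) = p" if p: "p \<in> N \<times> cyl J" for p
  proof -
    obtain r y where r: "r \<in> N" "p = lift J (r, y)" using p by (rule cylinder_point) blast
    have "c' r + row_comb (c r + row_comb y (D r)) (E r) = y"
      unfolding cc[OF r(1)] row_comb_add row_comb_minus row_comb_mult DE[OF r(1)] row_comb_mat_1 by simp
    then show ?thesis unfolding r(2) fD[OF r(1)] fE[OF r(1)] by simp
  qed
  have mapD: "fibre_map J D c p \<in> N \<times> cyl J" and mapE: "fibre_map J E c' p \<in> N \<times> cyl J" if p: "p \<in> N \<times> cyl J" for p
  proof -
    obtain r y where r: "r \<in> N" "p = lift J (r, y)" using p by (rule cylinder_point) blast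
    show "fibre_map J D c p \<in> N \<times> cyl J" "fibre_map J E c' p \<in> N \<times> cyl J"
      unfolding r(2) fD[OF r(1)] fE[OF r(1)]
      by (rule lift_in[OF r(1)])+
  qed
  have "homeomorphism (N \<times> cyl J) (N \<times> cyl J) (fibre_map J E c') (fibre_map J D c)"
  proof (rule homeomorphismI)
    show "continuous_on (N \<times> cyl J) (fibre_map J E c')" "continuous_on (N \<times> cyl J) (fibre_map J D c)"
      by (intro continuous_on_fibre_map smooth_on_continuous D E c c')+
    show "fibre_map J E c' ` (N \<times> cyl J) \<subseteq> N \<times> cyl J" "fibre_map J D c ` (N \<times> cyl J) \<subseteq> N \<times> cyl J"
      using mapD mapE by blast+
  qed (use D_E E_D in blast)+
  then show ?thesis
    unfolding trivialization_def
    using smooth_cyl_fibre_map[OF N D c rowsD] smooth_cyl_fibre_map[OF N E c' rowsE] by (simp add: fibre_map_def)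
qed

text \<open>
  The components of a bivector in a chart \<open>\<Phi>\<close> are the brackets of the coordinate functions; \<open>G\<close> is the
  derivative of the inverse chart, so \<open>G e\<close> are the coordinate fields.
\<close>

lemma (in lifted_bivector) W_in_coordinates:
  fixes \<Phi> \<G> :: "'a \<times> 'b \<Rightarrow> 'a \<times> 'b"
  assumes q: "q \<in> N \<times> UNIV" and \<Phi>: "(\<Phi> has_derivative \<Phi>') (at q)"
    and inv: "\<And>v. G (\<Phi>' v) = v" and G: "linear G"
  shows "W q \<alpha> \<beta> = (\<Sum>e\<in>Basis. \<Sum>f\<in>Basis. ((\<alpha> \<bullet> G e) * (\<beta> \<bullet> G f)) * PB (\<lambda>q. \<Phi> q \<bullet> e) (\<lambda>q. \<Phi> q \<bullet> f) q)"
proof -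
  have grad: "grad (\<lambda>q. \<Phi> q \<bullet> e) q \<bullet> v = \<Phi>' v \<bullet> e" for e v
  proof -
    have d: "((\<lambda>q. \<Phi> q \<bullet> e) has_derivative (\<lambda>v. \<Phi>' v \<bullet> e)) (at q)"
      by (rule has_derivative_inner_left[OF \<Phi>])
    show ?thesis using grad_inner[of "\<lambda>q. \<Phi> q \<bullet> e" q v] d frechet_derivative_eqI[OF d] by simp
  qed
  have expand: "\<alpha> = (\<Sum>e\<in>Basis. (\<alpha> \<bullet> G e) *\<^sub>R grad (\<lambda>q. \<Phi> q \<bullet> e) q)" for \<alpha>
  proof -
    have "\<alpha> \<bullet> v = (\<Sum>e\<in>Basis. (\<alpha> \<bullet> G e) *\<^sub>R grad (\<lambda>q. \<Phi> q \<bullet> e) q) \<bullet> v" for v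
    proof -
      have "\<alpha> \<bullet> v = \<alpha> \<bullet> G (\<Phi>' v)" by (simp add: inv)
      also have "\<dots> = (\<Sum>e\<in>Basis. (\<Phi>' v \<bullet> e) * (\<alpha> \<bullet> G e))"
        by (subst linear_eq_sum_Basis[OF G]) (simp add: inner_sum_right)
      finally show ?thesis by (simp add: inner_sum_left grad mult.commute)
    qed
    then show ?thesis by (rule vector_eq_rdot[THEN iffD1, OF allI])
  qed
  have r: "W q \<gamma> \<beta> = (\<Sum>f\<in>Basis. (\<beta> \<bullet> G f) * W q \<gamma> (grad (\<lambda>q. \<Phi> q \<bullet> f) q))" for \<gamma>
    by (subst expand[of \<beta>]) (simp add: linear_sum[OF linear_W(1)[OF q]] W_simps(5)[OF q])
  have "W q \<alpha> \<beta> = (\<Sum>e\<in>Basis. (\<alpha> \<bullet> G e) * W q (grad (\<lambda>q. \<Phi> q \<bullet> e) q) \<beta>)"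
    by (subst expand[of \<alpha>]) (simp add: linear_sum[OF linear_W(2)[OF q]] W_simps(6)[OF q])
  also have "\<dots> = (\<Sum>e\<in>Basis. (\<alpha> \<bullet> G e) * (\<Sum>f\<in>Basis. (\<beta> \<bullet> G f) * W q (grad (\<lambda>q. \<Phi> q \<bullet> e) q) (grad (\<lambda>q. \<Phi> q \<bullet> f) q)))"
    by (simp only: r)
  finally show ?thesis by (simp add: PB_def sum_distrib_left mult.assoc)
qed

lemma sum_Basis_vec: "(\<Sum>e\<in>(Basis :: (real^'m::finite) set). f e) = (\<Sum>j\<in>UNIV. f (axis j 1))"
proof -
  have B: "(Basis :: (real^'m) set) = (\<lambda>j. axis j 1) ` UNIV" by (auto simp: Basis_vec_def)
  have "inj (\<lambda>j. axis j 1 :: real^'m)" by (auto simp: inj_def axis_eq_axis)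
  from sum.reindex[OF this, of f] show ?thesis unfolding B by (simp add: o_def)
qed

lemma sum_Basis_prod:
  fixes f :: "'a::euclidean_space \<times> 'b::euclidean_space \<Rightarrow> 'c::comm_monoid_add"
  shows "(\<Sum>e\<in>Basis. f e) = (\<Sum>i\<in>Basis. f (i, 0)) + (\<Sum>i\<in>Basis. f (0, i))"
proof -
  have "inj_on (\<lambda>u. (u::'a, 0::'b)) Basis" "inj_on (\<lambda>u. (0::'a, u::'b)) Basis"
    by (auto intro!: inj_onI)
  then show ?thesis
    unfolding Basis_prod_def by (subst sum.union_disjoint) (auto simp: sum.reindex)
qed

lemma canonical_bracket_sum:
  fixes c :: "(real^'n::finite) \<times> (real^'k::finite) \<Rightarrow> (real^'n) \<times> (real^'k) \<Rightarrow> real"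
  assumes \<iota>: "inj \<iota>"
    and c1: "\<And>i j. c (axis i 1, 0) (axis j 1, 0) = 0"
    and c2: "\<And>j l. c (axis j 1, 0) (0, axis l 1) = (if j = \<iota> l then 1 else 0)"
    and c3: "\<And>j l. c (0, axis l 1) (axis j 1, 0) = - (if j = \<iota> l then 1 else 0)"
    and c4: "\<And>l m. c (0, axis l 1) (0, axis m 1) = 0"
  shows "(\<Sum>e\<in>Basis. \<Sum>f\<in>Basis. ((\<alpha> \<bullet> G e) * (\<beta> \<bullet> G f)) * c e f) =
    (\<Sum>l\<in>UNIV. wedge (G (axis (\<iota> l) 1, 0)) (G (0, axis l 1)) \<alpha> \<beta>)"
proof -
  have "(\<Sum>e\<in>Basis. \<Sum>f\<in>Basis. ((\<alpha> \<bullet> G e) * (\<beta> \<bullet> G f)) * c e f) =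
      (\<Sum>j\<in>UNIV. \<Sum>l\<in>UNIV. (\<alpha> \<bullet> G (axis j 1, 0)) * (\<beta> \<bullet> G (0, axis l 1)) * (if j = \<iota> l then 1 else 0)) +
      (\<Sum>l\<in>UNIV. \<Sum>j\<in>UNIV. (\<alpha> \<bullet> G (0, axis l 1)) * (\<beta> \<bullet> G (axis j 1, 0)) * - (if j = \<iota> l then 1 else 0))"
    unfolding sum_Basis_prod sum_Basis_vec c1 c2 c3 c4 by simp
  also have "\<dots> = (\<Sum>l\<in>UNIV. (\<alpha> \<bullet> G (axis (\<iota> l) 1, 0)) * (\<beta> \<bullet> G (0, axis l 1))) +
      (\<Sum>l\<in>UNIV. - ((\<alpha> \<bullet> G (0, axis l 1)) * (\<beta> \<bullet> G (axis (\<iota> l) 1, 0))))"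
    by (subst sum.swap) (simp add: mult_delta_right if_distrib[of uminus] cong: if_cong)
  finally show ?thesis by (simp add: wedge_def sum_subtractf sum_negf)
qed

section \<open>Partial action-angle coordinates\<close>

lemma sum_rows_pair:
  fixes D E :: "real^'k::finite^'k"
  shows "(\<Sum>m\<in>UNIV. D $ l $ m *\<^sub>R (0 :: 'a::real_vector, E $ m)) = (0, (D ** E) $ l)"
  by (simp add: prod_eq_iff fst_sum snd_sum vec_eq_iff matrix_matrix_mult_def)

theorem theorem3:
  fixes J :: "'k::finite set"
    and N :: "(real^'n::finite) set"
    and B C :: "real^'n \<Rightarrow> real^'k^'k"
    and w :: "('n, 'k) bivector"
  assumes "toroidal_domain J N B C"
    and "poisson_structure J N w"
    and "partially_integrable J N (theta J B C) w"
  shows "\<exists>N' V \<psi> \<psi>' T T' \<iota>.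
    N' \<subseteq> N \<and> toroidal_domain J N' B C \<and>
    aa_coordinates J N' V \<psi> \<psi>' T T' \<iota> \<and>
    (\<forall>p\<in>N' \<times> cyl J. \<forall>\<alpha> \<beta>.
       w p \<alpha> \<beta> =
         (\<Sum>a\<in>-J. wedge (coord_field J \<psi> \<psi>' T T' (axis (\<iota> a) 1, 0) p)
                        (coord_field J \<psi> \<psi>' T T' (0, axis a 1) p) \<alpha> \<beta>)
       + (\<Sum>i\<in>J. wedge (coord_field J \<psi> \<psi>' T T' (axis (\<iota> i) 1, 0) p)
                       (coord_field J \<psi> \<psi>' T T' (0, axis i 1) p) \<alpha> \<beta>)) \<and>
    dyn_algebra J N' (theta J B C) =
      generated_by J N' (integrals J N' (theta J B C))
        (\<lambda>l. ham J w (\<lambda>p. \<psi> (fst p) $ \<iota> l))"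
proof -
  let ?W = "\<lambda>q. w (lift J q)" and ?th = "theta J B C"
  have N: "open N" "N \<noteq> {}" using assms(1) by (auto simp: toroidal_domain_def domain_def)
  obtain h M where pis: "lifted_pis N ?W J h M"
    by (rule partially_integrable_lifted[OF assms]) blast
  interpret L: lifted_pis N ?W J h M by (rule pis)
  obtain r0 where "r0 \<in> N" using N by blast
  obtain N2 K A where fam: "momentum_family N ?W J h M N2 K A" and r0: "r0 \<in> N2"
    and rows: "\<And>r i. r \<in> N2 \<Longrightarrow> i \<in> J \<Longrightarrow> A r $ i = axis i 1"
    by (rule L.adapted_momenta_exist[OF \<open>r0 \<in> N\<close>]) blast
  interpret F: momentum_family N ?W J h M N2 K A by (rule fam)
  obtain \<epsilon> N' \<psi> \<psi>' \<tau> and \<iota> :: "'k \<Rightarrow> 'n" where \<epsilon>: "\<epsilon> > 0" "inj \<iota>" "N' \<subseteq> N2"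
    and diff: "smooth_diffeo (ball 0 \<epsilon>) N' \<psi>' \<psi>"
    and \<tau>: "\<And>l. smooth_on (ball 0 \<epsilon>) (\<tau> l)"
    and momentum: "\<And>l r \<beta>. r \<in> N' \<Longrightarrow> grad (\<lambda>r. \<psi> r $ \<iota> l) r \<bullet> L.X r \<beta> = A r $ l \<bullet> \<beta>"
    and PB1: "\<And>j l r y. r \<in> N' \<Longrightarrow> L.PB (\<lambda>q. \<psi> (fst q) $ j) (\<lambda>q. F.fibre_coord l q - \<tau> l (\<psi> (fst q))) (r, y) = (if j = \<iota> l then 1 else 0)"
    and PB2: "\<And>l m r y. r \<in> N' \<Longrightarrow> L.PB (\<lambda>q. F.fibre_coord l q - \<tau> l (\<psi> (fst q))) (\<lambda>q. F.fibre_coord m q - \<tau> m (\<psi> (fst q))) (r, y) = 0"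
    by (rule F.canonical_chart[OF r0]) blast
  note D = smooth_diffeoD[OF diff]
  let ?V = "ball (0::real^'n) \<epsilon>"
  have N'N: "N' \<subseteq> N" using \<epsilon>(3) F.N1_sub by blast
  have smA: "smooth_on N' (\<lambda>r. A r $ l $ m)" and smR: "smooth_on N' (\<lambda>r. F.R r $ l $ m)" for l m
    by (rule smooth_on_subset[OF F.smooth_A \<epsilon>(3)], rule smooth_on_subset[OF F.smooth_R \<epsilon>(3)])
  have AR: "A r ** F.R r = mat 1" "F.R r ** A r = mat 1" if "r \<in> N'" for r
    using F.A_R that \<epsilon>(3) by blast+
  have rowsA: "A r $ i = axis i 1" if "r \<in> N'" "i \<in> J" for r i using rows that \<epsilon>(3) by blast
  have rowsR: "F.R r $ i = axis i 1" if r: "r \<in> N'" and i: "i \<in> J" for r i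
  proof -
    have "F.R r $ i $ j = (A r ** F.R r) $ i $ j" for j
      by (simp add: matrix_matrix_mult_def rowsA[OF r i] axis_def mult_delta_left)
    then show ?thesis by (simp add: AR[OF r] vec_eq_iff mat_def axis_def)
  qed
  have tor': "toroidal_domain J N' B C"
  proof -
    have "connected (\<psi>' ` ?V)"
      by (rule connected_continuous_image[OF smooth_on_continuous[OF D(3)] connected_ball])
    moreover have "\<psi>' ` ?V = N'" using diff by (simp add: smooth_diffeo_def homeomorphism_def)
    moreover have "\<psi>' ` ?V \<noteq> {}" using \<epsilon>(1) by simp
    ultimately have "domain N'" using D(2) by (simp add: domain_def)
    then show ?thesis using assms(1) N'N smooth_on_subset[OF _ N'N] unfolding toroidal_domain_def by blast
  qed
  \<comment> \<open>the new fibre coordinates are \<open>y R - \<tau>\<close>; thus \<open>y = (y' + \<tau>) A\<close> covers the inverse trivialization\<close>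
  define tv where "tv r = (\<chi> l. \<tau> l (\<psi> r))" for r
  define cA where "cA r = row_comb (tv r) (A r)" for r
  define cR where "cR r = - tv r" for r
  have smtv: "smooth_on N' (\<lambda>r. tv r $ l)" for l
    unfolding tv_def vec_lambda_beta by (rule smooth_on_compose[OF D(2,1,4) \<tau>]) (use D(6) in auto)
  have smcR: "smooth_on N' (\<lambda>r. cR r $ l)" for l
    unfolding cR_def using smooth_on_minus[OF D(2) smtv] by simp
  have smcA: "smooth_on N' (\<lambda>r. cA r $ l)" for l
    unfolding cA_def row_comb_def vec_lambda_beta by (intro smooth_on_sum smooth_on_mult smtv smA D(2))
  let ?T = "fibre_map J F.R cR" and ?T' = "fibre_map J A cA"
  have triv: "trivialization J N' ?T ?T'"
    by (rule fibre_map_trivialization[OF D(2) smA smR smcA smcR rowsA rowsR AR])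
       (auto simp: cA_def cR_def row_comb_minus)
  define \<Phi> where "\<Phi> q = (\<psi> (fst q), cR (fst q) + row_comb (snd q) (F.R (fst q)))" for q
  define \<G> where "\<G> q = (\<psi>' (fst q), cA (\<psi>' (fst q)) + row_comb (snd q) (A (\<psi>' (fst q))))" for q
  have oN': "open (N' \<times> (UNIV::(real^'k) set))" using D(2) by (intro open_Times open_UNIV)
  have oV: "open (?V \<times> (UNIV::(real^'k) set))" by (intro open_Times open_UNIV open_ball)
  have sm\<Phi>: "smooth_on (N' \<times> UNIV) \<Phi>"
    unfolding \<Phi>_def by (intro smooth_on_Pair oN' smooth_on_fst[OF D(2,4)] smooth_affine D(2) smR smcR)
  have sm\<G>: "smooth_on (?V \<times> UNIV) \<G>"
  proof -
    have a: "smooth_on ?V (\<lambda>\<rho>. A (\<psi>' \<rho>) $ l $ m)" and c: "smooth_on ?V (\<lambda>\<rho>. cA (\<psi>' \<rho>) $ l)" for l m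
      by (rule smooth_on_compose[OF D(1,2,3) smA], use D(5) in blast, rule smooth_on_compose[OF D(1,2,3) smcA], use D(5) in blast)
    show ?thesis unfolding \<G>_def
      using smooth_on_Pair[OF oV smooth_on_fst[OF D(1,3)] smooth_affine[OF D(1) a c]] .
  qed
  have \<Phi>V: "\<Phi> q \<in> ?V \<times> UNIV" if "q \<in> N' \<times> UNIV" for q
    using that D(6)[of "fst q"] by (auto simp: \<Phi>_def)
  have \<G>\<Phi>: "\<G> (\<Phi> q) = q" if "q \<in> N' \<times> UNIV" for q
  proof -
    obtain r y where q: "q = (r, y)" "r \<in> N'" using \<open>q \<in> N' \<times> UNIV\<close> by blast
    have "cA r + row_comb (cR r + row_comb y (F.R r)) (A r) = y"
      unfolding cA_def cR_def row_comb_add row_comb_minus row_comb_mult AR[OF q(2)] row_comb_mat_1 by simp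
    then show ?thesis using q by (simp add: \<G>_def \<Phi>_def D(8))
  qed
  have T_lift: "?T (lift J (r, y)) = lift J (r, snd (\<Phi> (r, y)))" if r: "r \<in> N'" for r y
    unfolding \<Phi>_def fst_conv snd_conv by (rule fibre_map_lift) (rule rowsR[OF r])
  have field: "coord_field J \<psi> \<psi>' ?T ?T' e (lift J q) = frechet_derivative \<G> (at (\<Phi> q)) e"
    if q: "q \<in> N' \<times> UNIV" for q e
  proof -
    obtain r y where qq: "q = (r, y)" "r \<in> N'" using q by blast
    have "(\<psi> (fst (lift J q)), snd (?T (lift J q))) = lift J (\<Phi> q)"
      unfolding qq(1) T_lift[OF qq(2)] by (simp add: lift_def \<Phi>_def)
    then have "coord_field J \<psi> \<psi>' ?T ?T' e (lift J q) = tangent J (\<lambda>(\<rho>, u). ?T' (\<psi>' \<rho>, u)) (lift J (\<Phi> q)) e"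
      unfolding coord_field_def by simp
    also have "\<dots> = frechet_derivative \<G> (at (\<Phi> q)) e"
    proof (rule tangent_lift[OF oV \<Phi>V[OF q] _ smooth_on_has_derivative[OF sm\<G> \<Phi>V[OF q]]])
      fix z :: "(real^'n) \<times> (real^'k)" assume z: "z \<in> ?V \<times> UNIV"
      obtain \<rho> y where zz: "z = (\<rho>, y)" "\<rho> \<in> ?V" using z by blast
      have "fibre_map J A cA (lift J (\<psi>' \<rho>, y)) = lift J (\<psi>' \<rho>, cA (\<psi>' \<rho>) + row_comb y (A (\<psi>' \<rho>)))"
        by (rule fibre_map_lift) (rule rowsA[OF D(5)[OF zz(2)]])
      then show "(\<lambda>(\<rho>, u). ?T' (\<psi>' \<rho>, u)) (lift J z) = lift J (\<G> z)"
        by (simp add: zz \<G>_def)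
    qed
    finally show ?thesis .
  qed
  have canonical: "w p \<alpha> \<beta> =
         (\<Sum>a\<in>-J. wedge (coord_field J \<psi> \<psi>' ?T ?T' (axis (\<iota> a) 1, 0) p)
                        (coord_field J \<psi> \<psi>' ?T ?T' (0, axis a 1) p) \<alpha> \<beta>)
       + (\<Sum>i\<in>J. wedge (coord_field J \<psi> \<psi>' ?T ?T' (axis (\<iota> i) 1, 0) p)
                       (coord_field J \<psi> \<psi>' ?T ?T' (0, axis i 1) p) \<alpha> \<beta>)"
    if p: "p \<in> N' \<times> cyl J" for p \<alpha> \<beta>
  proof -
    obtain r y where r: "r \<in> N'" "p = lift J (r, y)" using p by (rule cylinder_point) blast
    let ?q = "(r, y)"
    have q: "?q \<in> N' \<times> UNIV" and qN: "?q \<in> N \<times> UNIV" using r(1) N'N by auto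
    let ?G = "frechet_derivative \<G> (at (\<Phi> ?q))"
    have G\<Phi>: "?G (frechet_derivative \<Phi> (at ?q) v) = v" for v
    proof -
      have "frechet_derivative (\<lambda>q. \<G> (\<Phi> q)) (at ?q) = frechet_derivative (\<lambda>q. q) (at ?q)"
        by (rule frechet_derivative_cong_open[OF oN' q \<G>\<Phi>])
      also have "\<dots> = (\<lambda>v. v)" by (rule frechet_derivative_eqI) simp
      finally show ?thesis using frechet_derivative_chain[OF sm\<Phi> q sm\<G> \<Phi>V[OF q], of v] by simp
    qed
    have lin: "linear ?G" using smooth_on_has_derivative[OF sm\<G> \<Phi>V[OF q]] has_derivative_linear by blast
    have comp1: "(\<lambda>q. \<Phi> q \<bullet> (axis j 1, 0)) = (\<lambda>q. \<psi> (fst q) $ j)" for j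
      by (simp add: \<Phi>_def inner_prod_def inner_axis)
    have comp2: "(\<lambda>q. \<Phi> q \<bullet> (0, axis l 1)) = (\<lambda>q. F.fibre_coord l q - \<tau> l (\<psi> (fst q)))" for l
      by (simp add: \<Phi>_def inner_prod_def inner_axis cR_def tv_def row_comb_def F.fibre_coord_def)
    have sm\<psi>: "smooth_on N' (\<lambda>r. \<psi> r $ j)" for j by (rule smooth_on_vec_nth[OF D(2,4)])
    have "w p \<alpha> \<beta> = (\<Sum>e\<in>Basis. \<Sum>f\<in>Basis. ((\<alpha> \<bullet> ?G e) * (\<beta> \<bullet> ?G f)) * L.PB (\<lambda>q. \<Phi> q \<bullet> e) (\<lambda>q. \<Phi> q \<bullet> f) ?q)"
      unfolding r(2) by (rule L.W_in_coordinates[OF qN smooth_on_has_derivative[OF sm\<Phi> q] G\<Phi> lin])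
    also have "\<dots> = (\<Sum>l\<in>UNIV. wedge (?G (axis (\<iota> l) 1, 0)) (?G (0, axis l 1)) \<alpha> \<beta>)"
    proof (rule canonical_bracket_sum[OF \<epsilon>(2)], unfold comp1 comp2)
      show "L.PB (\<lambda>q. \<psi> (fst q) $ i) (\<lambda>q. \<psi> (fst q) $ j) ?q = 0" for i j
        by (rule L.PB_base_base[OF sm\<psi> r(1) N'N sm\<psi>])
      show "L.PB (\<lambda>q. \<psi> (fst q) $ j) (\<lambda>q. F.fibre_coord l q - \<tau> l (\<psi> (fst q))) ?q = (if j = \<iota> l then 1 else 0)" for j l
        by (rule PB1[OF r(1)])
      show "L.PB (\<lambda>q. F.fibre_coord l q - \<tau> l (\<psi> (fst q))) (\<lambda>q. \<psi> (fst q) $ j) ?q = - (if j = \<iota> l then 1 else 0)" for j l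
        unfolding L.PB_antisym[OF qN, of "\<lambda>q. F.fibre_coord l q - \<tau> l (\<psi> (fst q))"] PB1[OF r(1)] ..
      show "L.PB (\<lambda>q. F.fibre_coord l q - \<tau> l (\<psi> (fst q))) (\<lambda>q. F.fibre_coord m q - \<tau> m (\<psi> (fst q))) ?q = 0" for l m
        by (rule PB2[OF r(1)])
    qed
    also have "\<dots> = (\<Sum>l\<in>-J. wedge (?G (axis (\<iota> l) 1, 0)) (?G (0, axis l 1)) \<alpha> \<beta>)
        + (\<Sum>l\<in>J. wedge (?G (axis (\<iota> l) 1, 0)) (?G (0, axis l 1)) \<alpha> \<beta>)"
      using sum.union_disjoint[of "-J" J "\<lambda>l. wedge (?G (axis (\<iota> l) 1, 0)) (?G (0, axis l 1)) \<alpha> \<beta>"]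
      by (simp add: Un_commute)
    finally show ?thesis unfolding r(2) field[OF q] .
  qed
  \<comment> \<open>the Hamiltonian fields of the actions have the components \<open>A\<close>, hence differ from \<open>\<vartheta>\<close> by invertible matrices over the base\<close>
  have hamI: "ham J w (\<lambda>p. \<psi> (fst p) $ \<iota> l) p = (0, A (fst p) $ l)" if p: "p \<in> N' \<times> cyl J" for l p
  proof -
    obtain r y where r: "r \<in> N'" "p = lift J (r, y)" using p by (rule cylinder_point) blast
    have rN: "r \<in> N" and qN: "(r, y) \<in> N \<times> UNIV" using r N'N by auto
    have "ham J w (\<lambda>p. \<psi> (fst p) $ \<iota> l) p = L.sh (r, y) (grad (\<lambda>r. \<psi> r $ \<iota> l) r, 0)"
      unfolding r(2) ham_lift lift_simps(2) grad_fst[OF smooth_on_vec_nth[OF D(2,4)] r(1)] L.sh_def ..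
    also have "\<dots> = (0, A r $ l)"
      unfolding L.sh_horizontal[OF qN] L.X_inner[OF rN, symmetric] momentum[OF r(1)] by (simp add: euclidean_representation)
    finally show ?thesis by (simp add: r(2))
  qed
  let ?S = "integrals J N' ?th"
  have inv: "invertible (block J (C r))" if "r \<in> N'" for r using tor' that by (simp add: toroidal_domain_def)
  note smTh = smooth_theta[OF tor']
  have "generated_by J N' ?S ?th \<subseteq> generated_by J N' ?S (\<lambda>l. ham J w (\<lambda>p. \<psi> (fst p) $ \<iota> l))"
  proof (rule generated_by_subset[OF D(2) _ _ tor', where c="\<lambda>r. theta_matrix J B C r ** F.R r"])
    show "smooth_on N' (\<lambda>r. (theta_matrix J B C r ** F.R r) $ l $ m)" for l m
      unfolding matrix_matrix_mult_def vec_lambda_beta by (intro smooth_on_sum smooth_on_mult smTh(2) smR D(2))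
    show "?th l p = (\<Sum>m\<in>UNIV. (theta_matrix J B C (fst p) ** F.R (fst p)) $ l $ m *\<^sub>R ham J w (\<lambda>p. \<psi> (fst p) $ \<iota> m) p)"
      if p: "p \<in> N' \<times> cyl J" for l p
    proof -
      have r: "fst p \<in> N'" using p by auto
      show ?thesis
        unfolding hamI[OF p] sum_rows_pair theta_eq matrix_mul_assoc[symmetric] AR(2)[OF r] matrix_mul_rid ..
    qed
  qed
  moreover have "generated_by J N' ?S (\<lambda>l. ham J w (\<lambda>p. \<psi> (fst p) $ \<iota> l)) \<subseteq> generated_by J N' ?S ?th"
  proof (rule generated_by_subset[OF D(2) _ _ tor', where c="\<lambda>r. A r ** theta_inverse J B C r"])
    show "smooth_on N' (\<lambda>r. (A r ** theta_inverse J B C r) $ l $ m)" for l m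
      unfolding matrix_matrix_mult_def vec_lambda_beta by (intro smooth_on_sum smooth_on_mult smTh(1) smA D(2))
    show "ham J w (\<lambda>p. \<psi> (fst p) $ \<iota> l) p = (\<Sum>m\<in>UNIV. (A (fst p) ** theta_inverse J B C (fst p)) $ l $ m *\<^sub>R ?th m p)"
      if p: "p \<in> N' \<times> cyl J" for l p
    proof -
      have r: "fst p \<in> N'" using p by auto
      show ?thesis
        unfolding hamI[OF p] theta_eq sum_rows_pair matrix_mul_assoc[symmetric]
          theta_inverse_theta[of J C "fst p" B, OF inv[OF r]] matrix_mul_rid ..
    qed
  qed
  ultimately have gen: "dyn_algebra J N' ?th = generated_by J N' ?S (\<lambda>l. ham J w (\<lambda>p. \<psi> (fst p) $ \<iota> l))"
    unfolding dyn_algebra_def by blast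
  have "aa_coordinates J N' ?V \<psi> \<psi>' ?T ?T' \<iota>"
    unfolding aa_coordinates_def using smooth_diffeo_sym[OF diff] triv \<epsilon>(2) by blast
  note * = N'N tor' this canonical gen
  show ?thesis
    by (rule exI[of _ N'], rule exI[of _ ?V], rule exI[of _ \<psi>], rule exI[of _ \<psi>'],
        rule exI[of _ ?T], rule exI[of _ ?T'], rule exI[of _ \<iota>]) (intro conjI ballI allI *)
qed

end
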